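(* Let $L$ be a one-dimensional mixed-type Kimura operator on $[0,1]$ and let $\mathcal Q_t=e^{tL}$. (1) If there is only one tangent endpoint $p\in\{0,1\}$, then for any point $x\in[0,1]$ that is not a quadratic endpoint, the transition probability $p_t(x,\cdot)$ converges exponentially, as $t\to\infty$, to the Dirac measure $\delta(p)$ in Wasserstein distance. (2) If there are two tangent endpoints, then there exists a function $S_0$ on $[0,1]$ satisfying $S_0(0)=0$, $S_0(1)=1$ and $LS_0=0$, such that for any probability measure $v$ on $[0,1]$, $\mathcal Q_t^*v$ converges exponentially, as $t\to\infty$, to $$\delta(0)\int_0^1(1-S_0)\,dv+\delta(1)\int_0^1 S_0\,dv$$ in Wasserstein distance.
   Context: A one-dimensional mixed-type Kimura operator is $$L=a(x)x^{m(0)}(1-x)^{m(1)}\frac{d^2}{dx^2}+b(x)x^{m(0)-1}(1-x)^{m(1)-1}\frac{d}{dx}\quad\text{on }[0,1],$$ with $a,b\in C^\infty([0,1])$, $a>0$ on $[0,1]$, and $m(0),m(1)\in\{1,2\}$. The endpoint $i\in\{0,1\}$ is of Kimura type if $m(i)=1$ and of quadratic type (a quadratic endpoint) if $m(i)=2$. At a Kimura endpoint the vector field $b\,\frac{d}{dx}$ is assumed inward pointing ($b(0)\ge 0$ if $0$ is Kimura, $b(1)\le 0$ if $1$ is Kimura). A Kimura endpoint $0$ (resp. $1$) is tangent if $b(0)=0$ (resp. $b(1)=0$) and transverse if $b(0)>0$ (resp. $b(1)<0$). A quadratic endpoint $0$ (resp. $1$) is tangent if $b(0)/a(0)<1$ (resp.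 $b(1)/a(1)>-1$), transverse if $b(0)/a(0)>1$ (resp. $b(1)/a(1)<-1$), and neutral if $b(0)/a(0)=1$ (resp. $b(1)/a(1)=-1$). Each endpoint is thus tangent, transverse or neutral. $\mathcal Q_t=e^{tL}$ is the positivity-preserving semigroup on $C^0([0,1])$ which is the solution operator of the Cauchy problem $\partial_tu=Lu$, $u(\cdot,0)=f$. Its transition probability $p_t(x,\cdot)$ is the probability measure with $\mathcal Q_tf(x)=\int f\,dp_t(x,\cdot)$, and $\mathcal Q_t^*$ is the dual action on measures, $\int f\,d(\mathcal Q_t^*v)=\int \mathcal Q_tf\,dv$. The Wasserstein distance is $W(\nu_1,\nu_2)=\sup\{\int f\,d\nu_1-\int f\,d\nu_2:\ \mathrm{Lip}(f)\le 1\}$. A family $\nu_t$ converges exponentially to $\nu$ if $W(\nu_t,\nu)\le Ce^{-\lambda t}$ for all $t>0$ with some constants $C,\lambda>0$ (in (1), $C$ may depend on $x$).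
   Formalization: In (1), exponential convergence is claimed only if the other endpoint is transverse; if it is neutral, only convergence to δ(p) is claimed, since the exponential rate fails there (e.g. m(0)=1, m(1)=2, a=1, b(x)=-x). *)

theory Defs
  imports "HOL-Probability.Probability"
begin

text \<open>Derivative along \<open>[0,1]\<close>: one-sided at the endpoints, two-sided in the interior.\<close>

definition unit_deriv :: "(real \<Rightarrow> real) \<Rightarrow> real \<Rightarrow> real" where
  "unit_deriv f x = vector_derivative f (at x within {0..1})"

definition C_inf :: "(real \<Rightarrow> real) set" where
  "C_inf = {f. \<forall>n. \<forall>x\<in>{0..1}. (unit_deriv ^^ n) f differentiable (at x within {0..1})}"

definition C_zero :: "(real \<Rightarrow> real) set" where
  "C_zero = {f. continuous_on {0..1} f}"

text \<open>The coefficients \<open>a\<close>, \<open>b\<close> and all functions on \<open>[0,1]\<close> are total functions on the reals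
  of which only the values on \<open>[0,1]\<close> matter. An endpoint is an index \<open>i \<in> {0, 1}\<close> located at
  \<open>real i\<close>.\<close>

definition kimura_op ::
    "(real \<Rightarrow> real) \<Rightarrow> (real \<Rightarrow> real) \<Rightarrow> (nat \<Rightarrow> nat) \<Rightarrow> (real \<Rightarrow> real) \<Rightarrow> real \<Rightarrow> real" where
  "kimura_op a b m f x =
     a x * x ^ m 0 * (1 - x) ^ m 1 * unit_deriv (unit_deriv f) x
     + b x * x ^ (m 0 - 1) * (1 - x) ^ (m 1 - 1) * unit_deriv f x"

definition mixed_type_kimura :: "(real \<Rightarrow> real) \<Rightarrow> (real \<Rightarrow> real) \<Rightarrow> (nat \<Rightarrow> nat) \<Rightarrow> bool" where
  "mixed_type_kimura a b m \<longleftrightarrow>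
     a \<in> C_inf \<and> b \<in> C_inf \<and> (\<forall>x\<in>{0..1}. a x > 0) \<and>
     m 0 \<in> {1, 2} \<and> m 1 \<in> {1, 2} \<and>
     (m 0 = 1 \<longrightarrow> b 0 \<ge> 0) \<and> (m 1 = 1 \<longrightarrow> b 1 \<le> 0)"

definition quadratic_endpoints :: "(nat \<Rightarrow> nat) \<Rightarrow> real set" where
  "quadratic_endpoints m = {real i | i. i \<in> {0, 1} \<and> m i = 2}"

definition tangent :: "(real \<Rightarrow> real) \<Rightarrow> (real \<Rightarrow> real) \<Rightarrow> (nat \<Rightarrow> nat) \<Rightarrow> nat \<Rightarrow> bool" where
  "tangent a b m i \<longleftrightarrow>
     (if m i = 1 then b (real i) = 0
      else if i = 0 then b 0 / a 0 < 1 else b 1 / a 1 > -1)"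

definition neutral :: "(real \<Rightarrow> real) \<Rightarrow> (real \<Rightarrow> real) \<Rightarrow> (nat \<Rightarrow> nat) \<Rightarrow> nat \<Rightarrow> bool" where
  "neutral a b m i \<longleftrightarrow> m i = 2 \<and> (if i = 0 then b 0 / a 0 = 1 else b 1 / a 1 = -1)"

text \<open>Regularity of classical solutions: continuous on \<open>[0,1]\<close> and twice continuously
  differentiable away from the quadratic endpoints. It includes the Kimura endpoints, and this is
  what selects the right boundary behaviour there (at a transverse Kimura endpoint \<open>L\<close> also has
  solutions that are merely continuous). At a quadratic endpoint, solutions with continuous data
  are in general not differentiable.\<close>

definition kimura_regular :: "(nat \<Rightarrow> nat) \<Rightarrow> (real \<Rightarrow> real) \<Rightarrow> bool" where
  "kimura_regular m f \<longleftrightarrow>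
     f \<in> C_zero \<and>
     (\<forall>x\<in>{0..1} - quadratic_endpoints m.
        f differentiable (at x within {0..1}) \<and> unit_deriv f differentiable (at x within {0..1})) \<and>
     continuous_on ({0..1} - quadratic_endpoints m) (unit_deriv (unit_deriv f))"

text \<open>\<open>Q\<close> is the semigroup \<open>exp (t L)\<close> on \<open>C\<^sup>0([0,1])\<close>. Joint continuity in \<open>(t, x)\<close> is strong
  continuity, \<open>[0,1]\<close> being compact. At a quadratic endpoint both coefficients of \<open>L\<close> vanish, so
  that there the equation reads \<open>\<partial>\<^sub>t u = 0\<close>.\<close>

definition kimura_semigroup ::
    "(real \<Rightarrow> real) \<Rightarrow> (real \<Rightarrow> real) \<Rightarrow> (nat \<Rightarrow> nat) \<Rightarrow> (real \<Rightarrow> (real \<Rightarrow> real) \<Rightarrow> real \<Rightarrow> real) \<Rightarrow> bool"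
  where
  "kimura_semigroup a b m Q \<longleftrightarrow>
     (\<forall>t\<ge>0. \<forall>f\<in>C_zero. Q t f \<in> C_zero) \<and>
     (\<forall>t\<ge>0. \<forall>f\<in>C_zero. \<forall>g\<in>C_zero. \<forall>c d. \<forall>x\<in>{0..1}.
        Q t (\<lambda>y. c * f y + d * g y) x = c * Q t f x + d * Q t g x) \<and>
     (\<forall>t\<ge>0. \<forall>f\<in>C_zero. (\<forall>x\<in>{0..1}. f x \<ge> 0) \<longrightarrow> (\<forall>x\<in>{0..1}. Q t f x \<ge> 0)) \<and>
     (\<forall>s\<ge>0. \<forall>t\<ge>0. \<forall>f\<in>C_zero. \<forall>x\<in>{0..1}. Q (s + t) f x = Q s (Q t f) x) \<and>
     (\<forall>f\<in>C_zero. \<forall>x\<in>{0..1}. Q 0 f x = f x) \<and>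
     (\<forall>f\<in>C_zero. continuous_on ({0..} \<times> {0..1}) (\<lambda>(t, x). Q t f x)) \<and>
     (\<forall>f\<in>C_zero. \<forall>t>0. kimura_regular m (Q t f) \<and>
        (\<forall>x\<in>{0..1}. ((\<lambda>s. Q s f x) has_real_derivative kimura_op a b m (Q t f) x) (at t)))"

abbreviation unit_borel :: "real measure" where
  "unit_borel \<equiv> restrict_space borel {0..1}"

definition transition_probability ::
    "(real \<Rightarrow> (real \<Rightarrow> real) \<Rightarrow> real \<Rightarrow> real) \<Rightarrow> real \<Rightarrow> real \<Rightarrow> real measure \<Rightarrow> bool" where
  "transition_probability Q t x \<mu> \<longleftrightarrow>
     prob_space \<mu> \<and> sets \<mu> = sets unit_borel \<and> (\<forall>f\<in>C_zero. Q t f x = (\<integral>y. f y \<partial>\<mu>))"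

text \<open>\<open>\<mu>\<close> is the image of \<open>v\<close> under the dual of \<open>Q t\<close>.\<close>

definition dual_image ::
    "(real \<Rightarrow> (real \<Rightarrow> real) \<Rightarrow> real \<Rightarrow> real) \<Rightarrow> real \<Rightarrow> real measure \<Rightarrow> real measure \<Rightarrow> bool" where
  "dual_image Q t v \<mu> \<longleftrightarrow>
     finite_measure \<mu> \<and> sets \<mu> = sets unit_borel \<and>
     (\<forall>f\<in>C_zero. (\<integral>y. f y \<partial>\<mu>) = (\<integral>x. Q t f x \<partial>v))"

definition wasserstein :: "real measure \<Rightarrow> real measure \<Rightarrow> real" where
  "wasserstein \<mu> \<nu> =
     (SUP f\<in>{f. 1-lipschitz_on {0..1} f}. (\<integral>x. f x \<partial>\<mu>) - (\<integral>x. f x \<partial>\<nu>))"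

abbreviation dirac :: "real \<Rightarrow> real measure" where
  "dirac x \<equiv> return unit_borel x"

text \<open>The measure \<open>c\<^sub>0 \<delta>(0) + c\<^sub>1 \<delta>(1)\<close> for \<open>c\<^sub>0, c\<^sub>1 \<ge> 0\<close>.\<close>

definition endpoint_mixture :: "real \<Rightarrow> real \<Rightarrow> real measure" where
  "endpoint_mixture c0 c1 = measure_of {0..1} (sets unit_borel)
     (\<lambda>A. ennreal c0 * emeasure (dirac 0) A + ennreal c1 * emeasure (dirac 1) A)"

text \<open>\<open>\<nu>\<^sub>t\<close> converges to \<open>\<nu>\<close> with the explicit constant \<open>C\<close> and rate \<open>r\<close>; these are exposed so
  that their dependence on the starting point or measure can be stated.\<close>

definition exp_converges ::
    "real \<Rightarrow> real \<Rightarrow> (real \<Rightarrow> real measure) \<Rightarrow> real measure \<Rightarrow> bool" where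
  "exp_converges C r \<nu>t \<nu> \<longleftrightarrow> (\<forall>t>0. wasserstein (\<nu>t t) \<nu> \<le> C * exp (- r * t))"

end

theory Submission
  imports Defs
begin

text \<open>Why the theorem is true. Write \<open>L = A d\<^sup>2/dx\<^sup>2 + B d/dx\<close>. Inside the interval
  \<open>B / A = p / x + q / (1 - x) + g\<close> with \<open>p = b 0 / a 0\<close>, \<open>q = b 1 / a 1\<close> and \<open>g\<close> continuous on
  \<open>[0,1]\<close> (\<open>mixed_type_boundary_operator\<close>). So the scale function \<open>S\<close>, the solution of \<open>L S = 0\<close>
  with \<open>S 0 = 0\<close> and \<open>S' = x\<^sup>-\<^sup>p (1 - x)\<^sup>q exp (- \<integral> g)\<close>, behaves like a power or a logarithm at
  each endpoint. At a tangent endpoint \<open>S\<close> is finite and \<open>B\<close> vanishes, so that the value of a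
  solution there never changes.

  Everything else is comparison. The maximum principle (\<open>comparison_exponential\<close>) bounds
  \<open>Q t f\<close> by any \<open>P + exp (- r t) R\<close> that dominates it initially and on the boundary, provided
  that \<open>L P \<le> 0\<close> and \<open>L R \<le> - r R\<close>. The Lyapunov functions \<open>R\<close> are small powers of functions of
  \<open>S\<close>: for concave powers the second-order term gives
  \<open>L (Y\<^sup>\<gamma>) / Y\<^sup>\<gamma> \<le> - const A (S' / Y)\<^sup>2\<close>, the degeneracy \<open>A \<ge> \<kappa> x\<^sup>2 (1 - x)\<^sup>2\<close> is exactly
  compensated by \<open>x (1 - x) S' \<ge> \<delta> Y\<close>, and the exponent \<open>\<gamma>\<close> is taken so small that \<open>Y\<^sup>\<gamma>\<close> still
  dominates the distance to the endpoint.

  Two tangent endpoints (\<open>both_tangent_decay\<close>): \<open>S0 = S / S 1\<close> is the probability of ending in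
  1. With \<open>P = f 0 (1 - S0) + f 1 S0\<close> and \<open>R\<close> a multiple of \<open>(S0 (1 - S0))\<^sup>\<gamma>\<close> comparison gives
  \<open>Q t f \<le> P + C exp (- r t)\<close> uniformly over 1-Lipschitz \<open>f\<close>; integrating against \<open>v\<close> bounds the
  Wasserstein distance.

  One tangent endpoint, which a reflection moves to 0: for a Dirac limit the distance function
  dominates all test functions, so it is enough that \<open>Q t\<close> of the function \<open>x\<close> tends to 0.
  If 1 is a transverse Kimura endpoint (\<open>transverse_kimura_decay\<close>), the singular part of the drift
  at 1 is left out of \<open>S\<close>; then \<open>S\<^sup>\<gamma>\<close> is differentiable up to 1, and the drift, which points
  inward there, makes up for the degeneracy of \<open>A\<close>. If 1 is a transverse quadratic endpoint
  (\<open>transverse_quadratic_decay\<close>), \<open>S\<close> blows up at 1 like a negative power, \<open>S\<^sup>\<gamma>\<close> is a Lyapunov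
  function on \<open>[0,1)\<close>, and comparison on \<open>[0,c]\<close> succeeds for \<open>c\<close> close to 1 because \<open>Q t\<close> stays
  below 1. If 1 is neutral (\<open>nontangent_quadratic_limit\<close>), \<open>S\<close> blows up only logarithmically and
  the rate degenerates near 1; the supersolution \<open>\<epsilon> S + C exp (- r t) S\<^sup>\<gamma>\<close>, with \<open>r\<close> depending on
  \<open>\<epsilon>\<close>, still gives convergence at every \<open>x < 1\<close>.\<close>

section \<open>The parabolic maximum principle\<close>

text \<open>The second derivative test for a function that is known to be twice differentiable only in
  the pointwise sense: if \<open>d > 0\<close> then \<open>v'\<close> is positive immediately to the right of \<open>x\<close>, so \<open>v\<close>
  exceeds its maximum there.\<close>

lemma second_derivative_nonpos_at_max:
  fixes v v' :: "real \<Rightarrow> real"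
  assumes "l < x" "x < r"
    and v: "\<And>y. y \<in> {l<..<r} \<Longrightarrow> (v has_real_derivative v' y) (at y)"
    and v'': "(v' has_real_derivative d) (at x)"
    and max: "\<And>y. y \<in> {l<..<r} \<Longrightarrow> v y \<le> v x"
  shows "v' x = 0" "d \<le> 0"
proof -
  show zero: "v' x = 0"
  proof (rule DERIV_local_max[OF v])
    show "0 < min (x - l) (r - x)" using assms(1,2) by simp
  qed (use assms(1,2) max in \<open>auto simp: abs_less_iff\<close>)
  show "d \<le> 0"
  proof (rule ccontr)
    assume "\<not> d \<le> 0"
    then obtain e where e: "e > 0" "\<And>h. 0 < h \<Longrightarrow> h < e \<Longrightarrow> v' x < v' (x + h)"
      using DERIV_pos_inc_right[OF v''] by force
    define y where "y = x + min e (r - x) / 2"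
    have y: "x < y" "y < r" "y - x < e" using e assms(1,2) by (auto simp: y_def min_def field_simps)
    have "\<exists>z. x < z \<and> z < y \<and> v y - v x = (y - x) * v' z"
      using v y(1,2) assms(1) by (intro MVT2) auto
    then obtain z where z: "x < z" "z < y" "v y - v x = (y - x) * v' z" by blast
    have "v' z > 0" using e(2)[of "z - x"] z y zero by simp
    then have "(y - x) * v' z > 0" using y(1) by simp
    then have "v y > v x" using z(3) by simp
    then show False using max[of y] y assms(1) by force
  qed
qed

lemma derivative_nonneg_at_right_max:
  fixes v :: "real \<Rightarrow> real"
  assumes "l < x"
    and v: "(v has_real_derivative d) (at x within {l..x})"
    and max: "\<And>y. y \<in> {l..x} \<Longrightarrow> v y \<le> v x"
  shows "d \<ge> 0"
proof (rule tendsto_lowerbound)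
  show "((\<lambda>y. (v y - v x) / (y - x)) \<longlongrightarrow> d) (at x within {l..x})"
    using v by (simp add: has_field_derivative_iff)
  show "\<forall>\<^sub>F y in at x within {l..x}. 0 \<le> (v y - v x) / (y - x)"
    using max by (auto simp: eventually_at_filter divide_nonpos_nonpos)
  show "at x within {l..x} \<noteq> bot"
    using assms(1) by (simp add: at_within_Icc_at_left)
qed

text \<open>The operator does not appear: all that matters is that at a positive spatial maximum the time
  derivative is nonpositive. Whether the maximum is interior or sits at an endpoint is left to
  the hypothesis, which makes room for boundary conditions of several kinds.\<close>

lemma parabolic_max_principle:
  fixes u :: "real \<Rightarrow> real \<Rightarrow> real"
  assumes "0 \<le> T" "l \<le> r"
    and cont: "continuous_on ({0..T} \<times> {l..r}) (\<lambda>(t, x). u t x)"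
    and init: "\<And>x. x \<in> {l..r} \<Longrightarrow> u 0 x \<le> 0"
    and step: "\<And>t x. \<lbrakk>t \<in> {0<..T}; x \<in> {l..r}; u t x > 0; \<And>y. y \<in> {l..r} \<Longrightarrow> u t y \<le> u t x\<rbrakk>
      \<Longrightarrow> \<exists>D\<le>0. ((\<lambda>s. u s x) has_real_derivative D) (at t)"
    and "t \<in> {0..T}" "x \<in> {l..r}"
  shows "u t x \<le> 0"
proof (rule ccontr)
  assume "\<not> u t x \<le> 0"
  \<comment> \<open>The penalty \<open>e * t\<close> makes the time derivative at a maximum strictly negative; \<open>e\<close> is small enough for the penalized function to stay positive somewhere.\<close>
  define e where "e = u t x / (2 * (T + 1))"
  have e: "e > 0" "e * T < u t x"
    using \<open>\<not> u t x \<le> 0\<close> \<open>0 \<le> T\<close> by (auto simp: e_def field_simps intro!: add_nonneg_pos)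
  define w where "w = (\<lambda>(t, x). u t x - e * t)"
  have "continuous_on ({0..T} \<times> {l..r}) w"
    using cont unfolding w_def case_prod_unfold by (intro continuous_intros) auto
  moreover have "compact ({0..T} \<times> {l..r})" by (intro compact_Times) auto
  ultimately obtain z where z: "z \<in> {0..T} \<times> {l..r}" "\<And>y. y \<in> {0..T} \<times> {l..r} \<Longrightarrow> w y \<le> w z"
    using continuous_attains_sup[of "{0..T} \<times> {l..r}" w] assms(6,7) by auto
  obtain t0 x0 where zz: "z = (t0, x0)" by force
  have mem: "t0 \<in> {0..T}" "x0 \<in> {l..r}" using z(1) zz by auto
  have mx: "u s y - e * s \<le> u t0 x0 - e * t0" if "s \<in> {0..T}" "y \<in> {l..r}" for s y
    using z(2)[of "(s, y)"] that by (simp add: w_def zz)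
  have "e * t \<le> e * T" using e(1) assms(6) by simp
  then have pos: "u t0 x0 - e * t0 > 0" using mx[OF assms(6,7)] e by linarith
  have "t0 \<noteq> 0" using pos init[OF mem(2)] by auto
  then have t0: "t0 \<in> {0<..T}" using mem by auto
  have "e * t0 > 0" using t0 e by simp
  have "\<exists>D\<le>0. ((\<lambda>s. u s x0) has_real_derivative D) (at t0)"
  proof (rule step[OF t0 mem(2)])
    show "u t0 x0 > 0" using pos \<open>e * t0 > 0\<close> by linarith
    show "u t0 y \<le> u t0 x0" if "y \<in> {l..r}" for y using mx[OF mem(1) that] by linarith
  qed
  then obtain D where D: "D \<le> 0" "((\<lambda>s. u s x0) has_real_derivative D) (at t0)" by blast
  have "((\<lambda>s. u s x0 - e * s) has_real_derivative D - e * 1) (at t0)"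
    by (intro DERIV_diff D(2) DERIV_cmult DERIV_ident)
  then have "((\<lambda>s. u s x0 - e * s) has_real_derivative D - e) (at t0 within {0..t0})"
    by (simp add: has_field_derivative_at_within)
  then have "D - e \<ge> 0"
  proof (rule derivative_nonneg_at_right_max[rotated])
    show "u s x0 - e * s \<le> u t0 x0 - e * t0" if "s \<in> {0..t0}" for s
      using mx[of s x0] that mem t0 by simp
  qed (use t0 in simp)
  then show False using D e by linarith
qed

text \<open>A solution of \<open>\<partial>\<^sub>t u = A u'' + B u'\<close>, where both endpoints satisfy \<open>\<partial>\<^sub>t u = B u'\<close>, the equation
  with \<open>A = 0\<close>. Differentiability in space at an endpoint is asked for only if \<open>B\<close> does not vanish
  there; otherwise \<open>ux e\<close> is an arbitrary number and the condition says \<open>\<partial>\<^sub>t u = 0\<close>. All types of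
  endpoints are covered in this way.\<close>

definition classical_solution ::
    "(real \<Rightarrow> real) \<Rightarrow> (real \<Rightarrow> real) \<Rightarrow> (real \<Rightarrow> real \<Rightarrow> real) \<Rightarrow> bool" where
  "classical_solution A B u \<longleftrightarrow>
     continuous_on ({0..} \<times> {0..1}) (\<lambda>(t, x). u t x) \<and>
     (\<forall>t>0. \<exists>ux uxx.
        (\<forall>x\<in>{0<..<1}. (u t has_real_derivative ux x) (at x) \<and>
           (ux has_real_derivative uxx x) (at x) \<and>
           ((\<lambda>s. u s x) has_real_derivative A x * uxx x + B x * ux x) (at t)) \<and>
        (\<forall>e\<in>{0, 1}. ((\<lambda>s. u s e) has_real_derivative B e * ux e) (at t) \<and>
           (B e \<noteq> 0 \<longrightarrow> (u t has_real_derivative ux e) (at e within {0..1}))))"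

lemma classical_solutionE:
  assumes "classical_solution A B u" "t > 0"
  obtains ux uxx where
    "\<And>x. x \<in> {0<..<1} \<Longrightarrow> (u t has_real_derivative ux x) (at x)"
    "\<And>x. x \<in> {0<..<1} \<Longrightarrow> (ux has_real_derivative uxx x) (at x)"
    "\<And>x. x \<in> {0<..<1} \<Longrightarrow>
      ((\<lambda>s. u s x) has_real_derivative A x * uxx x + B x * ux x) (at t)"
    "\<And>e. e \<in> {0, 1} \<Longrightarrow> ((\<lambda>s. u s e) has_real_derivative B e * ux e) (at t)"
    "\<And>e. e \<in> {0, 1} \<Longrightarrow> B e \<noteq> 0 \<Longrightarrow>
      (u t has_real_derivative ux e) (at e within {0..1})"
proof -
  from assms obtain ux uxx where
    "(\<forall>x\<in>{0<..<1}. (u t has_real_derivative ux x) (at x) \<and>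
       (ux has_real_derivative uxx x) (at x) \<and>
       ((\<lambda>s. u s x) has_real_derivative A x * uxx x + B x * ux x) (at t)) \<and>
     (\<forall>e\<in>{0, 1}. ((\<lambda>s. u s e) has_real_derivative B e * ux e) (at t) \<and>
       (B e \<noteq> 0 \<longrightarrow> (u t has_real_derivative ux e) (at e within {0..1})))"
    unfolding classical_solution_def by blast
  note H = this
  show thesis
    by (rule that[of ux uxx]) (use H in auto)
qed

lemma classical_solution_reflect:
  assumes "classical_solution A B u"
  shows "classical_solution (\<lambda>x. A (1 - x)) (\<lambda>x. - B (1 - x)) (\<lambda>t x. u t (1 - x))"
  unfolding classical_solution_def
proof (intro conjI allI impI)
  have "continuous_on ({0..} \<times> {0..1}) (\<lambda>(t, x). u t x)"
    using assms by (simp add: classical_solution_def)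
  then have "continuous_on ({0..} \<times> {0..1}) ((\<lambda>(t, x). u t x) \<circ> (\<lambda>(t, x). (t, 1 - x)))"
    by (intro continuous_on_compose)
      (auto simp: case_prod_unfold intro!: continuous_intros elim!: continuous_on_subset)
  then show "continuous_on ({0..} \<times> {0..1}) (\<lambda>(t, x). u t (1 - x))"
    by (simp add: o_def case_prod_unfold)
next
  fix t :: real assume "t > 0"
  then obtain ux uxx where
    int: "\<And>x. x \<in> {0<..<1} \<Longrightarrow> (u t has_real_derivative ux x) (at x)"
         "\<And>x. x \<in> {0<..<1} \<Longrightarrow> (ux has_real_derivative uxx x) (at x)"
         "\<And>x. x \<in> {0<..<1} \<Longrightarrow> ((\<lambda>s. u s x) has_real_derivative A x * uxx x + B x * ux x) (at t)"
    and bd: "\<And>e. e \<in> {0, 1} \<Longrightarrow> ((\<lambda>s. u s e) has_real_derivative B e * ux e) (at t)"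
         "\<And>e. e \<in> {0, 1} \<Longrightarrow> B e \<noteq> 0 \<Longrightarrow> (u t has_real_derivative ux e) (at e within {0..1})"
    by (rule classical_solutionE[OF assms]) (rule that)
  have refl: "(f has_real_derivative d) (at (1 - x) within {0..1}) \<Longrightarrow>
      ((\<lambda>x. f (1 - x)) has_real_derivative - d) (at x within {0..1})" for f d and x :: real
  proof -
    assume f: "(f has_real_derivative d) (at (1 - x) within {0..1})"
    have im: "(\<lambda>x::real. 1 - x) ` {0..1} = {0..1}" by (simp add: image_diff_atLeastAtMost)
    have "((\<lambda>x. 1 - x) has_real_derivative - 1) (at x within {0..1})"
      by (auto intro!: derivative_eq_intros)
    from DERIV_image_chain[OF _ this, of f d] f show ?thesis by (simp add: im o_def)
  qed
  have refl': "((\<lambda>x. f (1 - x)) has_real_derivative - d) (at x)"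
    if "(f has_real_derivative d) (at (1 - x))" for f d and x :: real
  proof -
    have "((\<lambda>x. 1 - x) has_real_derivative - 1) (at x)"
      by (auto intro!: derivative_eq_intros)
    from DERIV_chain2[where f = f and g = "\<lambda>x. 1 - x", OF that this] show ?thesis by simp
  qed
  show "\<exists>vx vxx.
        (\<forall>x\<in>{0<..<1}. ((\<lambda>x. u t (1 - x)) has_real_derivative vx x) (at x) \<and>
           (vx has_real_derivative vxx x) (at x) \<and>
           ((\<lambda>s. u s (1 - x)) has_real_derivative
              A (1 - x) * vxx x + - B (1 - x) * vx x) (at t)) \<and>
        (\<forall>e\<in>{0, 1}. ((\<lambda>s. u s (1 - e)) has_real_derivative - B (1 - e) * vx e) (at t) \<and>
           (- B (1 - e) \<noteq> 0 \<longrightarrow>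
              ((\<lambda>x. u t (1 - x)) has_real_derivative vx e) (at e within {0..1})))"
  proof (intro exI conjI ballI impI)
    fix x :: real assume "x \<in> {0<..<1}"
    then have x: "1 - x \<in> {0<..<1}" by auto
    show "((\<lambda>x. u t (1 - x)) has_real_derivative - ux (1 - x)) (at x)"
      by (rule refl'[OF int(1)[OF x]])
    show "((\<lambda>x. - ux (1 - x)) has_real_derivative uxx (1 - x)) (at x)"
      using DERIV_minus[OF refl'[OF int(2)[OF x]]] by simp
    show "((\<lambda>s. u s (1 - x)) has_real_derivative
       A (1 - x) * uxx (1 - x) + - B (1 - x) * - ux (1 - x)) (at t)"
      using int(3)[OF x] by simp
  next
    fix e :: real assume "e \<in> {0, 1}"
    then have e: "1 - e \<in> {0, 1}" by auto
    show "((\<lambda>s. u s (1 - e)) has_real_derivative - B (1 - e) * - ux (1 - e)) (at t)"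
      using bd(1)[OF e] by simp
    show "((\<lambda>x. u t (1 - x)) has_real_derivative - ux (1 - e)) (at e within {0..1})"
      if "- B (1 - e) \<noteq> 0" using refl[OF bd(2)[OF e]] that by simp
  qed
qed

text \<open>An endpoint without drift is a trap, so the value of the solution at it is frozen. This
  supplies the boundary values for comparison at tangent endpoints.\<close>

lemma classical_solution_absorbed:
  assumes u: "classical_solution A B u" and e: "e \<in> {0, 1}" "B e = 0" and "t \<ge> 0"
  shows "u t e = u 0 e"
proof (cases "t = 0")
  case False
  have "continuous_on {0..t} (\<lambda>s. u s e)"
  proof -
    have "continuous_on ({0..} \<times> {0..1}) (\<lambda>(t, x). u t x)"
      using u by (simp add: classical_solution_def)
    moreover have "continuous_on {0..t} (\<lambda>s. (s, e))" by (intro continuous_intros)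
    moreover have "(\<lambda>s. (s, e)) ` {0..t} \<subseteq> {0..} \<times> {0..1}" using e by auto
    ultimately show ?thesis
      using continuous_on_compose2[of _ "\<lambda>(t, x). u t x" "{0..t}" "\<lambda>s. (s, e)"] by simp
  qed
  moreover have "((\<lambda>s. u s e) has_real_derivative 0) (at s)" if "s > 0" for s
  proof (rule classical_solutionE[OF u that])
    fix ux
    assume "\<And>e. e \<in> {0, 1} \<Longrightarrow> ((\<lambda>s. u s e) has_real_derivative B e * ux e) (at s)"
    from this[OF e(1)] show ?thesis using e(2) by simp
  qed
  ultimately show ?thesis
    using False \<open>t \<ge> 0\<close> by (intro DERIV_isconst2[of 0 t]) auto
qed simp

text \<open>The maximum principle for the difference of a solution and a supersolution \<open>W\<close> on \<open>[0,c]\<close>. At the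
  right end either the boundary values are compared, or \<open>c = 1\<close> and the drift points strictly
  inward: then no boundary values are available, but at a maximum at 1 the one-sided space
  derivative of \<open>u - W\<close> is nonnegative, and multiplication by \<open>B 1 < 0\<close> turns it into the required
  sign for the time derivative.\<close>

lemma comparison:
  assumes u: "classical_solution A B u"
    and A: "\<And>x. x \<in> {0<..<1} \<Longrightarrow> A x \<ge> 0"
    and c: "0 < c" "c \<le> 1" and T: "0 \<le> T"
    and W: "continuous_on ({0..T} \<times> {0..c}) (\<lambda>(t, x). W t x)"
    and init: "\<And>x. x \<in> {0..c} \<Longrightarrow> u 0 x \<le> W 0 x"
    and left: "\<And>t. t \<in> {0..T} \<Longrightarrow> u t 0 \<le> W t 0"
    and Wx: "\<And>t x. \<lbrakk>t \<in> {0<..T}; x \<in> {0<..<c}\<rbrakk> \<Longrightarrow> (W t has_real_derivative Wx t x) (at x)"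
    and Wxx: "\<And>t x. \<lbrakk>t \<in> {0<..T}; x \<in> {0<..<c}\<rbrakk> \<Longrightarrow> (Wx t has_real_derivative Wxx t x) (at x)"
    and Wt: "\<And>t x. \<lbrakk>t \<in> {0<..T}; x \<in> {0<..c}\<rbrakk> \<Longrightarrow> ((\<lambda>s. W s x) has_real_derivative Wt t x) (at t)"
    and super: "\<And>t x. \<lbrakk>t \<in> {0<..T}; x \<in> {0<..<c}\<rbrakk> \<Longrightarrow> A x * Wxx t x + B x * Wx t x \<le> Wt t x"
    and right: "(\<forall>t\<in>{0..T}. u t c \<le> W t c) \<or>
      c = 1 \<and> B 1 < 0 \<and> (\<forall>t\<in>{0<..T}. (W t has_real_derivative Wx t 1) (at 1 within {0..1}) \<and>
         B 1 * Wx t 1 \<le> Wt t 1)"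
    and t: "t \<in> {0..T}" and x: "x \<in> {0..c}"
  shows "u t x \<le> W t x"
proof -
  have "u t x - W t x \<le> 0"
  proof (rule parabolic_max_principle[where u = "\<lambda>t x. u t x - W t x", OF T _ _ _ _ t x])
    show "0 \<le> c" using c by simp
    have "continuous_on ({0..T} \<times> {0..c}) (\<lambda>(t, x). u t x)"
      using u c unfolding classical_solution_def by (auto elim!: continuous_on_subset)
    from continuous_on_diff[OF this W]
    show "continuous_on ({0..T} \<times> {0..c}) (\<lambda>(t, x). u t x - W t x)"
      by (simp add: case_prod_unfold)
    show "u 0 x - W 0 x \<le> 0" if "x \<in> {0..c}" for x using init[OF that] by simp
  next
    fix s y assume s: "s \<in> {0<..T}" and y: "y \<in> {0..c}" and pos: "u s y - W s y > 0"
      and max: "\<And>z. z \<in> {0..c} \<Longrightarrow> u s z - W s z \<le> u s y - W s y"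
    have "y \<noteq> 0" using left[of s] pos s by auto
    have "s > 0" using s by simp
    then obtain ux uxx where
      int: "\<And>x. x \<in> {0<..<1} \<Longrightarrow> (u s has_real_derivative ux x) (at x)"
         "\<And>x. x \<in> {0<..<1} \<Longrightarrow> (ux has_real_derivative uxx x) (at x)"
         "\<And>x. x \<in> {0<..<1} \<Longrightarrow> ((\<lambda>s. u s x) has_real_derivative A x * uxx x + B x * ux x) (at s)"
      and bd: "\<And>e. e \<in> {0, 1} \<Longrightarrow> ((\<lambda>s. u s e) has_real_derivative B e * ux e) (at s)"
         "\<And>e. e \<in> {0, 1} \<Longrightarrow> B e \<noteq> 0 \<Longrightarrow> (u s has_real_derivative ux e) (at e within {0..1})"
      by (rule classical_solutionE[OF u]) (rule that)
    show "\<exists>D\<le>0. ((\<lambda>s. u s y - W s y) has_real_derivative D) (at s)"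
    proof (cases "y < c")
      case True
      then have y': "y \<in> {0<..<c}" "y \<in> {0<..<1}" "y \<in> {0<..c}" using y \<open>y \<noteq> 0\<close> c by auto
      have D1: "((\<lambda>z. u s z - W s z) has_real_derivative ux z - Wx s z) (at z)"
        if "z \<in> {0<..<c}" for z
        using that c by (intro DERIV_diff int Wx s) auto
      have D2: "((\<lambda>z. ux z - Wx s z) has_real_derivative uxx y - Wxx s y) (at y)"
        by (intro DERIV_diff int Wxx s y')
      have eq: "ux y - Wx s y = 0" and le: "uxx y - Wxx s y \<le> 0"
        using second_derivative_nonpos_at_max[of 0 y c, OF _ _ D1 D2] y' max by auto
      have "A x * (uxx y - Wxx s y) \<le> 0" if "x = y" for x
        using le A[OF y'(2)] that by (simp add: mult_nonneg_nonpos)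
      then have "A y * uxx y \<le> A y * Wxx s y" by (simp add: right_diff_distrib)
      then have "A y * uxx y + B y * ux y - Wt s y \<le> 0" using super[OF s y'(1)] eq by simp
      then show ?thesis using DERIV_diff[OF int(3)[OF y'(2)] Wt[OF s y'(3)]] by blast
    next
      case False
      then have "y = c" using y by auto
      then have "s \<in> {0..T} \<and> \<not> u s c \<le> W s c" using pos s by simp
      then have "\<not> (\<forall>t\<in>{0..T}. u t c \<le> W t c)" by blast
      with right have c1: "c = 1" "B 1 < 0"
        and r: "(W s has_real_derivative Wx s 1) (at 1 within {0..1})" "B 1 * Wx s 1 \<le> Wt s 1"
        using s by auto
      have "((\<lambda>z. u s z - W s z) has_real_derivative ux 1 - Wx s 1) (at 1 within {0..1})"
        using c1 by (intro DERIV_diff bd r) auto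
      then have "ux 1 - Wx s 1 \<ge> 0"
        using max \<open>y = c\<close> c1 by (intro derivative_nonneg_at_right_max[of 0 1]) auto
      then have "B 1 * (ux 1 - Wx s 1) \<le> 0" using c1(2) by (simp add: mult_nonpos_nonneg)
      then have "B 1 * ux 1 - Wt s 1 \<le> 0" using r by (simp add: right_diff_distrib)
      moreover have "((\<lambda>s. u s 1 - W s 1) has_real_derivative B 1 * ux 1 - Wt s 1) (at s)"
        using s c1 by (intro DERIV_diff bd(1) Wt) auto
      ultimately show ?thesis using \<open>y = c\<close> c1(1) by (auto intro!: exI[of _ "B 1 * ux 1 - Wt s 1"])
    qed
  qed
  then show ?thesis by simp
qed

text \<open>The supersolutions that occur are the sum of a stationary one and an exponentially decaying
  one, so that the hypotheses reduce to ordinary differential inequalities for \<open>P\<close> and \<open>R\<close>.\<close>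

lemma comparison_exponential:
  assumes u: "classical_solution A B u"
    and A: "\<And>x. x \<in> {0<..<1} \<Longrightarrow> A x \<ge> 0"
    and c: "0 < c" "c \<le> 1" and T: "0 \<le> T"
    and cont: "continuous_on {0..c} P" "continuous_on {0..c} R"
    and P: "\<And>x. x \<in> {0<..<c} \<Longrightarrow> (P has_real_derivative P1 x) (at x)"
      "\<And>x. x \<in> {0<..<c} \<Longrightarrow> (P1 has_real_derivative P2 x) (at x)"
      "\<And>x. x \<in> {0<..<c} \<Longrightarrow> A x * P2 x + B x * P1 x \<le> 0"
    and R: "\<And>x. x \<in> {0<..<c} \<Longrightarrow> (R has_real_derivative R1 x) (at x)"
      "\<And>x. x \<in> {0<..<c} \<Longrightarrow> (R1 has_real_derivative R2 x) (at x)"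
      "\<And>x. x \<in> {0<..<c} \<Longrightarrow> A x * R2 x + B x * R1 x \<le> - r * R x"
    and init: "\<And>x. x \<in> {0..c} \<Longrightarrow> u 0 x \<le> P x + R x"
    and left: "\<And>t. t \<in> {0..T} \<Longrightarrow> u t 0 \<le> P 0 + exp (- r * t) * R 0"
    and right: "(\<forall>t\<in>{0..T}. u t c \<le> P c + exp (- r * t) * R c) \<or>
      c = 1 \<and> B 1 < 0 \<and> (P has_real_derivative P1 1) (at 1 within {0..1}) \<and>
      (R has_real_derivative R1 1) (at 1 within {0..1}) \<and> B 1 * P1 1 \<le> 0 \<and> B 1 * R1 1 \<le> - r * R 1"
    and t: "t \<in> {0..T}" and x: "x \<in> {0..c}"
  shows "u t x \<le> P x + exp (- r * t) * R x"
proof (rule comparison[OF u A c T, where W = "\<lambda>t x. P x + exp (- r * t) * R x"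
      and Wx = "\<lambda>t x. P1 x + exp (- r * t) * R1 x" and Wxx = "\<lambda>t x. P2 x + exp (- r * t) * R2 x"
      and Wt = "\<lambda>t x. exp (- r * t) * (- r * R x)"])
  have "continuous_on ({0..T} \<times> {0..c}) (\<lambda>z. P (snd z))" "continuous_on ({0..T} \<times> {0..c}) (\<lambda>z. R (snd z))"
    by (rule continuous_on_compose2[OF cont(1) continuous_on_snd[OF continuous_on_id]]; auto)
       (rule continuous_on_compose2[OF cont(2) continuous_on_snd[OF continuous_on_id]]; auto)
  then show "continuous_on ({0..T} \<times> {0..c}) (\<lambda>(t, x). P x + exp (- r * t) * R x)"
    unfolding case_prod_unfold by (intro continuous_on_add continuous_on_mult continuous_on_exp
        continuous_on_const continuous_on_fst continuous_on_id)
next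
  fix t x assume x: "x \<in> {0<..<c}"
  show "((\<lambda>x. P x + exp (- r * t) * R x) has_real_derivative P1 x + exp (- r * t) * R1 x) (at x)"
    "((\<lambda>x. P1 x + exp (- r * t) * R1 x) has_real_derivative P2 x + exp (- r * t) * R2 x) (at x)"
    by (intro DERIV_add DERIV_cmult P(1,2)[OF x] R(1,2)[OF x])+
  have "exp (- r * t) * (A x * R2 x + B x * R1 x) \<le> exp (- r * t) * (- r * R x)"
    by (intro mult_left_mono R(3)[OF x]) simp
  then show "A x * (P2 x + exp (- r * t) * R2 x) + B x * (P1 x + exp (- r * t) * R1 x) \<le> exp (- r * t) * (- r * R x)"
    using P(3)[OF x] by (simp add: algebra_simps)
next
  fix t x
  have "((\<lambda>t. exp (- r * t)) has_real_derivative exp (- r * t) * - r) (at t)"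
    by (auto intro!: derivative_eq_intros)
  from DERIV_add[OF DERIV_const DERIV_cmult_right[OF this]]
  show "((\<lambda>t. P x + exp (- r * t) * R x) has_real_derivative exp (- r * t) * (- r * R x)) (at t)"
    by (rule DERIV_cong) simp
next
  have "(\<forall>t\<in>{0<..T}. ((\<lambda>x. P x + exp (- r * t) * R x) has_real_derivative P1 1 + exp (- r * t) * R1 1)
        (at 1 within {0..1}) \<and> B 1 * (P1 1 + exp (- r * t) * R1 1) \<le> exp (- r * t) * (- r * R 1))"
    if H: "(P has_real_derivative P1 1) (at 1 within {0..1})"
      "(R has_real_derivative R1 1) (at 1 within {0..1})" "B 1 * P1 1 \<le> 0" "B 1 * R1 1 \<le> - r * R 1"
  proof (intro ballI conjI)
    fix t
    show "((\<lambda>x. P x + exp (- r * t) * R x) has_real_derivative P1 1 + exp (- r * t) * R1 1) (at 1 within {0..1})"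
      by (intro DERIV_add DERIV_cmult H(1,2))
    have "exp (- r * t) * (B 1 * R1 1) \<le> exp (- r * t) * (- r * R 1)"
      by (intro mult_left_mono H(4)) simp
    then show "B 1 * (P1 1 + exp (- r * t) * R1 1) \<le> exp (- r * t) * (- r * R 1)"
      using H(3) by (simp add: algebra_simps)
  qed
  with right show "(\<forall>t\<in>{0..T}. u t c \<le> P c + exp (- r * t) * R c) \<or>
    c = 1 \<and> B 1 < 0 \<and> (\<forall>t\<in>{0<..T}. ((\<lambda>x. P x + exp (- r * t) * R x) has_real_derivative
        P1 1 + exp (- r * t) * R1 1) (at 1 within {0..1}) \<and>
      B 1 * (P1 1 + exp (- r * t) * R1 1) \<le> exp (- r * t) * (- r * R 1))" by blast
qed (use init left t x in auto)

section \<open>Functions whose derivative is a power at an endpoint\<close>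

text \<open>Integrating \<open>k x\<^sup>-\<^sup>p \<le> S' \<le> M x\<^sup>-\<^sup>p\<close>, in the form that \<open>(1 - p) S - k x\<^sup>1\<^sup>-\<^sup>p\<close> and
  \<open>M x\<^sup>1\<^sup>-\<^sup>p - (1 - p) S\<close> are nondecreasing and vanish at 0.\<close>

lemma edge_growth:
  fixes S h :: "real \<Rightarrow> real"
  assumes p: "p < 1" and c: "0 < c"
    and h: "continuous_on {0..c} h" "\<And>x. x \<in> {0..c} \<Longrightarrow> h x > 0"
    and S: "continuous_on {0..c} S" "S 0 = 0"
    and S': "\<And>x. x \<in> {0<..<c} \<Longrightarrow> (S has_real_derivative x powr - p * h x) (at x)"
  obtains k M where "k > 0" "M > 0" "\<And>x. x \<in> {0..c} \<Longrightarrow> k \<le> h x \<and> h x \<le> M"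
    "\<And>x. x \<in> {0..c} \<Longrightarrow> k * x powr (1 - p) \<le> (1 - p) * S x \<and> (1 - p) * S x \<le> M * x powr (1 - p)"
proof -
  obtain xk where xk: "xk \<in> {0..c}" "\<And>x. x \<in> {0..c} \<Longrightarrow> h xk \<le> h x"
    using continuous_attains_inf[of "{0..c}" h] h c by auto
  obtain xM where xM: "xM \<in> {0..c}" "\<And>x. x \<in> {0..c} \<Longrightarrow> h x \<le> h xM"
    using continuous_attains_sup[of "{0..c}" h] h c by auto
  have mono: "0 \<le> e * ((1 - p) * S x - r * x powr (1 - p))"
    if x: "x \<in> {0..c}" and r: "\<And>y. y \<in> {0..c} \<Longrightarrow> 0 \<le> e * (h y - r)" for e r x
  proof -
    \<comment> \<open>The sign \<open>e\<close> handles the lower bound (\<open>e = 1\<close>) and the upper bound (\<open>e = -1\<close>) at once.\<close>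
    have "(\<lambda>x. e * ((1 - p) * S x - r * x powr (1 - p))) 0 \<le> (\<lambda>x. e * ((1 - p) * S x - r * x powr (1 - p))) x"
    proof (rule DERIV_nonneg_imp_increasing_open[of 0 x "\<lambda>x. e * ((1 - p) * S x - r * x powr (1 - p))"])
      show "continuous_on {0..x} (\<lambda>x. e * ((1 - p) * S x - r * x powr (1 - p)))"
        using x p by (intro continuous_intros continuous_on_powr' continuous_on_subset[OF S(1)]) auto
      show "\<exists>d. ((\<lambda>x. e * ((1 - p) * S x - r * x powr (1 - p))) has_real_derivative d) (at y) \<and> 0 \<le> d"
        if "0 < y" "y < x" for y
      proof (intro exI conjI)
        show "((\<lambda>x. e * ((1 - p) * S x - r * x powr (1 - p))) has_real_derivative
            e * ((1 - p) * (y powr - p * h y) - r * ((1 - p) * y powr (1 - p - 1)))) (at y)"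
          using that x by (intro DERIV_cmult DERIV_diff S' has_real_derivative_powr) auto
        have "e * ((1 - p) * (y powr - p * h y) - r * ((1 - p) * y powr (1 - p - 1)))
            = (1 - p) * y powr - p * (e * (h y - r))" by (simp add: algebra_simps)
        also have "\<dots> \<ge> 0" using p r[of y] that x by (intro mult_nonneg_nonneg[OF mult_nonneg_nonneg]) auto
        finally show "0 \<le> e * ((1 - p) * (y powr - p * h y) - r * ((1 - p) * y powr (1 - p - 1)))" .
      qed
    qed (use x in auto)
    then show ?thesis using S p by simp
  qed
  show thesis
  proof (rule that[of "h xk" "h xM"])
    show "h xk > 0" "h xM > 0" using xk xM h by auto
    show "h xk \<le> h x \<and> h x \<le> h xM" if "x \<in> {0..c}" for x using xk xM that by auto
    show "h xk * x powr (1 - p) \<le> (1 - p) * S x \<and> (1 - p) * S x \<le> h xM * x powr (1 - p)"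
      if "x \<in> {0..c}" for x
      using mono[OF that, of 1 "h xk"] mono[OF that, of "-1" "h xM"] xk xM by auto
  qed
qed

text \<open>Both sides are comparable to \<open>x\<^sup>1\<^sup>-\<^sup>p\<close>. This bound on \<open>x S' / S\<close> is what compensates the
  degeneracy of the diffusion coefficient at 0.\<close>

lemma edge_logarithmic_slope:
  fixes S h :: "real \<Rightarrow> real"
  assumes p: "p < 1" and c: "0 < c"
    and h: "continuous_on {0..c} h" "\<And>x. x \<in> {0..c} \<Longrightarrow> h x > 0"
    and S: "continuous_on {0..c} S" "S 0 = 0"
    and S': "\<And>x. x \<in> {0<..<c} \<Longrightarrow> (S has_real_derivative x powr - p * h x) (at x)"
  shows "\<exists>\<delta>>0. \<forall>x\<in>{0<..c}. \<delta> * S x \<le> x * (x powr - p * h x)"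
proof -
  obtain k M where kM: "k > 0" "M > 0" "\<And>x. x \<in> {0..c} \<Longrightarrow> k \<le> h x \<and> h x \<le> M"
    "\<And>x. x \<in> {0..c} \<Longrightarrow> k * x powr (1 - p) \<le> (1 - p) * S x \<and> (1 - p) * S x \<le> M * x powr (1 - p)"
    using edge_growth[OF assms] by blast
  show ?thesis
  proof (intro exI conjI ballI)
    show "k * (1 - p) / M > 0" using kM p by simp
    fix x assume x: "x \<in> {0<..c}"
    have "k * (1 - p) / M * S x = k / M * ((1 - p) * S x)" by simp
    also have "\<dots> \<le> k / M * (M * x powr (1 - p))" using kM x by (intro mult_left_mono) auto
    also have "\<dots> = x powr (1 - p) * k" using kM by simp
    also have "\<dots> \<le> x powr (1 - p) * h x" using kM x by (intro mult_left_mono) auto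
    also have "\<dots> = x * (x powr - p * h x)" using x by (simp add: powr_diff powr_minus_divide)
    finally show "k * (1 - p) / M * S x \<le> x * (x powr - p * h x)" .
  qed
qed

text \<open>For \<open>\<gamma> (1 - p) \<le> 1\<close> the function \<open>S\<^sup>\<gamma>\<close>, of order \<open>x\<^sup>\<gamma>\<^sup>(\<^sup>1\<^sup>-\<^sup>p\<^sup>)\<close>, dominates the distance to
  the endpoint up to a constant. This is how a Lyapunov function controls Lipschitz test functions.\<close>

lemma edge_power_bound:
  fixes S h :: "real \<Rightarrow> real"
  assumes p: "p < 1" and c: "0 < c"
    and h: "continuous_on {0..c} h" "\<And>x. x \<in> {0..c} \<Longrightarrow> h x > 0"
    and S: "continuous_on {0..c} S" "S 0 = 0"
    and S': "\<And>x. x \<in> {0<..<c} \<Longrightarrow> (S has_real_derivative x powr - p * h x) (at x)"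
    and \<gamma>: "\<gamma> > 0" "\<gamma> * (1 - p) \<le> 1" and "c \<le> 1"
  shows "\<exists>C>0. \<forall>x\<in>{0..c}. x \<le> C * S x powr \<gamma>"
proof -
  obtain k M where kM: "k > 0" "M > 0" "\<And>x. x \<in> {0..c} \<Longrightarrow> k \<le> h x \<and> h x \<le> M"
    "\<And>x. x \<in> {0..c} \<Longrightarrow> k * x powr (1 - p) \<le> (1 - p) * S x \<and> (1 - p) * S x \<le> M * x powr (1 - p)"
    using edge_growth[OF p c h S S'] by blast
  show ?thesis
  proof (intro exI conjI ballI)
    show "((1 - p) / k) powr \<gamma> > 0" using kM p by simp
    fix x assume x: "x \<in> {0..c}"
    show "x \<le> ((1 - p) / k) powr \<gamma> * S x powr \<gamma>"
    proof (cases "x = 0")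
      case False
      then have x0: "0 < x" "x \<le> 1" using x \<open>c \<le> 1\<close> by auto
      have le: "x powr (1 - p) \<le> (1 - p) / k * S x" using kM x by (simp add: field_simps)
      have "x = x powr 1" using x0 by simp
      also have "\<dots> \<le> x powr ((1 - p) * \<gamma>)"
        using x0 \<gamma> by (intro powr_mono') (auto simp: mult.commute)
      also have "\<dots> = (x powr (1 - p)) powr \<gamma>" by (simp add: powr_powr)
      also have "\<dots> \<le> ((1 - p) / k * S x) powr \<gamma>" using \<gamma> le by (intro powr_mono2) auto
      also have "\<dots> = ((1 - p) / k) powr \<gamma> * S x powr \<gamma>"
      proof -
        have pos: "0 < (1 - p) / k * S x" using le x0 by (metis less_le_trans powr_gt_zero order_less_irrefl)
        have pk: "0 < (1 - p) / k" using p kM by simp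
        have "0 \<le> S x" using pos pk less_imp_le zero_less_mult_pos by blast
        then show ?thesis using pk powr_mult[of "(1 - p) / k" "S x" \<gamma>] by simp
      qed
      finally show ?thesis .
    qed simp
  qed
qed

section \<open>The scale function\<close>

text \<open>The real power with value 1 for exponent 0 also at the origin, where \<open>powr\<close> gives 0. At an
  endpoint with exponent 0 the scale density is then continuous up to the boundary.\<close>

definition rpow :: "real \<Rightarrow> real \<Rightarrow> real" where
  "rpow x p = (if p = 0 then 1 else x powr p)"

lemma rpow_eq_powr: "0 < x \<Longrightarrow> rpow x p = x powr p"
  by (simp add: rpow_def)

lemma rpow_pos: "0 < x \<or> p = 0 \<Longrightarrow> rpow x p > 0"
  by (auto simp: rpow_def)

lemma has_derivative_rpow:
  assumes "0 < x \<or> p = 0"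
  shows "((\<lambda>x. rpow x p) has_real_derivative p * rpow x p / x) (at x)"
proof (cases "p = 0")
  case False
  then have "x > 0" using assms by simp
  then show ?thesis
    using has_real_derivative_powr[of x p] False by (simp add: rpow_def powr_diff)
qed (simp add: rpow_def)

lemma continuous_on_rpow [continuous_intros]:
  assumes "continuous_on X f" "\<And>x. x \<in> X \<Longrightarrow> 0 < f x \<or> p = 0"
  shows "continuous_on X (\<lambda>x. rpow (f x) p)"
proof (cases "p = 0")
  case False
  then have "\<forall>x\<in>X. f x \<noteq> 0" using assms(2) by force
  then show ?thesis using False assms(1) by (auto simp: rpow_def intro!: continuous_intros)
qed (simp add: rpow_def)

text \<open>The solution of \<open>s' = - (p / x + q / (1 - x) + g) s\<close>, which is the equation \<open>S'' + (B / A) S' = 0\<close>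
  for \<open>s = S'\<close>.\<close>

definition scale_density :: "(real \<Rightarrow> real) \<Rightarrow> real \<Rightarrow> real \<Rightarrow> real \<Rightarrow> real" where
  "scale_density g p q x = rpow x (- p) * rpow (1 - x) q * exp (- integral {0..x} g)"

definition scale_function :: "(real \<Rightarrow> real) \<Rightarrow> real \<Rightarrow> real \<Rightarrow> real \<Rightarrow> real" where
  "scale_function g p q x = integral {0..x} (scale_density g p q)"

text \<open>The points of \<open>[0,1]\<close> up to which the scale density is differentiable: an endpoint belongs to
  them if and only if its exponent vanishes.\<close>

definition regular_points :: "real \<Rightarrow> real \<Rightarrow> real set" where
  "regular_points p q = {x \<in> {0..1}. (0 < x \<or> p = 0) \<and> (x < 1 \<or> q = 0)}"

lemma regular_points_interior [simp]: "0 < x \<Longrightarrow> x < 1 \<Longrightarrow> x \<in> regular_points p q"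
  by (auto simp: regular_points_def)

lemma scale_density_pos: "x \<in> regular_points p q \<Longrightarrow> scale_density g p q x > 0"
  by (auto simp: scale_density_def regular_points_def intro!: mult_pos_pos rpow_pos)

lemma scale_density_deriv:
  assumes g: "continuous_on {0..1} g" and x: "x \<in> regular_points p q"
  shows "(scale_density g p q has_real_derivative
    scale_density g p q x * (- p / x - q / (1 - x) - g x)) (at x within {0..1})"
proof -
  have x': "x \<in> {0..1}" "0 < x \<or> - p = 0" "0 < 1 - x \<or> q = 0" using x by (auto simp: regular_points_def)
  have "((\<lambda>x. 1 - x) has_real_derivative - 1) (at x within {0..1})"
    by (auto intro!: derivative_eq_intros)
  from DERIV_chain2[where f = "\<lambda>y. rpow y q", OF has_derivative_rpow[OF x'(3)] this]
  have d2: "((\<lambda>x. rpow (1 - x) q) has_real_derivative q * rpow (1 - x) q / (1 - x) * - 1) (at x within {0..1})" .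
  have d1: "((\<lambda>x. rpow x (- p)) has_real_derivative - p * rpow x (- p) / x) (at x within {0..1})"
    by (rule has_field_derivative_at_within[OF has_derivative_rpow[OF x'(2)]])
  have "((\<lambda>x. integral {0..x} g) has_real_derivative g x) (at x within {0..1})"
    by (rule integral_has_real_derivative[OF g x'(1)])
  from DERIV_chain2[where f = exp, OF DERIV_exp DERIV_minus[OF this]]
  have d3: "((\<lambda>x. exp (- integral {0..x} g)) has_real_derivative exp (- integral {0..x} g) * - g x)
    (at x within {0..1})" .
  show ?thesis
    using DERIV_mult[OF DERIV_mult[OF d1 d2] d3] unfolding scale_density_def[abs_def]
    by (rule DERIV_cong) (simp add: algebra_simps)
qed

lemma scale_density_continuous:
  assumes g: "continuous_on {0..1} g"
  shows "continuous_on (regular_points p q) (scale_density g p q)"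
  unfolding continuous_on_eq_continuous_within
proof
  fix x assume "x \<in> regular_points p q"
  from DERIV_continuous[OF scale_density_deriv[OF g this]]
  show "continuous (at x within regular_points p q) (scale_density g p q)"
    by (rule continuous_within_subset) (auto simp: regular_points_def)
qed

text \<open>Domination on the open interval is enough, since the endpoints form a null set; the scale
  density is in general neither bounded nor dominated at the endpoints themselves.\<close>

lemma integrable_on_dominated_interior:
  fixes f g :: "real \<Rightarrow> real"
  assumes "continuous_on {a<..<b} f" "g integrable_on {a..b}"
    and "\<And>x. x \<in> {a<..<b} \<Longrightarrow> \<bar>f x\<bar> \<le> g x"
  shows "f integrable_on {a..b}"
proof -
  have neg: "negligible {x \<in> {a..b} - {a<..<b}. P x}" "negligible {x \<in> {a<..<b} - {a..b}. P x}" for P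
    by (rule negligible_subset[of "{a, b}"]; auto)+
  have "g integrable_on {a<..<b}"
    by (rule integrable_spike_set[OF assms(2) neg])
  moreover have "f \<in> borel_measurable (lebesgue_on {a<..<b})"
    by (rule continuous_imp_measurable_on_sets_lebesgue[OF assms(1)]) simp
  ultimately have "f integrable_on {a<..<b}"
    using assms(3) measurable_bounded_by_integrable_imp_integrable[of f "{a<..<b}" g] by simp
  then show ?thesis by (rule integrable_spike_set[OF _ neg(2) neg(1)])
qed

lemma integrable_on_powr_to_1:
  assumes "q > -1" "0 \<le> a" "a \<le> 1"
  shows "(\<lambda>x::real. (1 - x) powr q) integrable_on {a..1}"
proof -
  have "((\<lambda>x. (1 - x) powr q) has_integral
    - ((1 - 1) powr (q + 1)) / (q + 1) - - ((1 - a) powr (q + 1)) / (q + 1)) {a..1}"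
  proof (rule fundamental_theorem_of_calculus_interior)
    show "continuous_on {a..1} (\<lambda>x. - ((1 - x) powr (q + 1)) / (q + 1))"
      using assms by (intro continuous_intros continuous_on_powr') auto
    fix x assume x: "x \<in> {a<..<1}"
    have "((\<lambda>x. 1 - x) has_real_derivative - 1) (at x)" by (auto intro!: derivative_eq_intros)
    from DERIV_chain2[where f = "\<lambda>y. y powr (q + 1)", OF has_real_derivative_powr this]
    have "((\<lambda>x. (1 - x) powr (q + 1)) has_real_derivative (q + 1) * (1 - x) powr q * - 1) (at x)"
      using x by simp
    from DERIV_cdivide[OF DERIV_minus[OF this], of "q + 1"]
    have "((\<lambda>x. - ((1 - x) powr (q + 1)) / (q + 1)) has_real_derivative (1 - x) powr q) (at x)"
      by (rule DERIV_cong) (use assms in \<open>simp add: field_simps\<close>)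
    then show "((\<lambda>x. - ((1 - x) powr (q + 1)) / (q + 1)) has_vector_derivative (1 - x) powr q) (at x)"
      by (simp add: has_real_derivative_iff_has_vector_derivative)
  qed (use assms in simp)
  then show ?thesis by blast
qed

text \<open>Near 0 the density is at most a multiple of \<open>x\<^sup>-\<^sup>p\<close>, near 1 at most a multiple of
  \<open>(1 - x)\<^sup>q\<close>. The conditions \<open>p < 1\<close> and \<open>q > -1\<close> hold if 0 and 1 are tangent.\<close>

lemma scale_density_integrable:
  assumes g: "continuous_on {0..1} g" and p: "p < 1" and c: "0 \<le> c" "c \<le> 1" "c < 1 \<or> q > -1"
  shows "scale_density g p q integrable_on {0..c}"
proof -
  have cont: "continuous_on {a<..<b} (scale_density g p q)" if "0 \<le> a" "b \<le> 1" for a b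
    by (rule continuous_on_subset[OF scale_density_continuous[OF g]])
       (use that in \<open>auto simp: regular_points_def\<close>)
  have G: "continuous_on {0..1} (\<lambda>x. exp (- integral {0..x} g))"
    using indefinite_integral_continuous_1[OF integrable_continuous_real[OF g]]
    by (intro continuous_intros)
  have left: "scale_density g p q integrable_on {0..c}" if c: "0 \<le> c" "c < 1" for c
  proof -
    have "continuous_on {0..c} (\<lambda>x. rpow (1 - x) q * exp (- integral {0..x} g))"
      using c by (intro continuous_intros continuous_on_subset[OF G]) auto
    then obtain y where y: "y \<in> {0..c}"
      "\<And>x. x \<in> {0..c} \<Longrightarrow> rpow (1 - x) q * exp (- integral {0..x} g) \<le> rpow (1 - y) q * exp (- integral {0..y} g)"
      using c continuous_attains_sup[of "{0..c}" "\<lambda>x. rpow (1 - x) q * exp (- integral {0..x} g)"] by auto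
    define M where "M = rpow (1 - y) q * exp (- integral {0..y} g)"
    show ?thesis
    proof (rule integrable_on_dominated_interior[where g = "\<lambda>x. M * x powr - p"])
      show "(\<lambda>x. M * x powr - p) integrable_on {0..c}"
        using p c by (intro integrable_on_mult_right integrable_on_powr_from_0) auto
      fix x assume x: "x \<in> {0<..<c}"
      then have "scale_density g p q x > 0"
        using c by (intro scale_density_pos) (auto simp: regular_points_def)
      moreover have "scale_density g p q x \<le> M * x powr - p"
        using x y(2)[of x]
        by (simp add: scale_density_def rpow_eq_powr M_def mult.assoc mult.commute[of "x powr - p"] mult_right_mono)
      ultimately show "\<bar>scale_density g p q x\<bar> \<le> M * x powr - p" by simp
    qed (use cont c in auto)
  qed
  show ?thesis
  proof (cases "c < 1")
    case False
    then have c1: "c = 1" "q > -1" using c by auto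
    have "continuous_on {1/2..1} (\<lambda>x. rpow x (- p) * exp (- integral {0..x} g))"
      by (intro continuous_intros continuous_on_subset[OF G]) auto
    then obtain y where y: "y \<in> {1/2..1}"
      "\<And>x. x \<in> {1/2..1} \<Longrightarrow> rpow x (- p) * exp (- integral {0..x} g) \<le> rpow y (- p) * exp (- integral {0..y} g)"
      using continuous_attains_sup[of "{1/2..1}" "\<lambda>x. rpow x (- p) * exp (- integral {0..x} g)"] by auto
    define M where "M = rpow y (- p) * exp (- integral {0..y} g)"
    have "scale_density g p q integrable_on {1/2..1}"
    proof (rule integrable_on_dominated_interior[where g = "\<lambda>x. M * (1 - x) powr q"])
      show "(\<lambda>x. M * (1 - x) powr q) integrable_on {1/2..1}"
        using c1 by (intro integrable_on_mult_right integrable_on_powr_to_1) auto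
      fix x :: real assume x: "x \<in> {1/2<..<1}"
      then have "scale_density g p q x > 0"
        by (intro scale_density_pos) (auto simp: regular_points_def)
      moreover have "scale_density g p q x = (1 - x) powr q * (rpow x (- p) * exp (- integral {0..x} g))"
        using x by (simp add: scale_density_def rpow_eq_powr)
      moreover have "\<dots> \<le> (1 - x) powr q * M"
        using x y(2)[of x] by (intro mult_left_mono) (auto simp: M_def)
      ultimately show "\<bar>scale_density g p q x\<bar> \<le> M * (1 - x) powr q" by (simp add: mult.commute)
    qed (use cont[of "1/2" 1] in auto)
    with left[of "1/2"] show ?thesis unfolding c1
      by (intro Henstock_Kurzweil_Integration.integrable_combine[of 0 "1/2" 1]) auto
  qed (use left c in auto)
qed

lemma scale_function_0: "scale_function g p q 0 = 0"
  by (simp add: scale_function_def)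

lemma scale_function_continuous:
  assumes "continuous_on {0..1} g" "p < 1" "0 \<le> c" "c \<le> 1" "c < 1 \<or> q > -1"
  shows "continuous_on {0..c} (scale_function g p q)"
  unfolding scale_function_def
  by (rule indefinite_integral_continuous_1[OF scale_density_integrable[OF assms]])

text \<open>At an endpoint with exponent 0 the derivative is one-sided; it exists because the density is
  continuous there.\<close>

lemma scale_function_deriv_within:
  assumes g: "continuous_on {0..1} g" and p: "p < 1" and x: "x \<in> regular_points p q"
  shows "(scale_function g p q has_real_derivative scale_density g p q x) (at x within {0..1})"
proof -
  \<comment> \<open>The density need not be integrable up to 1, so the integral is first restricted to \<open>[0,c]\<close> with \<open>x < c < 1\<close>, unless \<open>x = 1\<close>.\<close>
  define c where "c = (if x < 1 then (x + 1) / 2 else 1)"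
  have c: "0 \<le> c" "c \<le> 1" "c < 1 \<or> q > -1" "x \<in> {0..c}"
    using x unfolding c_def regular_points_def by (auto split: if_splits)
  have "continuous (at x within {0..1}) (scale_density g p q)"
    by (rule DERIV_continuous[OF scale_density_deriv[OF g x]])
  then have "continuous (at x within {0..c} - {}) (scale_density g p q)"
    by (rule continuous_within_subset) (use c in auto)
  with integral_has_vector_derivative_continuous_at[OF scale_density_integrable[OF g p c(1-3)], of x "{}"] c
  have "(scale_function g p q has_vector_derivative scale_density g p q x) (at x within {0..c})"
    by (simp add: scale_function_def[abs_def])
  moreover have "at x within {0..c} = at x within {0..1}"
  proof (cases "x < 1")
    case True
    then have "x < c" "c \<le> 1" using c by (simp_all add: c_def)
    then have "{0..c} \<inter> {..<c} - {x} = {0..1} \<inter> {..<c} - {x}" by auto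
    from at_within_nhd[OF _ _ this] show ?thesis using \<open>x < c\<close> by simp
  qed (simp add: c_def)
  ultimately show ?thesis by (simp add: has_real_derivative_iff_has_vector_derivative)
qed

lemma scale_function_deriv:
  assumes g: "continuous_on {0..1} g" and p: "p < 1" and x: "x \<in> {0<..<1}"
  shows "(scale_function g p q has_real_derivative scale_density g p q x) (at x)"
    and "(scale_density g p q has_real_derivative
          scale_density g p q x * (- p / x - q / (1 - x) - g x)) (at x)"
proof -
  have reg: "x \<in> regular_points p q" and eq: "at x within {0..1} = at x"
    using x at_within_Icc_at[of 0 x 1] by simp_all
  show "(scale_function g p q has_real_derivative scale_density g p q x) (at x)"
    using scale_function_deriv_within[OF g p reg] unfolding eq .
  show "(scale_density g p q has_real_derivative
      scale_density g p q x * (- p / x - q / (1 - x) - g x)) (at x)"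
    using scale_density_deriv[OF g reg] unfolding eq .
qed

lemma scale_function_strict_mono:
  assumes g: "continuous_on {0..1} g" and p: "p < 1" and "0 \<le> x" "x < y" "y \<le> 1" "y < 1 \<or> q > -1"
  shows "scale_function g p q x < scale_function g p q y"
proof (rule DERIV_pos_imp_increasing_open[OF \<open>x < y\<close>])
  show "\<exists>d. (scale_function g p q has_real_derivative d) (at z) \<and> 0 < d" if "x < z" "z < y" for z
  proof (intro exI conjI)
    have z: "z \<in> {0<..<1}" using that assms by auto
    then show "(scale_function g p q has_real_derivative scale_density g p q z) (at z)"
      by (rule scale_function_deriv(1)[OF g p])
    show "0 < scale_density g p q z" using z by (intro scale_density_pos) simp
  qed
  show "continuous_on {x..y} (scale_function g p q)"
    by (rule continuous_on_subset[OF scale_function_continuous[OF g p, of y q]]) (use assms in auto)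
qed

lemma scale_function_pos:
  assumes "continuous_on {0..1} g" "p < 1" "0 < x" "x \<le> 1" "x < 1 \<or> q > -1"
  shows "scale_function g p q x > 0"
  using scale_function_strict_mono[OF assms(1,2), of 0 x q] assms by (simp add: scale_function_0)

section \<open>Degenerate operators in normal form\<close>

text \<open>The derivatives of \<open>Y\<^sup>\<gamma>\<close>, with \<open>Y\<^sup>\<gamma>\<close> factored out so that the quotient \<open>L (Y\<^sup>\<gamma>) / Y\<^sup>\<gamma>\<close> can be
  read off.\<close>

lemma powr_function_derivs:
  fixes Y Y1 :: "real \<Rightarrow> real"
  assumes Y: "Y x > 0" and Y': "(Y has_real_derivative Y1 x) (at x within X)"
  shows "((\<lambda>z. Y z powr \<gamma>) has_real_derivative \<gamma> * Y x powr \<gamma> / Y x * Y1 x) (at x within X)"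
    and "(Y1 has_real_derivative y2) (at x within X) \<Longrightarrow>
      ((\<lambda>z. \<gamma> * Y z powr \<gamma> / Y z * Y1 z) has_real_derivative
        Y x powr \<gamma> * (\<gamma> * (\<gamma> - 1) * (Y1 x / Y x)\<^sup>2 + \<gamma> * y2 / Y x)) (at x within X)"
proof -
  have "((\<lambda>z. Y z powr \<gamma>) has_real_derivative \<gamma> * Y x powr (\<gamma> - 1) * Y1 x) (at x within X)"
    by (rule DERIV_chain2[where f = "\<lambda>y. y powr \<gamma>", OF has_real_derivative_powr[OF Y] Y'])
  then show d: "((\<lambda>z. Y z powr \<gamma>) has_real_derivative \<gamma> * Y x powr \<gamma> / Y x * Y1 x) (at x within X)"
    using Y by (simp add: powr_diff)
  assume Y'': "(Y1 has_real_derivative y2) (at x within X)"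
  show "((\<lambda>z. \<gamma> * Y z powr \<gamma> / Y z * Y1 z) has_real_derivative
        Y x powr \<gamma> * (\<gamma> * (\<gamma> - 1) * (Y1 x / Y x)\<^sup>2 + \<gamma> * y2 / Y x)) (at x within X)"
    by (rule DERIV_cong[OF DERIV_mult[OF DERIV_divide[OF DERIV_cmult[OF d] Y'] Y'']])
       (use Y in \<open>auto simp: field_simps power2_eq_square\<close>)
qed

text \<open>The inequality \<open>L (Y\<^sup>\<gamma>) \<le> - r Y\<^sup>\<gamma>\<close> at a point, where \<open>a\<close>, \<open>b\<close> are the coefficients of \<open>L\<close> and
  \<open>y1\<close>, \<open>y2\<close> the derivatives of \<open>Y\<close>. For \<open>\<gamma> < 1\<close> the term with \<open>\<gamma> - 1\<close> is a source of decay.\<close>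

lemma operator_powr:
  fixes a b Y y1 y2 \<gamma> r :: real
  assumes "Y > 0" and harm: "\<gamma> * (\<gamma> - 1) * a * (y1 / Y)\<^sup>2 + \<gamma> * (a * y2 + b * y1) / Y \<le> - r"
  shows "a * (Y powr \<gamma> * (\<gamma> * (\<gamma> - 1) * (y1 / Y)\<^sup>2 + \<gamma> * y2 / Y)) + b * (\<gamma> * Y powr \<gamma> / Y * y1)
     \<le> - r * Y powr \<gamma>"
proof -
  have "a * (Y powr \<gamma> * (\<gamma> * (\<gamma> - 1) * (y1 / Y)\<^sup>2 + \<gamma> * y2 / Y)) + b * (\<gamma> * Y powr \<gamma> / Y * y1)
     = Y powr \<gamma> * (\<gamma> * (\<gamma> - 1) * a * (y1 / Y)\<^sup>2 + \<gamma> * (a * y2 + b * y1) / Y)"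
    using \<open>Y > 0\<close> by (simp add: field_simps)
  also have "\<dots> \<le> Y powr \<gamma> * - r" using harm by (intro mult_left_mono) auto
  finally show ?thesis by (simp add: mult.commute)
qed

text \<open>Operators \<open>A d\<^sup>2/dx\<^sup>2 + B d/dx\<close> in a form that depends on the endpoint behaviour only through the
  numbers \<open>p\<close>, \<open>q\<close> and the orders of degeneracy \<open>j\<close>, \<open>k\<close>. The form is invariant under
  \<open>x \<mapsto> 1 - x\<close>, which exchanges \<open>p\<close> with \<open>- q\<close> and \<open>j\<close> with \<open>k\<close>.\<close>

locale boundary_operator =
  fixes A B g :: "real \<Rightarrow> real" and p q \<kappa> :: real and j k :: nat
  assumes g: "continuous_on {0..1} g" and \<kappa>: "\<kappa> > 0" and jk: "j \<le> 2" "k \<le> 2"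
    and A_lower: "x \<in> {0<..<1} \<Longrightarrow> \<kappa> * (x ^ j * (1 - x) ^ k) \<le> A x"
    and B_eq: "x \<in> {0<..<1} \<Longrightarrow> B x = A x * (p / x + q / (1 - x) + g x)"
begin

lemma A_ge_power: 
  assumes "x \<in> {0<..<1}" "k \<le> n"
  shows "\<kappa> * (x\<^sup>2 * (1 - x) ^ n) \<le> A x"
proof -
  have "\<kappa> * (x\<^sup>2 * (1 - x) ^ n) \<le> \<kappa> * (x ^ j * (1 - x) ^ k)"
    using assms \<kappa> jk by (intro mult_left_mono mult_mono power_decreasing) auto
  then show ?thesis using A_lower[OF assms(1)] by simp
qed

lemma A_pos: "x \<in> {0<..<1} \<Longrightarrow> A x > 0"
  using A_ge_power[of x 2] jk \<kappa> by (smt (verit) greaterThanLessThan_iff mult_pos_pos zero_less_power)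

lemma reflected: "boundary_operator (\<lambda>x. A (1 - x)) (\<lambda>x. - B (1 - x)) (\<lambda>x. - g (1 - x)) (- q) (- p) \<kappa> k j"
proof
  show "continuous_on {0..1} (\<lambda>x. - g (1 - x))"
    by (intro continuous_intros continuous_on_compose2[OF g]) auto
  fix x :: real assume x: "x \<in> {0<..<1}"
  then show "\<kappa> * (x ^ k * (1 - x) ^ j) \<le> A (1 - x)" using A_lower[of "1 - x"] by (simp add: mult.commute)
  show "- B (1 - x) = A (1 - x) * (- q / x + - p / (1 - x) + - g (1 - x))"
    using x B_eq[of "1 - x"] by (simp add: algebra_simps)
qed (use \<kappa> jk in auto)

abbreviation "s r \<equiv> scale_density g p r"
abbreviation "s' r x \<equiv> scale_density g p r x * (- p / x - r / (1 - x) - g x)"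
abbreviation "S r \<equiv> scale_function g p r"

text \<open>The scale function with exponent \<open>r\<close> at 1 satisfies \<open>L S = A S' (q - r) / (1 - x)\<close>: it is
  harmonic for \<open>r = q\<close>, and superharmonic for \<open>r = 0\<close> if \<open>q < 0\<close>.\<close>

lemma operator_scale:
  assumes x: "x \<in> {0<..<1}"
  shows "A x * s' r x + B x * s r x = A x * s r x * ((q - r) / (1 - x))"
  unfolding B_eq[OF x] by (simp add: algebra_simps diff_divide_distrib)

lemma exp_integral_continuous: "continuous_on {0..1} (\<lambda>x. exp (- integral {0..x} g))"
  using indefinite_integral_continuous_1[OF integrable_continuous_real[OF g]]
  by (intro continuous_intros)

text \<open>The bounds for functions with power-law derivative, applied to \<open>S\<close>. For \<open>r = 0\<close> the density has
  no singularity at 1 and \<open>c = 1\<close> is possible.\<close>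

lemma scale_near_0:
  assumes p: "p < 1" and c: "0 < c" "c \<le> 1" "c < 1 \<or> r = 0"
  shows scale_slope: "\<exists>\<delta>>0. \<forall>x\<in>{0<..c}. \<delta> * S r x \<le> x * s r x"
    and scale_power_bound_near_0: "0 < \<gamma> \<Longrightarrow> \<gamma> * (1 - p) \<le> 1 \<Longrightarrow> \<exists>C>0. \<forall>x\<in>{0..c}. x \<le> C * S r x powr \<gamma>"
proof -
  define h where "h = (\<lambda>x. rpow (1 - x) r * exp (- integral {0..x} g))"
  have eq: "x powr - p * h x = s r x" if "x > 0" for x
    using that by (simp add: h_def scale_density_def rpow_eq_powr)
  have 1: "continuous_on {0..c} h"
    unfolding h_def using c by (intro continuous_intros continuous_on_subset[OF exp_integral_continuous]) auto
  have 2: "h x > 0" if "x \<in> {0..c}" for x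
    using that c unfolding h_def by (intro mult_pos_pos rpow_pos) auto
  have 3: "continuous_on {0..c} (S r)" by (rule scale_function_continuous[OF g p]) (use c in auto)
  have 4: "(S r has_real_derivative x powr - p * h x) (at x)" if "x \<in> {0<..<c}" for x
    using scale_function_deriv(1)[OF g p, of x r] that c eq[of x] by auto
  show "\<exists>\<delta>>0. \<forall>x\<in>{0<..c}. \<delta> * S r x \<le> x * s r x"
    using edge_logarithmic_slope[OF p c(1) 1 2 3 scale_function_0 4] eq by (metis greaterThanAtMost_iff)
  show "\<exists>C>0. \<forall>x\<in>{0..c}. x \<le> C * S r x powr \<gamma>" if "0 < \<gamma>" "\<gamma> * (1 - p) \<le> 1"
    by (rule edge_power_bound[OF p c(1) 1 2 3 scale_function_0 4 that c(2)])
qed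

text \<open>Away from 0 the bound persists by monotonicity of \<open>S\<close>; the factor 2 accounts for \<open>x \<le> 1\<close> on the
  right half of the interval.\<close>

lemma scale_power_bound:
  assumes p: "p < 1" and \<gamma>: "0 < \<gamma>" "\<gamma> * (1 - p) \<le> 1"
  shows "\<exists>C>0. \<forall>x\<in>{0..1}. x < 1 \<or> r > -1 \<longrightarrow> x \<le> C * S r x powr \<gamma>"
proof -
  obtain C where C: "C > 0" "\<And>x. x \<in> {0..1/2} \<Longrightarrow> x \<le> C * S r x powr \<gamma>"
    using scale_power_bound_near_0[OF p _ _ _ \<gamma>, of "1/2" r] by auto
  show ?thesis
  proof (intro exI conjI ballI impI)
    show "2 * C > 0" using C by simp
    fix x :: real assume x: "x \<in> {0..1}" "x < 1 \<or> r > -1"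
    show "x \<le> 2 * C * S r x powr \<gamma>"
    proof (cases "x \<le> 1/2")
      case True
      then have "x \<le> C * S r x powr \<gamma>" using C(2)[of x] x by simp
      moreover have "0 \<le> C * S r x powr \<gamma>" using C by simp
      ultimately show ?thesis by simp
    next
      case False
      have "S r (1/2) powr \<gamma> \<le> S r x powr \<gamma>"
        using scale_function_strict_mono[OF g p, of "1/2" x r] scale_function_pos[OF g p, of "1/2" r] False x \<gamma>
        by (intro powr_mono2) auto
      then have "C * S r (1/2) powr \<gamma> \<le> C * S r x powr \<gamma>" using C by simp
      then show ?thesis using C(2)[of "1/2"] x by auto
    qed
  qed
qed

end

section \<open>Two tangent endpoints\<close>

context boundary_operator
begin

text \<open>For two tangent endpoints this is the probability that the diffusion started at \<open>x\<close> ends in 1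
  rather than in 0.\<close>

definition hitting :: "real \<Rightarrow> real" where
  "hitting x = S q x / S q 1"

context
  assumes p: "p < 1" and q: "q > - 1"
begin

lemma scale_at_1_pos: "S q 1 > 0"
  using scale_function_pos[OF g p, of 1 q] q by simp

lemma hitting_continuous: "continuous_on {0..1} hitting"
  unfolding hitting_def[abs_def] using scale_function_continuous[OF g p, of 1 q] q scale_at_1_pos
  by (intro continuous_intros) auto

lemma hitting_endpoints: "hitting 0 = 0" "hitting 1 = 1"
  using scale_at_1_pos by (auto simp: hitting_def scale_function_0)

lemma hitting_bounds:
  shows "x \<in> {0<..<1} \<Longrightarrow> 0 < hitting x \<and> hitting x < 1" and "x \<in> {0..1} \<Longrightarrow> 0 \<le> hitting x \<and> hitting x \<le> 1"
proof -
  show *: "0 < hitting x \<and> hitting x < 1" if "x \<in> {0<..<1}" for x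
    using that scale_function_pos[OF g p, of x q] scale_function_strict_mono[OF g p, of x 1 q] q scale_at_1_pos
    by (simp add: hitting_def)
  show "0 \<le> hitting x \<and> hitting x \<le> 1" if "x \<in> {0..1}"
    using that *[of x] hitting_endpoints by (cases "x = 0 \<or> x = 1") auto
qed

lemma hitting_deriv_within:
  assumes "x \<in> regular_points p q"
  shows "(hitting has_real_derivative s q x / S q 1) (at x within {0..1})"
    and "((\<lambda>x. s q x / S q 1) has_real_derivative s' q x / S q 1) (at x within {0..1})"
  unfolding hitting_def[abs_def]
  using DERIV_cdivide[OF scale_function_deriv_within[OF g p assms]]
    DERIV_cdivide[OF scale_density_deriv[OF g assms]] by blast+

lemma hitting_deriv:
  assumes "x \<in> {0<..<1}"
  shows "(hitting has_real_derivative s q x / S q 1) (at x)"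
    and "((\<lambda>x. s q x / S q 1) has_real_derivative s' q x / S q 1) (at x)"
  unfolding hitting_def[abs_def]
  using DERIV_cdivide[OF scale_function_deriv(1)[OF g p assms]]
    DERIV_cdivide[OF scale_function_deriv(2)[OF g p assms]] by blast+

text \<open>The estimates at 1 are those at 0 for the reflected function \<open>1 - hitting (1 - x)\<close>, whose
  derivative is \<open>x\<^sup>q\<close> times a positive continuous function.\<close>

lemma hitting_near_1:
  shows "\<exists>\<delta>>0. \<forall>x\<in>{1/2..<1}. \<delta> * (1 - hitting x) \<le> (1 - x) * (s q x / S q 1)"
    and "0 < \<gamma> \<Longrightarrow> \<gamma> * (1 + q) \<le> 1 \<Longrightarrow> \<exists>C>0. \<forall>x\<in>{0..1}. 1 - x \<le> C * (1 - hitting x) powr \<gamma>"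
proof -
  define T where "T = (\<lambda>x. 1 - hitting (1 - x))"
  define h where "h = (\<lambda>x. rpow (1 - x) (- p) * exp (- integral {0..1 - x} g) / S q 1)"
  have eq: "x powr - (- q) * h x = s q (1 - x) / S q 1" if "x > 0" for x
    using that by (simp add: h_def scale_density_def rpow_eq_powr)
  have 1: "continuous_on {0..1/2} h"
    unfolding h_def using scale_at_1_pos
    by (intro continuous_intros continuous_on_compose2[OF exp_integral_continuous]) auto
  have 2: "h x > 0" if "x \<in> {0..1/2}" for x
    using that scale_at_1_pos unfolding h_def by (intro divide_pos_pos mult_pos_pos rpow_pos) auto
  have 3: "continuous_on {0..1/2} T" "T 0 = 0"
    unfolding T_def by (intro continuous_intros continuous_on_compose2[OF hitting_continuous])
      (auto simp: hitting_endpoints)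
  have 4: "(T has_real_derivative x powr - (- q) * h x) (at x)" if "x \<in> {0<..<1/2}" for x
  proof -
    have "((\<lambda>x. 1 - x) has_real_derivative - 1) (at x)" by (auto intro!: derivative_eq_intros)
    from DERIV_chain2[where f = hitting, OF hitting_deriv(1) this] that
    have "((\<lambda>x. hitting (1 - x)) has_real_derivative s q (1 - x) / S q 1 * - 1) (at x)" by simp
    from DERIV_diff[OF DERIV_const this, of 1] show ?thesis
      unfolding T_def using eq[of x] that by simp
  qed
  have q': "- q < 1" using q by simp
  obtain \<delta> where \<delta>: "\<delta> > 0" "\<And>x. x \<in> {0<..1/2} \<Longrightarrow> \<delta> * T x \<le> x * (x powr - (- q) * h x)"
    using edge_logarithmic_slope[OF q' _ 1 2 3 4] by auto
  show "\<exists>\<delta>>0. \<forall>x\<in>{1/2..<1}. \<delta> * (1 - hitting x) \<le> (1 - x) * (s q x / S q 1)"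
  proof (intro exI conjI ballI)
    fix x :: real assume x: "x \<in> {1/2..<1}"
    then show "\<delta> * (1 - hitting x) \<le> (1 - x) * (s q x / S q 1)"
      using \<delta>(2)[of "1 - x"] eq[of "1 - x"] by (auto simp: T_def)
  qed (rule \<delta>)
  assume \<gamma>: "0 < \<gamma>" "\<gamma> * (1 + q) \<le> 1"
  then have \<gamma>': "\<gamma> * (1 - (- q)) \<le> 1" by simp
  obtain C where C: "C > 0" "\<And>x. x \<in> {0..1/2} \<Longrightarrow> x \<le> C * T x powr \<gamma>"
    using edge_power_bound[OF q' _ 1 2 3 4 \<gamma>(1) \<gamma>'] by auto
  show "\<exists>C>0. \<forall>x\<in>{0..1}. 1 - x \<le> C * (1 - hitting x) powr \<gamma>"
  proof (intro exI conjI ballI)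
    show "2 * C > 0" using C by simp
    fix x :: real assume x: "x \<in> {0..1}"
    show "1 - x \<le> 2 * C * (1 - hitting x) powr \<gamma>"
    proof (cases "x \<ge> 1/2")
      case True
      then have "1 - x \<le> C * (1 - hitting x) powr \<gamma>" using C(2)[of "1 - x"] x by (simp add: T_def)
      moreover have "0 \<le> C * (1 - hitting x) powr \<gamma>" using C by simp
      ultimately show ?thesis by simp
    next
      case False
      have "S q x < S q (1/2)"
        by (rule scale_function_strict_mono[OF g p]) (use False x in auto)
      then have "hitting x \<le> hitting (1/2)" using scale_at_1_pos by (simp add: hitting_def divide_right_mono)
      then have "(1 - hitting (1/2)) powr \<gamma> \<le> (1 - hitting x) powr \<gamma>"
        using \<gamma> hitting_bounds(2)[of "1/2"] by (intro powr_mono2) auto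
      then have "C * (1 - hitting (1/2)) powr \<gamma> \<le> C * (1 - hitting x) powr \<gamma>" using C by simp
      then show ?thesis using C(2)[of "1/2"] x by (auto simp: T_def)
    qed
  qed
qed

lemma hitting_slope: 
  "\<exists>\<delta>>0. \<forall>x\<in>{0<..<1}. \<delta> * (hitting x * (1 - hitting x)) \<le> x * (1 - x) * (s q x / S q 1)"
proof -
  obtain d1 where d1: "d1 > 0" "\<And>x. x \<in> {0<..1/2} \<Longrightarrow> d1 * S q x \<le> x * s q x"
    using scale_slope[OF p, of "1/2" q] by auto
  obtain d2 where d2: "d2 > 0" "\<And>x. x \<in> {1/2..<1} \<Longrightarrow> d2 * (1 - hitting x) \<le> (1 - x) * (s q x / S q 1)"
    using hitting_near_1(1) by auto
  show ?thesis
  proof (intro exI conjI ballI)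
    show "min d1 d2 / 2 > 0" using d1 d2 by simp
    fix x :: real assume x: "x \<in> {0<..<1}"
    define v where "v = s q x / S q 1"
    have v: "v > 0" unfolding v_def using scale_at_1_pos x by (intro divide_pos_pos scale_density_pos) auto
    have hb: "0 < hitting x" "hitting x < 1" using hitting_bounds(1)[OF x] by auto
    have "min d1 d2 / 2 * (hitting x * (1 - hitting x)) \<le> x * (1 - x) * v"
    proof (cases "x \<le> 1/2")
      case True
      have "d1 * hitting x \<le> x * v"
        using d1(2)[of x] True x scale_at_1_pos by (simp add: hitting_def v_def divide_right_mono)
      then have "1/2 * (d1 * hitting x) \<le> (1 - x) * (x * v)"
        using True x d1 hb by (intro mult_mono[of "1/2" "1 - x" "d1 * hitting x" "x * v"]) auto
      moreover have "min d1 d2 / 2 * (hitting x * (1 - hitting x)) \<le> d1 / 2 * (hitting x * 1)"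
        using hb d1 d2 by (intro mult_mono) auto
      ultimately show ?thesis by (simp add: algebra_simps)
    next
      case False
      have "d2 * (1 - hitting x) \<le> (1 - x) * v"
        using d2(2)[of x] False x by (simp add: v_def)
      then have "1/2 * (d2 * (1 - hitting x)) \<le> x * ((1 - x) * v)"
        using False x d2 hb by (intro mult_mono[of "1/2" x "d2 * (1 - hitting x)" "(1 - x) * v"]) auto
      moreover have "min d1 d2 / 2 * (hitting x * (1 - hitting x)) \<le> d2 / 2 * (1 * (1 - hitting x))"
        using hb d1 d2 by (intro mult_mono) auto
      ultimately show ?thesis by (simp add: algebra_simps)
    qed
    then show "min d1 d2 / 2 * (hitting x * (1 - hitting x)) \<le> x * (1 - x) * (s q x / S q 1)"
      by (simp add: v_def)
  qed
qed

text \<open>For \<open>Y = S0 (1 - S0)\<close> with \<open>L S0 = 0\<close> one has \<open>Y' = v (1 - 2 S0)\<close> and \<open>L Y = - 2 A v\<^sup>2\<close>, where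
  \<open>v = S0'\<close>. As \<open>(1 - 2 S0)\<^sup>2 = 1 - 4 Y\<close>, the quotient \<open>L (Y\<^sup>\<gamma>) / Y\<^sup>\<gamma>\<close> equals
  \<open>\<gamma> A (v / Y)\<^sup>2 ((\<gamma> - 1) (1 - 4 Y) - 2 Y)\<close>; for \<open>\<gamma> \<le> 1/2\<close> the last factor is at most \<open>- 1/2\<close>,
  and \<open>A (v / Y)\<^sup>2\<close> is bounded below by \<open>hitting_slope\<close>.\<close>

lemma hitting_lyapunov:
  assumes \<gamma>: "0 < \<gamma>" "\<gamma> \<le> 1/2"
    and Y_def: "Y = (\<lambda>x. hitting x * (1 - hitting x))"
  obtains r w1 w2 where "r > 0"
    "\<And>x. x \<in> {0<..<1} \<Longrightarrow> ((\<lambda>x. Y x powr \<gamma>) has_real_derivative w1 x) (at x)"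
    "\<And>x. x \<in> {0<..<1} \<Longrightarrow> (w1 has_real_derivative w2 x) (at x)"
    "\<And>x. x \<in> {0<..<1} \<Longrightarrow> A x * w2 x + B x * w1 x \<le> - r * Y x powr \<gamma>"
proof -
  obtain \<delta> where \<delta>: "\<delta> > 0"
    "\<And>x. x \<in> {0<..<1} \<Longrightarrow> \<delta> * (hitting x * (1 - hitting x)) \<le> x * (1 - x) * (s q x / S q 1)"
    using hitting_slope by blast
  define v where "v = (\<lambda>x. s q x / S q 1)"
  define Y1 where "Y1 = (\<lambda>x. v x * (1 - 2 * hitting x))"
  define Y2 where "Y2 = (\<lambda>x. s' q x / S q 1 * (1 - 2 * hitting x) - 2 * (v x)\<^sup>2)"
  have Ypos: "Y x > 0" if "x \<in> {0<..<1}" for x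
    using hitting_bounds(1)[OF that] by (simp add: Y_def)
  note d = hitting_deriv[folded v_def]
  have dY: "(Y has_real_derivative Y1 x) (at x)" if "x \<in> {0<..<1}" for x
    unfolding Y_def Y1_def
    by (rule DERIV_cong[OF DERIV_mult[OF d(1)[OF that] DERIV_diff[OF DERIV_const d(1)[OF that]]]])
      (simp add: v_def algebra_simps diff_divide_distrib add_divide_distrib)
  have dY1: "(Y1 has_real_derivative Y2 x) (at x)" if "x \<in> {0<..<1}" for x
    unfolding Y1_def Y2_def
    by (rule DERIV_cong[OF DERIV_mult[OF d(2)[OF that] DERIV_diff[OF DERIV_const DERIV_cmult[OF d(1)[OF that]]]]])
      (simp add: v_def algebra_simps power2_eq_square diff_divide_distrib add_divide_distrib)
  show thesis
  proof (rule that)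
    show "\<gamma> / 2 * \<kappa> * \<delta>\<^sup>2 > 0" using \<gamma> \<kappa> \<delta> by simp
    fix x :: real assume x: "x \<in> {0<..<1}"
    show "((\<lambda>x. Y x powr \<gamma>) has_real_derivative \<gamma> * Y x powr \<gamma> / Y x * Y1 x) (at x)"
      by (rule powr_function_derivs(1)[where Y = Y and ?Y1.0 = Y1 and x = x, OF Ypos[OF x] dY[OF x]])
    show "((\<lambda>x. \<gamma> * Y x powr \<gamma> / Y x * Y1 x) has_real_derivative
      Y x powr \<gamma> * (\<gamma> * (\<gamma> - 1) * (Y1 x / Y x)\<^sup>2 + \<gamma> * Y2 x / Y x)) (at x)"
      by (rule powr_function_derivs(2)[where Y = Y and ?Y1.0 = Y1 and x = x, OF Ypos[OF x] dY[OF x] dY1[OF x]])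
    show "A x * (Y x powr \<gamma> * (\<gamma> * (\<gamma> - 1) * (Y1 x / Y x)\<^sup>2 + \<gamma> * Y2 x / Y x))
       + B x * (\<gamma> * Y x powr \<gamma> / Y x * Y1 x) \<le> - (\<gamma> / 2 * \<kappa> * \<delta>\<^sup>2) * Y x powr \<gamma>"
    proof (rule operator_powr[OF Ypos[OF x]])
      have harm: "A x * (s' q x / S q 1) + B x * v x = 0"
        using operator_scale[OF x, of q] scale_at_1_pos by (simp add: v_def field_simps)
      have "A x * Y2 x + B x * Y1 x = (1 - 2 * hitting x) * (A x * (s' q x / S q 1) + B x * v x) - 2 * A x * (v x)\<^sup>2"
      proof -
        have "a * (d * (1 - 2 * h) - 2 * z\<^sup>2) + b * (z * (1 - 2 * h)) = (1 - 2 * h) * (a * d + b * z) - 2 * a * z\<^sup>2"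
          for a b d h z :: real by (simp add: algebra_simps)
        then show ?thesis unfolding Y1_def Y2_def .
      qed
      then have LY: "A x * Y2 x + B x * Y1 x = - 2 * A x * (v x)\<^sup>2" unfolding harm by simp
      have sq: "(1 - 2 * hitting x)\<^sup>2 = 1 - 4 * Y x" by (simp add: Y_def power2_eq_square algebra_simps)
      have le: "4 * Y x \<le> 1" using zero_le_power2[of "1 - 2 * hitting x"] sq by simp
      define a where "a = A x * (v x / Y x)\<^sup>2"
      have "\<gamma> * (\<gamma> - 1) * A x * (Y1 x / Y x)\<^sup>2 + \<gamma> * (A x * Y2 x + B x * Y1 x) / Y x
         = \<gamma> * a * ((\<gamma> - 1) * (1 - 2 * hitting x)\<^sup>2 - 2 * Y x)"
        unfolding LY unfolding a_def Y1_def using Ypos[OF x] by (simp add: field_simps power2_eq_square)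
      also have "\<dots> = \<gamma> * a * ((\<gamma> - 1) * (1 - 4 * Y x) - 2 * Y x)" by (simp only: sq)
      also have "\<dots> \<le> \<gamma> * a * (- 1 / 2)"
      proof (rule mult_left_mono)
        have "(\<gamma> - 1) * (1 - 4 * Y x) \<le> (- 1 / 2) * (1 - 4 * Y x)"
          using \<gamma> le by (intro mult_right_mono) auto
        moreover have "(- 1 / 2) * (1 - 4 * Y x) = - 1 / 2 + 2 * Y x" by (simp add: field_simps)
        ultimately show "(\<gamma> - 1) * (1 - 4 * Y x) - 2 * Y x \<le> - 1 / 2" by linarith
        show "0 \<le> \<gamma> * a" using \<gamma> A_pos[OF x] by (simp add: a_def)
      qed
      also have "\<dots> \<le> - (\<gamma> / 2 * \<kappa> * \<delta>\<^sup>2)"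
      proof -
        have "\<delta> \<le> x * (1 - x) * (v x / Y x)"
        proof -
          have "\<delta> * Y x \<le> x * (1 - x) * v x" using \<delta>(2)[OF x] by (simp only: v_def Y_def)
          then show ?thesis using Ypos[OF x] by (simp add: pos_le_divide_eq)
        qed
        then have "\<delta>\<^sup>2 \<le> (x * (1 - x) * (v x / Y x))\<^sup>2" using \<delta> by (intro power_mono) auto
        then have "\<kappa> * \<delta>\<^sup>2 \<le> \<kappa> * (x * (1 - x) * (v x / Y x))\<^sup>2" using \<kappa> by simp
        also have "\<dots> = \<kappa> * (x\<^sup>2 * (1 - x)\<^sup>2) * (v x / Y x)\<^sup>2" by (simp only: power_mult_distrib mult.assoc)
        also have "\<dots> \<le> a" unfolding a_def
          using A_ge_power[OF x jk(2)] by (intro mult_right_mono) auto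
        finally have "\<gamma> / 2 * (\<kappa> * \<delta>\<^sup>2) \<le> \<gamma> / 2 * a" using \<gamma> by (intro mult_left_mono) auto
        then show ?thesis by simp
      qed
      finally show "\<gamma> * (\<gamma> - 1) * A x * (Y1 x / Y x)\<^sup>2 + \<gamma> * (A x * Y2 x + B x * Y1 x) / Y x
         \<le> - (\<gamma> / 2 * \<kappa> * \<delta>\<^sup>2)" .
    qed
  qed
qed

text \<open>Comparison with \<open>u 0 0 (1 - S0) + u 0 1 S0 + C exp (- r t) (S0 (1 - S0))\<^sup>\<gamma>\<close>. At time 0 the
  difference between a 1-Lipschitz function and its harmonic interpolation is at most
  \<open>(1 - S0) x + S0 (1 - x)\<close>, which the Lyapunov function dominates. At the endpoints both sides
  are constant in time. The constants do not depend on the solution.\<close>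

lemma both_tangent_decay:
  assumes B: "B 0 = 0" "B 1 = 0"
  shows "\<exists>C>0. \<exists>r>0. \<forall>u. classical_solution A B u \<and> 1-lipschitz_on {0..1} (u 0) \<longrightarrow>
    (\<forall>t\<ge>0. \<forall>x\<in>{0..1}. u t x \<le> u 0 0 * (1 - hitting x) + u 0 1 * hitting x + C * exp (- r * t))"
proof -
  \<comment> \<open>Small enough for \<open>S0\<^sup>\<gamma>\<close> to dominate \<open>x\<close> and for \<open>(1 - S0)\<^sup>\<gamma>\<close> to dominate \<open>1 - x\<close>.\<close>
  define \<gamma> where "\<gamma> = 1 / (2 + \<bar>p\<bar> + \<bar>q\<bar>)"
  have \<gamma>: "0 < \<gamma>" "\<gamma> \<le> 1/2" "\<gamma> * (1 - p) \<le> 1" "\<gamma> * (1 + q) \<le> 1"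
    by (auto simp: \<gamma>_def field_simps)
  define Y where "Y = (\<lambda>x. hitting x * (1 - hitting x))"
  obtain r w1 w2 where r: "r > 0"
    and w1: "\<And>x. x \<in> {0<..<1} \<Longrightarrow> ((\<lambda>x. Y x powr \<gamma>) has_real_derivative w1 x) (at x)"
    and w2: "\<And>x. x \<in> {0<..<1} \<Longrightarrow> (w1 has_real_derivative w2 x) (at x)"
    and Lw: "\<And>x. x \<in> {0<..<1} \<Longrightarrow> A x * w2 x + B x * w1 x \<le> - r * Y x powr \<gamma>"
    by (rule hitting_lyapunov[OF \<gamma>(1,2) Y_def]) (rule that)
  obtain C0 where C0: "C0 > 0" "\<And>x. x \<in> {0..1} \<Longrightarrow> x \<le> C0 * S q x powr \<gamma>"
    using scale_power_bound[OF p \<gamma>(1,3), of q] q by blast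
  obtain C2 where C2: "C2 > 0" "\<And>x. x \<in> {0..1} \<Longrightarrow> 1 - x \<le> C2 * (1 - hitting x) powr \<gamma>"
    using hitting_near_1(2)[OF \<gamma>(1,4)] by blast
  define C1 where "C1 = C0 * S q 1 powr \<gamma>"
  have C1: "C1 > 0" using C0 scale_at_1_pos by (simp add: C1_def)
  have C1': "x \<le> C1 * hitting x powr \<gamma>" if "x \<in> {0..1}" for x
  proof -
    have "S q x = S q 1 * hitting x" using scale_at_1_pos by (simp add: hitting_def)
    then have "S q x powr \<gamma> = S q 1 powr \<gamma> * hitting x powr \<gamma>"
      using scale_at_1_pos hitting_bounds(2)[OF that] by (simp add: powr_mult)
    then show ?thesis using C0(2)[OF that] by (simp add: C1_def)
  qed
  define C where "C = C1 + C2"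
  have C: "C > 0" using C1 C2 by (simp add: C_def)
  have le_powr: "z \<le> z powr \<gamma>" if "0 \<le> z" "z \<le> 1" for z
    using that \<gamma> powr_mono'[of \<gamma> 1 z] by (cases "z = 0") auto
  have "u t x \<le> u 0 0 * (1 - hitting x) + u 0 1 * hitting x + C * exp (- r * t)"
    if u: "classical_solution A B u" and lip: "1-lipschitz_on {0..1} (u 0)"
      and t: "t \<ge> 0" and x: "x \<in> {0..1}" for u t x
  proof -
    define P where "P = (\<lambda>x. u 0 0 * (1 - hitting x) + u 0 1 * hitting x)"
    define R where "R = (\<lambda>x. C * Y x powr \<gamma>)"
    note hb = hitting_bounds and he = hitting_endpoints and hd = hitting_deriv
      and hc = hitting_continuous
    have "u t x \<le> P x + exp (- r * t) * R x"
    proof (rule comparison_exponential[OF u, where c = 1 and T = t and P = P and R = R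
          and ?P1.0 = "\<lambda>x. (u 0 1 - u 0 0) * (s q x / S q 1)"
          and ?P2.0 = "\<lambda>x. (u 0 1 - u 0 0) * (s' q x / S q 1)"
          and ?R1.0 = "\<lambda>x. C * w1 x" and ?R2.0 = "\<lambda>x. C * w2 x"])
      show "continuous_on {0..1} P"
        unfolding P_def by (intro continuous_on_add continuous_on_mult continuous_on_diff continuous_on_const hc)
      have "continuous_on {0..1} Y"
        unfolding Y_def by (intro continuous_on_mult continuous_on_diff continuous_on_const hc)
      then show "continuous_on {0..1} R"
        unfolding R_def using \<gamma>(1) hb(2)
        by (intro continuous_on_mult continuous_on_const continuous_on_powr') (auto simp: Y_def)
    next
      fix x :: real assume x: "x \<in> {0..1}"
      note h = hb(2)[OF x]
      have "u 0 x - u 0 0 \<le> x" "u 0 x - u 0 1 \<le> 1 - x"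
        using lipschitz_onD[OF lip x, of 0] lipschitz_onD[OF lip x, of 1] x by (auto simp: dist_real_def)
      then have "(1 - hitting x) * (u 0 x - u 0 0) \<le> (1 - hitting x) * x"
         "hitting x * (u 0 x - u 0 1) \<le> hitting x * (1 - x)"
        using h by (auto intro!: mult_left_mono)
      moreover have "(1 - hitting x) * x \<le> (1 - hitting x) powr \<gamma> * (C1 * hitting x powr \<gamma>)"
        using h x C1'[OF x] by (intro mult_mono le_powr) auto
      moreover have "hitting x * (1 - x) \<le> hitting x powr \<gamma> * (C2 * (1 - hitting x) powr \<gamma>)"
        using h x C2(2)[OF x] by (intro mult_mono le_powr) auto
      moreover have "Y x powr \<gamma> = hitting x powr \<gamma> * (1 - hitting x) powr \<gamma>"
        using h by (simp add: Y_def powr_mult)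
      ultimately show "u 0 x \<le> P x + R x" by (simp add: P_def R_def C_def algebra_simps)
    next
      fix s1 assume "s1 \<in> {0..t}"
      then show "u s1 0 \<le> P 0 + exp (- r * s1) * R 0"
        using classical_solution_absorbed[OF u, of 0 s1] B by (simp add: P_def R_def he Y_def)
    next
      have "u s1 1 \<le> P 1 + exp (- r * s1) * R 1" if "s1 \<in> {0..t}" for s1
        using classical_solution_absorbed[OF u, of 1 s1] B that by (simp add: P_def R_def he Y_def)
      then show "(\<forall>t\<in>{0..t}. u t 1 \<le> P 1 + exp (- r * t) * R 1) \<or>
        1 = 1 \<and> B 1 < 0 \<and>
        (P has_real_derivative (u 0 1 - u 0 0) * (s q 1 / S q 1)) (at 1 within {0..1}) \<and>
        (R has_real_derivative C * w1 1) (at 1 within {0..1}) \<and>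
        B 1 * ((u 0 1 - u 0 0) * (s q 1 / S q 1)) \<le> 0 \<and> B 1 * (C * w1 1) \<le> - r * R 1" by blast
    next
      fix x :: real assume x: "x \<in> {0<..<1}"
      show "(P has_real_derivative (u 0 1 - u 0 0) * (s q x / S q 1)) (at x)"
        unfolding P_def
        by (rule DERIV_cong[OF DERIV_add[OF DERIV_cmult[OF DERIV_diff[OF DERIV_const hd(1)[OF x]]]
              DERIV_cmult[OF hd(1)[OF x]]]])
           (simp add: algebra_simps diff_divide_distrib)
      show "((\<lambda>x. (u 0 1 - u 0 0) * (s q x / S q 1)) has_real_derivative (u 0 1 - u 0 0) * (s' q x / S q 1)) (at x)"
        by (intro DERIV_cmult hd(2)[OF x])
      have harm: "A x * (s' q x / S q 1) + B x * (s q x / S q 1) = 0"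
        using operator_scale[OF x, of q] scale_at_1_pos by (simp add: field_simps)
      have "A x * ((u 0 1 - u 0 0) * (s' q x / S q 1)) + B x * ((u 0 1 - u 0 0) * (s q x / S q 1))
        = (u 0 1 - u 0 0) * (A x * (s' q x / S q 1) + B x * (s q x / S q 1))"
        by (simp only: distrib_left mult.left_commute)
      then show "A x * ((u 0 1 - u 0 0) * (s' q x / S q 1)) + B x * ((u 0 1 - u 0 0) * (s q x / S q 1)) \<le> 0"
        unfolding harm by simp
      show "(R has_real_derivative C * w1 x) (at x)" "((\<lambda>x. C * w1 x) has_real_derivative C * w2 x) (at x)"
        unfolding R_def by (intro DERIV_cmult w1[OF x] w2[OF x])+
      have "C * (A x * w2 x + B x * w1 x) \<le> C * (- r * Y x powr \<gamma>)"
        using Lw[OF x] C by (intro mult_left_mono) auto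
      then show "A x * (C * w2 x) + B x * (C * w1 x) \<le> - r * R x" by (simp add: R_def algebra_simps)
      show "A x \<ge> 0" using A_pos[OF x] by simp
    qed (use t x in auto)
    also have "P x + exp (- r * t) * R x \<le> u 0 0 * (1 - hitting x) + u 0 1 * hitting x + C * exp (- r * t)"
    proof -
      have "0 \<le> Y x" "Y x \<le> 1" using hb(2)[OF x] by (auto simp: Y_def mult_le_one)
      then have "Y x powr \<gamma> \<le> 1" using \<gamma> by (intro powr_le1) auto
      then show ?thesis using C by (simp add: P_def R_def)
    qed
    finally show ?thesis .
  qed
  then show ?thesis using C r by blast
qed

end

end

section \<open>One tangent endpoint\<close>

context boundary_operator
begin

context
  assumes p: "p < 1"
begin

lemma scale_lyapunov:
  assumes x: "x \<in> {0<..<1}"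
    and le: "\<gamma> * (\<gamma> - 1) * (A x * (s r x / S r x)\<^sup>2) + \<gamma> * (A x * s r x * ((q - r) / (1 - x))) / S r x \<le> - \<rho>"
  shows "((\<lambda>x. S r x powr \<gamma>) has_real_derivative \<gamma> * S r x powr \<gamma> / S r x * s r x) (at x)"
    and "((\<lambda>x. \<gamma> * S r x powr \<gamma> / S r x * s r x) has_real_derivative
      S r x powr \<gamma> * (\<gamma> * (\<gamma> - 1) * (s r x / S r x)\<^sup>2 + \<gamma> * s' r x / S r x)) (at x)"
    and "A x * (S r x powr \<gamma> * (\<gamma> * (\<gamma> - 1) * (s r x / S r x)\<^sup>2 + \<gamma> * s' r x / S r x))
      + B x * (\<gamma> * S r x powr \<gamma> / S r x * s r x) \<le> - \<rho> * S r x powr \<gamma>"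
proof -
  have pos: "S r x > 0" using scale_function_pos[OF g p, of x r] x by simp
  show "((\<lambda>x. S r x powr \<gamma>) has_real_derivative \<gamma> * S r x powr \<gamma> / S r x * s r x) (at x)"
    by (rule powr_function_derivs(1)[where Y = "S r" and ?Y1.0 = "s r" and x = x,
          OF pos scale_function_deriv(1)[OF g p x]])
  show "((\<lambda>x. \<gamma> * S r x powr \<gamma> / S r x * s r x) has_real_derivative
      S r x powr \<gamma> * (\<gamma> * (\<gamma> - 1) * (s r x / S r x)\<^sup>2 + \<gamma> * s' r x / S r x)) (at x)"
    by (rule powr_function_derivs(2)[where Y = "S r" and ?Y1.0 = "s r" and x = x,
          OF pos scale_function_deriv(1)[OF g p x] scale_function_deriv(2)[OF g p x]])
  show "A x * (S r x powr \<gamma> * (\<gamma> * (\<gamma> - 1) * (s r x / S r x)\<^sup>2 + \<gamma> * s' r x / S r x))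
      + B x * (\<gamma> * S r x powr \<gamma> / S r x * s r x) \<le> - \<rho> * S r x powr \<gamma>"
    by (rule operator_powr[OF pos]) (use le in \<open>simp only: operator_scale[OF x] mult.assoc\<close>)
qed

lemma scale_powr_continuous:
  assumes "\<gamma> > 0" "0 \<le> c" "c \<le> 1" "c < 1 \<or> r > -1"
  shows "continuous_on {0..c} (\<lambda>x. S r x powr \<gamma>)"
proof (rule continuous_on_powr'[OF scale_function_continuous[OF g p assms(2-4)] continuous_on_const])
  have "0 \<le> S r x" if "x \<in> {0..c}" for x
    using scale_function_pos[OF g p, of x r] that assms scale_function_0[of g p r]
    by (cases "x = 0") (auto intro: less_imp_le)
  then show "\<forall>x\<in>{0..c}. 0 \<le> S r x \<and> (S r x = 0 \<longrightarrow> 0 < \<gamma>)" using assms by auto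
qed

text \<open>The lower bound for the decay rate in \<open>operator_powr\<close>: the factor \<open>x\<^sup>2\<close> of \<open>A\<close> is absorbed by
  \<open>x S' / S\<close>, while \<open>z\<close> measures how much of the factor at 1 is absorbed and \<open>e\<close> what is left.\<close>

lemma A_slope:
  assumes x: "x \<in> {0<..<1}" and "k \<le> n" and \<delta>: "\<delta> \<ge> 0" "\<delta> * S r x \<le> x * s r x * z" "z \<ge> 0"
    and n: "(1 - x) ^ n \<ge> z\<^sup>2 * e" "e \<ge> 0"
  shows "\<kappa> * \<delta>\<^sup>2 * e \<le> A x * (s r x / S r x)\<^sup>2"
proof -
  have pos: "S r x > 0" using scale_function_pos[OF g p, of x r] x by simp
  have "\<delta> \<le> x * (s r x / S r x) * z" using \<delta>(2) pos by (simp add: field_simps)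
  then have "\<delta>\<^sup>2 \<le> (x * (s r x / S r x) * z)\<^sup>2" using \<delta>(1) by (intro power_mono) auto
  then have "\<kappa> * \<delta>\<^sup>2 * e \<le> \<kappa> * (x * (s r x / S r x) * z)\<^sup>2 * e"
    using \<kappa> n by (intro mult_right_mono mult_left_mono) auto
  also have "\<dots> = \<kappa> * (x\<^sup>2 * (z\<^sup>2 * e)) * (s r x / S r x)\<^sup>2"
    by (simp add: power_mult_distrib power_divide)
  also have "\<dots> \<le> \<kappa> * (x\<^sup>2 * (1 - x) ^ n) * (s r x / S r x)\<^sup>2"
    using \<kappa> n by (intro mult_right_mono mult_left_mono) auto
  also have "\<dots> \<le> A x * (s r x / S r x)\<^sup>2"
    using A_ge_power[OF x \<open>k \<le> n\<close>] by (intro mult_right_mono) auto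
  finally show ?thesis .
qed

text \<open>The scale function is taken with exponent 0 instead of \<open>q\<close> at 1. It is then differentiable at 1
  with positive derivative, so that the boundary condition \<open>B 1 w' \<le> - r w\<close> can be met, and it is
  strictly superharmonic: \<open>L S = q A S' / (1 - x)\<close> with \<open>q < 0\<close>. In \<open>L (S\<^sup>\<gamma>) / S\<^sup>\<gamma>\<close> concavity
  contributes at least a multiple of \<open>1 - x\<close> to the decay and the drift a multiple of \<open>x\<close>.\<close>

lemma transverse_kimura_decay:
  assumes q: "q < 0" and k: "k \<le> 1" and B: "B 0 = 0" "B 1 < 0"
  shows "\<exists>r>0. \<forall>u. classical_solution A B u \<and> (\<forall>x\<in>{0..1}. u 0 x = x) \<longrightarrow>
    (\<forall>x\<in>{0..1}. \<exists>C. \<forall>t\<ge>0. u t x \<le> C * exp (- r * t))"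
proof -
  define \<gamma> where "\<gamma> = 1 / (2 + \<bar>p\<bar>)"
  have \<gamma>: "0 < \<gamma>" "\<gamma> < 1" "\<gamma> * (1 - p) \<le> 1" by (auto simp: \<gamma>_def field_simps)
  obtain \<delta> where \<delta>: "\<delta> > 0" "\<And>x. x \<in> {0<..1} \<Longrightarrow> \<delta> * S 0 x \<le> x * s 0 x"
    using scale_slope[OF p, of 1 0] by auto
  obtain C where C: "C > 0" "\<And>x. x \<in> {0..1} \<Longrightarrow> x \<le> C * S 0 x powr \<gamma>"
    using scale_power_bound[OF p \<gamma>(1,3), of 0] by auto
  \<comment> \<open>The common lower bound for the coefficients of \<open>\<gamma> \<kappa> (1 - x)\<close>, from concavity, and of \<open>\<gamma> \<kappa> x\<close>, from the drift.\<close>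
  define m where "m = min ((1 - \<gamma>) * \<delta>\<^sup>2) (- q * \<delta>)"
  have m: "m > 0" using \<gamma> \<delta> q by (simp add: m_def mult_neg_pos)
  have S1: "S 0 1 > 0" "s 0 1 > 0"
    using scale_function_pos[OF g p, of 1 0] scale_density_pos[of 1 p 0 g] by (auto simp: regular_points_def)
  define r where "r = min (\<gamma> * \<kappa> * m) (- B 1 * \<gamma> / S 0 1 * s 0 1)"
  have "\<gamma> * \<kappa> * m > 0" "- B 1 * \<gamma> / S 0 1 * s 0 1 > 0"
    using \<gamma> \<kappa> m B S1 by (intro mult_pos_pos divide_pos_pos; simp)+
  then have r: "r > 0" unfolding r_def by (simp only: min_less_iff_conj)
  have le: "\<gamma> * (\<gamma> - 1) * (A x * (s 0 x / S 0 x)\<^sup>2) + \<gamma> * (A x * s 0 x * ((q - 0) / (1 - x))) / S 0 x \<le> - r"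
    if x: "x \<in> {0<..<1}" for x
  proof -
    have pos: "S 0 x > 0" "s 0 x > 0"
      using scale_function_pos[OF g p, of x 0] scale_density_pos[of x p 0 g] x by auto
    have dx: "\<delta> * S 0 x \<le> x * s 0 x" using \<delta>(2)[of x] x by simp
    have "\<kappa> * \<delta>\<^sup>2 * (1 - x) \<le> A x * (s 0 x / S 0 x)\<^sup>2"
      by (rule A_slope[OF x k, where z = 1]) (use \<delta> dx x in auto)
    then have "(\<gamma> * (1 - \<gamma>)) * (\<kappa> * \<delta>\<^sup>2 * (1 - x)) \<le> (\<gamma> * (1 - \<gamma>)) * (A x * (s 0 x / S 0 x)\<^sup>2)"
      using \<gamma> by (intro mult_left_mono) auto
    moreover have "(\<gamma> * \<kappa>) * ((1 - x) * m) \<le> (\<gamma> * \<kappa>) * ((1 - x) * ((1 - \<gamma>) * \<delta>\<^sup>2))"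
      using \<gamma> \<kappa> x by (intro mult_left_mono) (auto simp: m_def)
    ultimately have 1: "\<gamma> * (\<gamma> - 1) * (A x * (s 0 x / S 0 x)\<^sup>2) \<le> - ((\<gamma> * \<kappa>) * ((1 - x) * m))"
      by (simp add: algebra_simps)
    have "\<kappa> * (x\<^sup>2 * (1 - x)) \<le> A x" using A_ge_power[OF x k] by simp
    then have "\<kappa> * x\<^sup>2 \<le> A x / (1 - x)" using x by (simp add: field_simps)
    moreover have "\<delta> / x \<le> s 0 x / S 0 x" using dx x pos by (simp add: field_simps)
    ultimately have "(\<kappa> * x\<^sup>2) * (\<delta> / x) \<le> (A x / (1 - x)) * (s 0 x / S 0 x)"
      using \<kappa> \<delta> x A_pos[OF x] by (intro mult_mono) auto
    then have "\<kappa> * \<delta> * x \<le> (A x / (1 - x)) * (s 0 x / S 0 x)"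
      using x by (simp add: power2_eq_square field_simps)
    then have "(\<gamma> * - q) * (\<kappa> * \<delta> * x) \<le> (\<gamma> * - q) * ((A x / (1 - x)) * (s 0 x / S 0 x))"
      using \<gamma> q by (intro mult_left_mono) (auto simp: mult_le_0_iff)
    moreover have "(\<gamma> * \<kappa>) * (x * m) \<le> (\<gamma> * \<kappa>) * (x * (- q * \<delta>))"
      using \<gamma> \<kappa> x by (intro mult_left_mono) (auto simp: m_def)
    moreover have "\<gamma> * (A x * s 0 x * ((q - 0) / (1 - x))) / S 0 x = - ((\<gamma> * - q) * ((A x / (1 - x)) * (s 0 x / S 0 x)))"
      by simp
    ultimately have 2: "\<gamma> * (A x * s 0 x * ((q - 0) / (1 - x))) / S 0 x \<le> - ((\<gamma> * \<kappa>) * (x * m))"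
      by (simp add: algebra_simps)
    have "(\<gamma> * \<kappa>) * ((1 - x) * m) + (\<gamma> * \<kappa>) * (x * m) = \<gamma> * \<kappa> * m" by (simp add: algebra_simps)
    moreover have "r \<le> \<gamma> * \<kappa> * m" by (simp add: r_def)
    ultimately show ?thesis using 1 2 by linarith
  qed
  note lyap = scale_lyapunov[OF _ le]
  have "\<exists>C. \<forall>t\<ge>0. u t x \<le> C * exp (- r * t)"
    if u: "classical_solution A B u" "\<forall>x\<in>{0..1}. u 0 x = x" and x: "x \<in> {0..1}" for u x
  proof (intro exI allI impI)
    fix t :: real assume t: "t \<ge> 0"
    have "u t x \<le> 0 + exp (- r * t) * (C * S 0 x powr \<gamma>)"
    proof (rule comparison_exponential[OF u(1), where c = 1 and T = t and P = "\<lambda>_. 0"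
          and ?P1.0 = "\<lambda>_. 0" and ?P2.0 = "\<lambda>_. 0"
          and ?R1.0 = "\<lambda>x. C * (\<gamma> * S 0 x powr \<gamma> / S 0 x * s 0 x)"
          and ?R2.0 = "\<lambda>x. C * (S 0 x powr \<gamma> * (\<gamma> * (\<gamma> - 1) * (s 0 x / S 0 x)\<^sup>2 + \<gamma> * s' 0 x / S 0 x))"])
      show "continuous_on {0..1} (\<lambda>x. C * S 0 x powr \<gamma>)"
        by (intro continuous_on_mult continuous_on_const scale_powr_continuous \<gamma>) auto
      show "u 0 x \<le> 0 + C * S 0 x powr \<gamma>" if "x \<in> {0..1}" for x using C(2)[OF that] u(2) that by simp
      show "u s1 0 \<le> 0 + exp (- r * s1) * (C * S 0 0 powr \<gamma>)" if "s1 \<in> {0..t}" for s1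
        using classical_solution_absorbed[OF u(1), of 0 s1] that B u(2) C(1) by simp
    next
      fix x :: real assume x: "x \<in> {0<..<1}"
      show "((\<lambda>x. C * S 0 x powr \<gamma>) has_real_derivative C * (\<gamma> * S 0 x powr \<gamma> / S 0 x * s 0 x)) (at x)"
        by (intro DERIV_cmult lyap(1)[OF x x])
      show "((\<lambda>x. C * (\<gamma> * S 0 x powr \<gamma> / S 0 x * s 0 x)) has_real_derivative
        C * (S 0 x powr \<gamma> * (\<gamma> * (\<gamma> - 1) * (s 0 x / S 0 x)\<^sup>2 + \<gamma> * s' 0 x / S 0 x))) (at x)"
        by (intro DERIV_cmult lyap(2)[OF x x])
      show "A x * (C * (S 0 x powr \<gamma> * (\<gamma> * (\<gamma> - 1) * (s 0 x / S 0 x)\<^sup>2 + \<gamma> * s' 0 x / S 0 x)))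
        + B x * (C * (\<gamma> * S 0 x powr \<gamma> / S 0 x * s 0 x)) \<le> - r * (C * S 0 x powr \<gamma>)"
      proof -
        have "C * (a1 * b1 + a2 * b2) \<le> C * (- r * z)" if "a1 * b1 + a2 * b2 \<le> - r * z" for a1 b1 a2 b2 z
          using that C(1) by (intro mult_left_mono) auto
        from this[OF lyap(3)[OF x x]] show ?thesis
          by (simp only: distrib_left mult.left_commute)
      qed
      show "A x \<ge> 0" using A_pos[OF x] by simp
    next
      have reg: "1 \<in> regular_points p 0" by (simp add: regular_points_def)
      have "((\<lambda>x. C * S 0 x powr \<gamma>) has_real_derivative C * (\<gamma> * S 0 1 powr \<gamma> / S 0 1 * s 0 1)) (at 1 within {0..1})"
        by (intro DERIV_cmult powr_function_derivs(1)[where Y = "S 0" and ?Y1.0 = "s 0" and x = 1]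
            S1 scale_function_deriv_within[OF g p reg])
      moreover have "B 1 * (C * (\<gamma> * S 0 1 powr \<gamma> / S 0 1 * s 0 1)) \<le> - r * (C * S 0 1 powr \<gamma>)"
      proof -
        have "(C * S 0 1 powr \<gamma>) * r \<le> (C * S 0 1 powr \<gamma>) * (- B 1 * \<gamma> / S 0 1 * s 0 1)"
          using C(1) by (intro mult_left_mono) (auto simp: r_def)
        then show ?thesis by (simp add: mult_ac)
      qed
      ultimately show "(\<forall>s1\<in>{0..t}. u s1 1 \<le> 0 + exp (- r * s1) * (C * S 0 1 powr \<gamma>)) \<or>
        1 = 1 \<and> B 1 < 0 \<and> ((\<lambda>_. 0) has_real_derivative 0) (at 1 within {0..1}) \<and>
        ((\<lambda>x. C * S 0 x powr \<gamma>) has_real_derivative C * (\<gamma> * S 0 1 powr \<gamma> / S 0 1 * s 0 1)) (at 1 within {0..1}) \<and>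
        B 1 * 0 \<le> 0 \<and> B 1 * (C * (\<gamma> * S 0 1 powr \<gamma> / S 0 1 * s 0 1)) \<le> - r * (C * S 0 1 powr \<gamma>)"
        using B by simp
    qed (use t x in auto)
    then show "u t x \<le> C * S 0 x powr \<gamma> * exp (- r * t)" by (simp add: mult.commute)
  qed
  then show ?thesis using r by blast
qed

lemma scale_density_near_1:
  obtains l M where "l > 0" "M > 0"
    "\<And>x. x \<in> {1/2..<1} \<Longrightarrow> l * (1 - x) powr r \<le> s r x \<and> s r x \<le> M * (1 - x) powr r"
proof -
  define h where "h = (\<lambda>x. rpow x (- p) * exp (- integral {0..x} g))"
  have h: "continuous_on {1/2..1} h"
    unfolding h_def by (intro continuous_intros continuous_on_subset[OF exp_integral_continuous]) auto
  have hpos: "h x > 0" if "x \<in> {1/2..1}" for x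
    using that unfolding h_def by (intro mult_pos_pos rpow_pos) auto
  obtain xl where xl: "xl \<in> {1/2..1}" "\<And>x. x \<in> {1/2..1} \<Longrightarrow> h xl \<le> h x"
    using continuous_attains_inf[of "{1/2..1}" h] h by auto
  obtain xM where xM: "xM \<in> {1/2..1}" "\<And>x. x \<in> {1/2..1} \<Longrightarrow> h x \<le> h xM"
    using continuous_attains_sup[of "{1/2..1}" h] h by auto
  show thesis
  proof (rule that[of "h xl" "h xM"])
    fix x :: real assume x: "x \<in> {1/2..<1}"
    have "s r x = h x * (1 - x) powr r" using x by (simp add: h_def scale_density_def rpow_eq_powr)
    then show "h xl * (1 - x) powr r \<le> s r x \<and> s r x \<le> h xM * (1 - x) powr r"
      using xl(2)[of x] xM(2)[of x] x by (simp add: mult_right_mono)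
  qed (use hpos xl xM in auto)
qed

text \<open>For \<open>r \<le> -1\<close> the density is at least a multiple of \<open>1 / (1 - x)\<close> near 1, so that
  \<open>S + l ln (1 - x)\<close> is nondecreasing and \<open>S\<close> grows at least logarithmically.\<close>

lemma scale_blowup:
  assumes r: "r \<le> - 1" and "c0 < 1"
  obtains c where "c0 < c" "0 < c" "c < 1" "R \<le> S r c"
proof -
  obtain l M where l: "l > 0" "\<And>x. x \<in> {1/2..<1} \<Longrightarrow> l * (1 - x) powr r \<le> s r x \<and> s r x \<le> M * (1 - x) powr r"
    using scale_density_near_1[of r] by metis
  define e where "e = min (min (1/2) ((1 - c0) / 2)) (exp (- (R / l + ln 2)))"
  have "0 < e" using \<open>c0 < 1\<close> by (simp add: e_def)
  moreover have "e \<le> 1/2" "e \<le> (1 - c0) / 2" "e \<le> exp (- (R / l + ln 2))"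
    unfolding e_def by (intro min.coboundedI1 min.cobounded1 min.cobounded2)+
  ultimately have e: "0 < e" "e \<le> 1/2" "e \<le> (1 - c0) / 2" "e \<le> exp (- (R / l + ln 2))" by blast+
  have "S r (1/2) + l * ln (1 - 1/2) \<le> S r (1 - e) + l * ln (1 - (1 - e))"
  proof (rule DERIV_nonneg_imp_increasing_open[where f = "\<lambda>x. S r x + l * ln (1 - x)"])
    show "1/2 \<le> 1 - e" using e by simp
    show "continuous_on {1/2..1 - e} (\<lambda>x. S r x + l * ln (1 - x))"
    proof -
      have "continuous_on {1/2..1 - e} (S r)"
        by (rule continuous_on_subset[OF scale_function_continuous[OF g p, of "1 - e"]]) (use e in auto)
      moreover have "continuous_on {1/2..1 - e} (\<lambda>x. ln (1 - x))"
        using e by (intro continuous_on_ln continuous_on_diff continuous_on_const continuous_on_id) auto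
      ultimately show ?thesis by (intro continuous_on_add continuous_on_mult continuous_on_const)
    qed
    fix x :: real assume x: "1/2 < x" "x < 1 - e"
    then have x': "x \<in> {0<..<1}" "1 - x > 0" "1 - x \<le> 1" using e by auto
    have "((\<lambda>x. 1 - x) has_real_derivative 0 - 1) (at x)"
      by (intro DERIV_diff DERIV_const DERIV_ident)
    from DERIV_chain2[where f = ln, OF DERIV_ln_divide[OF x'(2)] this]
    have "((\<lambda>x. S r x + l * ln (1 - x)) has_real_derivative s r x + l * (1 / (1 - x) * (0 - 1))) (at x)"
      by (intro DERIV_add DERIV_cmult scale_function_deriv(1)[OF g p x'(1)])
    moreover have "0 \<le> s r x + l * (1 / (1 - x) * (0 - 1))"
    proof -
      have "(1 - x) powr - 1 \<le> (1 - x) powr r" using r x' by (intro powr_mono') auto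
      then have "1 / (1 - x) \<le> (1 - x) powr r" using x' by (simp add: powr_minus_divide)
      then have "l * (1 / (1 - x)) \<le> l * (1 - x) powr r" using l(1) by (intro mult_left_mono) auto
      then show ?thesis using l(2)[of x] x x' by simp
    qed
    ultimately show "\<exists>y. ((\<lambda>x. S r x + l * ln (1 - x)) has_real_derivative y) (at x) \<and> 0 \<le> y" by blast
  qed
  moreover have "S r (1/2) \<ge> 0" using scale_function_pos[OF g p, of "1/2" r] by simp
  moreover have "ln (1 - 1/2 :: real) = - ln 2" by (simp add: ln_div)
  moreover have "l * ln e \<le> l * - (R / l + ln 2)"
    using e l(1) by (intro mult_left_mono) (auto simp: ln_le_cancel_iff[of e, symmetric] simp del: ln_le_cancel_iff)
  moreover have "l * - (R / l + ln 2) = - R - l * ln 2" using l(1) by (simp add: algebra_simps)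
  ultimately have "R \<le> S r (1 - e)" by simp
  then show thesis using e \<open>c0 < 1\<close> by (intro that[of "1 - e"]) auto
qed

text \<open>Near 1 both sides are of order \<open>(1 - x)\<^sup>r\<^sup>+\<^sup>1\<close>. For \<open>r = -1\<close> the function \<open>S\<close> is logarithmic while
  \<open>(1 - x) S'\<close> stays bounded; this is why a neutral endpoint has no exponential rate here.\<close>

lemma scale_slope_repelling:
  assumes r: "r < - 1"
  shows "\<exists>\<delta>>0. \<forall>x\<in>{0<..<1}. \<delta> * S r x \<le> x * s r x * (1 - x)"
proof -
  obtain l M where lM: "l > 0" "M > 0"
      "\<And>x. x \<in> {1/2..<1} \<Longrightarrow> l * (1 - x) powr r \<le> s r x \<and> s r x \<le> M * (1 - x) powr r"
    using scale_density_near_1[of r] by metis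
  obtain d where d: "d > 0" "\<And>x. x \<in> {0<..1/2} \<Longrightarrow> d * S r x \<le> x * s r x"
    using scale_slope[OF p, of "1/2" r] by auto
  define D where "D = M / (- r - 1)"
  have D: "D > 0" using lM r by (simp add: D_def)
  have S2: "S r (1/2) > 0" using scale_function_pos[OF g p, of "1/2" r] by simp
  have up: "S r x \<le> (S r (1/2) + D) * (1 - x) powr (r + 1)" if x: "x \<in> {1/2..<1}" for x
  proof -
    have "D * (1 - 1/2) powr (r + 1) - S r (1/2) \<le> D * (1 - x) powr (r + 1) - S r x"
    proof (rule DERIV_nonneg_imp_increasing_open[where f = "\<lambda>x. D * (1 - x) powr (r + 1) - S r x"])
      show "1/2 \<le> x" using x by simp
      show "continuous_on {1/2..x} (\<lambda>x. D * (1 - x) powr (r + 1) - S r x)"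
      proof -
        have "continuous_on {1/2..x} (S r)"
          by (rule continuous_on_subset[OF scale_function_continuous[OF g p, of x]]) (use x in auto)
        moreover have "continuous_on {1/2..x} (\<lambda>x. (1 - x) powr (r + 1))"
          using x by (intro continuous_on_powr continuous_on_diff continuous_on_const continuous_on_id) auto
        ultimately show ?thesis by (intro continuous_on_diff continuous_on_mult continuous_on_const)
      qed
      fix y assume y: "1/2 < y" "y < x"
      then have y': "y \<in> {0<..<1}" "1 - y > 0" using x by auto
      have "((\<lambda>x. 1 - x) has_real_derivative 0 - 1) (at y)"
        by (intro DERIV_diff DERIV_const DERIV_ident)
      from DERIV_chain2[where f = "\<lambda>z. z powr (r + 1)", OF has_real_derivative_powr[OF y'(2)] this]
      have "((\<lambda>x. D * (1 - x) powr (r + 1) - S r x) has_real_derivative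
          D * ((r + 1) * (1 - y) powr (r + 1 - 1) * (0 - 1)) - s r y) (at y)"
        by (intro DERIV_diff DERIV_cmult scale_function_deriv(1)[OF g p y'(1)])
      moreover have "D * ((r + 1) * (1 - y) powr (r + 1 - 1) * (0 - 1)) = M * (1 - y) powr r"
        using r by (simp add: D_def field_simps)
      ultimately show "\<exists>d. ((\<lambda>x. D * (1 - x) powr (r + 1) - S r x) has_real_derivative d) (at y) \<and> 0 \<le> d"
        using lM(3)[of y] y x by (intro exI[of _ "M * (1 - y) powr r - s r y"]) auto
    qed
    moreover have "0 \<le> D * (1 - 1/2) powr (r + 1)" using D by simp
    moreover have "1 \<le> (1 - x) powr (r + 1)"
      using powr_mono'[of "r + 1" 0 "1 - x"] r x by auto
    then have "S r (1/2) * 1 \<le> S r (1/2) * (1 - x) powr (r + 1)" using S2 by (intro mult_left_mono) auto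
    ultimately show ?thesis by (simp add: algebra_simps)
  qed
  define m where "m = min (d / 2) (l / 2 / (S r (1/2) + D))"
  have m: "m \<le> d / 2" "m \<le> l / 2 / (S r (1/2) + D)"
    unfolding m_def by (rule min.cobounded1, rule min.cobounded2)
  show ?thesis
  proof (intro exI conjI ballI)
    show "m > 0" using d D S2 lM by (simp add: m_def)
    fix x :: real assume x: "x \<in> {0<..<1}"
    have pos: "S r x > 0" "s r x > 0"
      using scale_function_pos[OF g p, of x r] scale_density_pos[of x p r g] x by auto
    show "m * S r x \<le> x * s r x * (1 - x)"
    proof (cases "x \<le> 1/2")
      case True
      have "m * S r x \<le> d / 2 * S r x" using pos m by (intro mult_right_mono) auto
      also have "\<dots> = (d * S r x) * (1/2)" by simp
      also have "\<dots> \<le> (x * s r x) * (1 - x)"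
        using d(2)[of x] True x pos by (intro mult_mono[of "d * S r x" "x * s r x" "1/2" "1 - x"]) auto
      finally show ?thesis .
    next
      case False
      then have x2: "x \<in> {1/2..<1}" using x by auto
      have "m * S r x \<le> (l / 2 / (S r (1/2) + D)) * ((S r (1/2) + D) * (1 - x) powr (r + 1))"
        using pos up[OF x2] lM D S2 m by (intro mult_mono) auto
      also have "\<dots> = 1/2 * (l * (1 - x) powr r) * (1 - x)"
      proof -
        have "l / 2 / E * (E * w) = 1/2 * l * w" if "E > 0" for E w :: real using that by simp
        from this[of "S r (1/2) + D"] show ?thesis using x D S2 by (simp only: powr_add) simp
      qed
      also have "\<dots> \<le> x * s r x * (1 - x)"
        using lM x2 x by (intro mult_right_mono mult_mono) auto
      finally show ?thesis .
    qed
  qed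
qed

text \<open>Comparison on \<open>[0,c]\<close> with \<open>\<epsilon> S + C exp (- \<rho> t) S\<^sup>\<gamma>\<close>, where \<open>S\<close> is harmonic and may be unbounded at
  1. The rate \<open>\<rho>\<close> refers to \<open>(0,c)\<close>, where it can be chosen positive even if 1 is neutral.\<close>

lemma scale_powr_comparison:
  assumes u: "classical_solution A B u" "B 0 = 0" "u 0 0 = 0" and c: "0 < c" "c < 1" and \<gamma>: "\<gamma> > 0"
    and init: "\<And>x. x \<in> {0..c} \<Longrightarrow> u 0 x \<le> C * S q x powr \<gamma>" and C: "C > 0" and \<epsilon>: "\<epsilon> \<ge> 0"
    and le: "\<And>x. x \<in> {0<..<c} \<Longrightarrow> \<rho> \<le> \<gamma> * (1 - \<gamma>) * (A x * (s q x / S q x)\<^sup>2)"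
    and right: "\<And>t. t \<in> {0..T} \<Longrightarrow> u t c \<le> \<epsilon> * S q c + exp (- \<rho> * t) * (C * S q c powr \<gamma>)"
    and t: "t \<in> {0..T}" and x: "x \<in> {0..c}"
  shows "u t x \<le> \<epsilon> * S q x + exp (- \<rho> * t) * (C * S q x powr \<gamma>)"
proof -
  have le': "\<gamma> * (\<gamma> - 1) * (A x * (s q x / S q x)\<^sup>2) + \<gamma> * (A x * s q x * ((q - q) / (1 - x))) / S q x \<le> - \<rho>"
    if "x \<in> {0<..<c}" for x using le[OF that] by (simp add: algebra_simps)
  have int: "x \<in> {0<..<1}" if "x \<in> {0<..<c}" for x using that c by auto
  note lyap = scale_lyapunov[OF int le']
  show ?thesis
  proof (rule comparison_exponential[OF u(1), where c = c and T = T and P = "\<lambda>x. \<epsilon> * S q x"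
        and ?P1.0 = "\<lambda>x. \<epsilon> * s q x" and ?P2.0 = "\<lambda>x. \<epsilon> * s' q x"
        and R = "\<lambda>x. C * S q x powr \<gamma>"
        and ?R1.0 = "\<lambda>x. C * (\<gamma> * S q x powr \<gamma> / S q x * s q x)"
        and ?R2.0 = "\<lambda>x. C * (S q x powr \<gamma> * (\<gamma> * (\<gamma> - 1) * (s q x / S q x)\<^sup>2 + \<gamma> * s' q x / S q x))"])
    show "continuous_on {0..c} (\<lambda>x. C * S q x powr \<gamma>)"
      by (intro continuous_on_mult continuous_on_const scale_powr_continuous \<gamma>) (use c in auto)
    show "continuous_on {0..c} (\<lambda>x. \<epsilon> * S q x)"
      by (intro continuous_on_mult continuous_on_const scale_function_continuous[OF g p]) (use c in auto)
  next
    fix x assume x: "x \<in> {0<..<c}"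
    note x1 = int[OF x]
    show "((\<lambda>x. \<epsilon> * S q x) has_real_derivative \<epsilon> * s q x) (at x)"
      "((\<lambda>x. \<epsilon> * s q x) has_real_derivative \<epsilon> * s' q x) (at x)"
      by (intro DERIV_cmult scale_function_deriv[OF g p x1])+
    have "A x * (\<epsilon> * s' q x) + B x * (\<epsilon> * s q x) = \<epsilon> * (A x * s' q x + B x * s q x)"
      by (simp only: distrib_left mult.left_commute)
    then show "A x * (\<epsilon> * s' q x) + B x * (\<epsilon> * s q x) \<le> 0"
      unfolding operator_scale[OF x1] by simp
    show "((\<lambda>x. C * S q x powr \<gamma>) has_real_derivative C * (\<gamma> * S q x powr \<gamma> / S q x * s q x)) (at x)"
      by (intro DERIV_cmult lyap(1)[OF x x])
    show "((\<lambda>x. C * (\<gamma> * S q x powr \<gamma> / S q x * s q x)) has_real_derivative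
      C * (S q x powr \<gamma> * (\<gamma> * (\<gamma> - 1) * (s q x / S q x)\<^sup>2 + \<gamma> * s' q x / S q x))) (at x)"
      by (intro DERIV_cmult lyap(2)[OF x x])
    show "A x * (C * (S q x powr \<gamma> * (\<gamma> * (\<gamma> - 1) * (s q x / S q x)\<^sup>2 + \<gamma> * s' q x / S q x)))
      + B x * (C * (\<gamma> * S q x powr \<gamma> / S q x * s q x)) \<le> - \<rho> * (C * S q x powr \<gamma>)"
    proof -
      have "C * (a1 * b1 + a2 * b2) \<le> C * (- \<rho> * z)" if "a1 * b1 + a2 * b2 \<le> - \<rho> * z" for a1 b1 a2 b2 z
        using that C by (intro mult_left_mono) auto
      from this[OF lyap(3)[OF x x]] show ?thesis
        by (simp only: distrib_left mult.left_commute)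
    qed
  next
    fix x assume x: "x \<in> {0..c}"
    have "0 \<le> S q x" using scale_function_pos[OF g p, of x q] scale_function_0[of g p q] x c
      by (cases "x = 0") (auto intro: less_imp_le)
    then show "u 0 x \<le> \<epsilon> * S q x + C * S q x powr \<gamma>"
      using init[OF x] \<epsilon> by (simp add: add_increasing)
  next
    fix s1 assume "s1 \<in> {0..T}"
    then show "u s1 0 \<le> \<epsilon> * S q 0 + exp (- \<rho> * s1) * (C * S q 0 powr \<gamma>)"
      using classical_solution_absorbed[OF u(1), of 0 s1] u by (simp add: scale_function_0)
  next
    fix x :: real assume "x \<in> {0<..<1}"
    then show "A x \<ge> 0" using A_pos[of x] by simp
  qed (use c t x right in auto)
qed

text \<open>Since \<open>S\<^sup>\<gamma>\<close> is unbounded at 1 and \<open>u \<le> 1\<close>, comparison on \<open>[0,c]\<close> up to a given time works once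
  \<open>c\<close> is close enough to 1. The resulting bound does not depend on \<open>c\<close>.\<close>

lemma transverse_quadratic_decay:
  assumes q: "q < - 1" and B: "B 0 = 0"
  shows "\<exists>r>0. \<forall>u. classical_solution A B u \<and> (\<forall>x\<in>{0..1}. u 0 x = x) \<and> (\<forall>t\<ge>0. \<forall>x\<in>{0..1}. u t x \<le> 1) \<longrightarrow>
    (\<forall>x\<in>{0..<1}. \<exists>C. \<forall>t\<ge>0. u t x \<le> C * exp (- r * t))"
proof -
  define \<gamma> where "\<gamma> = 1 / (2 + \<bar>p\<bar>)"
  have \<gamma>: "0 < \<gamma>" "\<gamma> < 1" "\<gamma> * (1 - p) \<le> 1" by (auto simp: \<gamma>_def field_simps)
  obtain \<delta> where \<delta>: "\<delta> > 0" "\<And>x. x \<in> {0<..<1} \<Longrightarrow> \<delta> * S q x \<le> x * s q x * (1 - x)"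
    using scale_slope_repelling[OF q] by blast
  obtain C where C: "C > 0" "\<And>x. x \<in> {0..<1} \<Longrightarrow> x \<le> C * S q x powr \<gamma>"
    using scale_power_bound[OF p \<gamma>(1,3), of q] by auto
  define r where "r = \<gamma> * (1 - \<gamma>) * (\<kappa> * \<delta>\<^sup>2)"
  have r: "r > 0" using \<gamma> \<kappa> \<delta> by (simp add: r_def)
  have le: "r \<le> \<gamma> * (1 - \<gamma>) * (A x * (s q x / S q x)\<^sup>2)" if x: "x \<in> {0<..<1}" for x
  proof -
    have "\<kappa> * \<delta>\<^sup>2 * 1 \<le> A x * (s q x / S q x)\<^sup>2"
      by (rule A_slope[OF x jk(2), where z = "1 - x"]) (use \<delta> x in auto)
    then show ?thesis unfolding r_def using \<gamma> by (intro mult_left_mono) auto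
  qed
  have "u t x \<le> (C * S q x powr \<gamma>) * exp (- r * t)"
    if u: "classical_solution A B u" "\<forall>x\<in>{0..1}. u 0 x = x" "\<forall>t\<ge>0. \<forall>x\<in>{0..1}. u t x \<le> 1"
      and x: "x \<in> {0..<1}" and t: "t \<ge> 0" for u x t
  proof -
    \<comment> \<open>At \<open>c\<close> the supersolution is still at least 1 at time \<open>t\<close>.\<close>
    obtain c where c: "x < c" "0 < c" "c < 1" "(exp (r * t) / C) powr (1 / \<gamma>) \<le> S q c"
      using scale_blowup[of q x] q x by (metis atLeastLessThan_iff less_imp_le)
    have "u t x \<le> 0 * S q x + exp (- r * t) * (C * S q x powr \<gamma>)"
    proof (rule scale_powr_comparison[OF u(1) B, where c = c and T = t])
      fix t1 assume t1: "t1 \<in> {0..t}"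
      have "exp (r * t) / C = ((exp (r * t) / C) powr (1 / \<gamma>)) powr \<gamma>"
        using C \<gamma> by (simp add: powr_powr)
      also have "\<dots> \<le> S q c powr \<gamma>" using c \<gamma> by (intro powr_mono2) auto
      finally have "exp (r * t) \<le> C * S q c powr \<gamma>" using C by (simp add: field_simps)
      then have "exp (- r * t1) * exp (r * t) \<le> exp (- r * t1) * (C * S q c powr \<gamma>)"
        by (intro mult_left_mono) auto
      moreover have "exp (- r * t1) * exp (r * t) \<ge> 1"
        using t1 r by (simp add: exp_add[symmetric] mult_left_mono)
      moreover have "u t1 c \<le> 1" using u(3) t1 c by auto
      ultimately have "u t1 c \<le> exp (- r * t1) * (C * S q c powr \<gamma>)" by linarith
      then show "u t1 c \<le> 0 * S q c + exp (- r * t1) * (C * S q c powr \<gamma>)" by simp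
    qed (use u(2) c C \<gamma> le t x in auto)
    then show ?thesis by (simp add: mult.commute)
  qed
  then show ?thesis using r by blast
qed

text \<open>The term \<open>\<epsilon> S\<close> takes care of the boundary point \<open>c\<close>, where it is at least 1, and is at most \<open>e / 2\<close> at
  the given \<open>x\<close>. Away from 1 the function \<open>S\<^sup>\<gamma>\<close> decays at a rate that depends on \<open>c\<close>, hence on \<open>e\<close> and \<open>x\<close>.\<close>

lemma nontangent_quadratic_limit:
  assumes q: "q \<le> - 1" and B: "B 0 = 0"
    and u: "classical_solution A B u" "\<forall>x\<in>{0..1}. u 0 x = x" "\<forall>t\<ge>0. \<forall>x\<in>{0..1}. u t x \<le> 1"
    and x: "x \<in> {0..<1}" and e: "e > 0"
  shows "\<forall>\<^sub>F t in at_top. u t x \<le> e"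
proof -
  define \<gamma> where "\<gamma> = 1 / (2 + \<bar>p\<bar>)"
  have \<gamma>: "0 < \<gamma>" "\<gamma> < 1" "\<gamma> * (1 - p) \<le> 1" by (auto simp: \<gamma>_def field_simps)
  have S0: "S q x \<ge> 0" using scale_function_pos[OF g p, of x q] scale_function_0[of g p q] x
    by (cases "x = 0") (auto intro: less_imp_le)
  define \<epsilon> where "\<epsilon> = e / 2 / (S q x + 1)"
  have \<epsilon>: "\<epsilon> > 0" "\<epsilon> * S q x \<le> e / 2" using e S0 by (auto simp: \<epsilon>_def field_simps)
  obtain c where c: "x < c" "0 < c" "c < 1" "1 / \<epsilon> \<le> S q c"
    using scale_blowup[OF q, of x] x by (metis atLeastLessThan_iff)
  obtain \<delta> where \<delta>: "\<delta> > 0" "\<And>x. x \<in> {0<..c} \<Longrightarrow> \<delta> * S q x \<le> x * s q x"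
    using scale_slope[OF p, of c q] c by auto
  obtain C where C: "C > 0" "\<And>x. x \<in> {0..<1} \<Longrightarrow> x \<le> C * S q x powr \<gamma>"
    using scale_power_bound[OF p \<gamma>(1,3), of q] by auto
  define r where "r = \<gamma> * (1 - \<gamma>) * (\<kappa> * \<delta>\<^sup>2 * (1 - c)\<^sup>2)"
  have r: "r > 0" using \<gamma> \<kappa> \<delta> c by (simp add: r_def)
  have le: "r \<le> \<gamma> * (1 - \<gamma>) * (A x * (s q x / S q x)\<^sup>2)" if x: "x \<in> {0<..<c}" for x
  proof -
    have "(1 - c)\<^sup>2 \<le> (1 - x)\<^sup>2" using x c by (intro power_mono) auto
    then have "\<kappa> * \<delta>\<^sup>2 * (1 - c)\<^sup>2 \<le> A x * (s q x / S q x)\<^sup>2"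
      using x c \<delta> by (intro A_slope[OF _ jk(2), where z = 1]) auto
    then show ?thesis unfolding r_def using \<gamma> by (intro mult_left_mono) auto
  qed
  have bound: "u t x \<le> \<epsilon> * S q x + exp (- r * t) * (C * S q x powr \<gamma>)" if t: "t \<ge> 0" for t
  proof (rule scale_powr_comparison[OF u(1) B, where c = c and T = t])
    fix t1 assume t1: "t1 \<in> {0..t}"
    have "u t1 c \<le> 1" using u(3) t1 c by auto
    also have "1 \<le> \<epsilon> * S q c" using c \<epsilon> by (simp add: field_simps)
    also have "\<dots> \<le> \<epsilon> * S q c + exp (- r * t1) * (C * S q c powr \<gamma>)" using C by simp
    finally show "u t1 c \<le> \<epsilon> * S q c + exp (- r * t1) * (C * S q c powr \<gamma>)" .
  qed (use u(2) c C \<gamma> \<epsilon> le t x in auto)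
  have "filterlim (\<lambda>t. - r * t) at_bot at_top"
    by (rule filterlim_tendsto_neg_mult_at_bot[OF tendsto_const _ filterlim_ident]) (use r in simp)
  from tendsto_mult[OF filterlim_compose[OF exp_at_bot this] tendsto_const]
  have "((\<lambda>t. exp (- r * t) * (C * S q x powr \<gamma>)) \<longlongrightarrow> 0) at_top" by simp
  then have "\<forall>\<^sub>F t in at_top. exp (- r * t) * (C * S q x powr \<gamma>) < e / 2"
    by (rule order_tendstoD) (use e in simp)
  then show ?thesis using eventually_ge_at_top[of 0]
  proof eventually_elim
    case (elim t)
    then show ?case using bound[of t] \<epsilon>(2) by linarith
  qed
qed

end

lemma one_tangent_decay:
  assumes p: "p < 1" and B: "B 0 = 0"
    and k: "k = 1 \<and> q < 0 \<and> B 1 < 0 \<or> k = 2 \<and> q < - 1"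
  shows "\<exists>r>0. \<forall>u. classical_solution A B u \<and> (\<forall>x\<in>{0..1}. u 0 x = x) \<and> (\<forall>t\<ge>0. \<forall>x\<in>{0..1}. u t x \<le> 1) \<longrightarrow>
    (\<forall>x\<in>{0..1}. x < 1 \<or> k = 1 \<longrightarrow> (\<exists>C. \<forall>t\<ge>0. u t x \<le> C * exp (- r * t)))"
proof (cases "k = 1")
  case True
  then have "q < 0" "k \<le> 1" "B 1 < 0" using k by auto
  from transverse_kimura_decay[OF p this(1,2) B this(3)] show ?thesis
    by (elim ex_forward conj_forward all_forward) simp_all
next
  case False
  then have "q < - 1" using k by auto
  from transverse_quadratic_decay[OF p this B] show ?thesis
    using False by (elim ex_forward conj_forward all_forward) simp_all
qed

lemma one_tangent_limit:
  assumes p: "p < 1" and B: "B 0 = 0"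
    and k: "k = 1 \<and> q < 0 \<and> B 1 < 0 \<or> k = 2 \<and> q \<le> - 1"
    and u: "classical_solution A B u" "\<forall>x\<in>{0..1}. u 0 x = x" "\<forall>t\<ge>0. \<forall>x\<in>{0..1}. u t x \<le> 1"
    and x: "x \<in> {0..1}" "x < 1 \<or> k = 1" and e: "e > 0"
  shows "\<forall>\<^sub>F t in at_top. u t x \<le> e"
proof (cases "k = 1")
  case True
  then have "\<exists>r>0. \<forall>u. classical_solution A B u \<and> (\<forall>x\<in>{0..1}. u 0 x = x) \<and> (\<forall>t\<ge>0. \<forall>x\<in>{0..1}. u t x \<le> 1) \<longrightarrow>
    (\<forall>x\<in>{0..1}. x < 1 \<or> k = 1 \<longrightarrow> (\<exists>C. \<forall>t\<ge>0. u t x \<le> C * exp (- r * t)))"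
    using k by (intro one_tangent_decay p B) auto
  then obtain r C where r: "r > 0" and C: "\<And>t. t \<ge> 0 \<Longrightarrow> u t x \<le> C * exp (- r * t)"
    using u x by blast
  have "filterlim (\<lambda>t. - r * t) at_bot at_top"
    by (rule filterlim_tendsto_neg_mult_at_bot[OF tendsto_const _ filterlim_ident]) (use r in simp)
  from tendsto_mult[OF tendsto_const filterlim_compose[OF exp_at_bot this]]
  have "((\<lambda>t. C * exp (- r * t)) \<longlongrightarrow> 0) at_top" by simp
  then have "\<forall>\<^sub>F t in at_top. C * exp (- r * t) < e"
    by (rule order_tendstoD) (use e in simp)
  then show ?thesis using eventually_ge_at_top[of 0]
  proof eventually_elim
    case (elim t)
    then show ?case using C[of t] by linarith
  qed
next
  case False
  then show ?thesis using x k by (intro nontangent_quadratic_limit[OF p _ B u _ e]) auto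
qed

end

section \<open>The normal form of a Kimura operator\<close>

definition diffusion_coeff :: "(real \<Rightarrow> real) \<Rightarrow> (nat \<Rightarrow> nat) \<Rightarrow> real \<Rightarrow> real" where
  "diffusion_coeff a m x = a x * x ^ m 0 * (1 - x) ^ m 1"

definition drift_coeff :: "(real \<Rightarrow> real) \<Rightarrow> (nat \<Rightarrow> nat) \<Rightarrow> real \<Rightarrow> real" where
  "drift_coeff b m x = b x * x ^ (m 0 - 1) * (1 - x) ^ (m 1 - 1)"

lemma C_inf_differentiable: "f \<in> C_inf \<Longrightarrow> x \<in> {0..1} \<Longrightarrow> f differentiable (at x within {0..1})"
proof -
  assume "f \<in> C_inf" "x \<in> {0..1}"
  then have "\<forall>n. \<forall>x\<in>{0..1}. (unit_deriv ^^ n) f differentiable (at x within {0..1})"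
    by (simp only: C_inf_def mem_Collect_eq)
  from bspec[OF spec[OF this, of 0] \<open>x \<in> {0..1}\<close>]
  show "f differentiable (at x within {0..1})" by simp
qed

text \<open>The function \<open>N = b / a - p (1 - x) - q x\<close> vanishes at both endpoints and is differentiable there,
  so \<open>g = N / (x (1 - x))\<close> extends continuously by difference quotients.\<close>

lemma mixed_type_boundary_operator:
  assumes "mixed_type_kimura a b m"
  obtains g \<kappa> where
    "boundary_operator (diffusion_coeff a m) (drift_coeff b m) g (b 0 / a 0) (b 1 / a 1) \<kappa> (m 0) (m 1)"
proof -
  define p where "p = b 0 / a 0"
  define q where "q = b 1 / a 1"
  have a_pos: "\<And>x. x \<in> {0..1} \<Longrightarrow> a x > 0" and m: "m 0 \<in> {1, 2}" "m 1 \<in> {1, 2}"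
    and ab: "a \<in> C_inf" "b \<in> C_inf"
    using assms by (auto simp: mixed_type_kimura_def)
  define N where "N = (\<lambda>x. b x / a x - p * (1 - x) - q * x)"
  have N: "N differentiable (at x within {0..1})" if "x \<in> {0..1}" for x
    unfolding N_def using C_inf_differentiable[OF ab(1) that] C_inf_differentiable[OF ab(2) that] a_pos[OF that]
    by (intro differentiable_diff differentiable_divide differentiable_mult) auto
  have N_cont: "continuous_on {0..1} N"
    unfolding continuous_on_eq_continuous_within using N differentiable_imp_continuous_within by blast
  obtain d0 where d0: "(N has_real_derivative d0) (at 0 within {0..1})"
    using N[of 0] unfolding real_differentiable_def by auto
  obtain d1 where d1: "(N has_real_derivative d1) (at 1 within {0..1})"
    using N[of 1] unfolding real_differentiable_def by auto
  have N0: "N 0 = 0" "N 1 = 0" by (auto simp: N_def p_def q_def)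
  define g where "g = (\<lambda>x. if x = 0 then d0 else if x = 1 then - d1 else N x / (x * (1 - x)))"
  have g_cont: "continuous_on {0..1} g"
  proof (rule continuous_on_IccI)
    have "((\<lambda>x. N x / x) \<longlongrightarrow> d0) (at_right 0)"
      using d0 N0 by (simp add: has_field_derivative_iff at_within_Icc_at_right)
    moreover have "((\<lambda>x::real. 1 - x) \<longlongrightarrow> 1 - 0) (at_right 0)" by (intro tendsto_intros)
    ultimately have "((\<lambda>x. N x / x / (1 - x)) \<longlongrightarrow> d0 / (1 - 0)) (at_right 0)"
      by (intro tendsto_divide) auto
    then have "((\<lambda>x. N x / x / (1 - x)) \<longlongrightarrow> g 0) (at_right 0)" by (simp add: g_def)
    moreover have "\<forall>\<^sub>F x in at_right (0::real). x < 1"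
      by (rule eventually_at_rightI[of 0 1]) auto
    then have "\<forall>\<^sub>F x in at_right 0. N x / x / (1 - x) = g x"
      using eventually_at_right_less[of 0] by eventually_elim (auto simp: g_def)
    ultimately show "(g \<longlongrightarrow> g 0) (at_right 0)" by (rule Lim_transform_eventually)
    have "((\<lambda>x. N x / (x - 1)) \<longlongrightarrow> d1) (at_left 1)"
      using d1 N0 by (simp add: has_field_derivative_iff at_within_Icc_at_left)
    moreover have "((\<lambda>x::real. - x) \<longlongrightarrow> - 1) (at_left 1)" by (intro tendsto_intros)
    ultimately have "((\<lambda>x. N x / (x - 1) / - x) \<longlongrightarrow> d1 / - 1) (at_left 1)"
      by (intro tendsto_divide) auto
    then have "((\<lambda>x. N x / (x - 1) / - x) \<longlongrightarrow> g 1) (at_left 1)" by (simp add: g_def)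
    moreover have "\<forall>\<^sub>F x in at_left (1::real). x \<in> {0<..<1}"
      by (rule eventually_at_leftI[of 0 1]) auto
    then have "\<forall>\<^sub>F x in at_left 1. N x / (x - 1) / - x = g x"
      by eventually_elim (auto simp: g_def field_simps)
    ultimately show "(g \<longlongrightarrow> g 1) (at_left 1)" by (rule Lim_transform_eventually)
  next
    fix x :: real assume x: "0 < x" "x < 1"
    have "continuous_on {0<..<1} N" by (rule continuous_on_subset[OF N_cont]) auto
    then have "continuous_on {0<..<1} (\<lambda>x. N x / (x * (1 - x)))"
      by (intro continuous_on_divide continuous_on_mult continuous_on_diff continuous_on_const continuous_on_id) auto
    then have "isCont (\<lambda>x. N x / (x * (1 - x))) x"
      using x by (simp add: continuous_on_eq_continuous_at)
    then have "((\<lambda>x. N x / (x * (1 - x))) \<longlongrightarrow> g x) (at x)" using x by (simp add: isCont_def g_def)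
    moreover have "\<forall>\<^sub>F y in at x. y \<in> {0<..<1}"
      using x by (intro eventually_at_in_open') auto
    then have "\<forall>\<^sub>F y in at x. N y / (y * (1 - y)) = g y"
      by eventually_elim (auto simp: g_def)
    ultimately show "(g \<longlongrightarrow> g x) (at x)" by (rule Lim_transform_eventually)
  qed simp
  have "continuous_on {0..1} a"
    unfolding continuous_on_eq_continuous_within
    using C_inf_differentiable[OF ab(1)] differentiable_imp_continuous_within by blast
  then obtain y where y: "y \<in> {0..1}" "\<And>x. x \<in> {0..1} \<Longrightarrow> a y \<le> a x"
    using continuous_attains_inf[of "{0..1}" a] by auto
  show thesis
  proof (rule that[of g "a y"], unfold_locales)
    show "continuous_on {0..1} g" by (rule g_cont)
    show "0 < a y" using a_pos y by simp
    show "m 0 \<le> 2" "m 1 \<le> 2" using m by auto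
    fix x :: real assume x: "x \<in> {0<..<1}"
    show "a y * (x ^ m 0 * (1 - x) ^ m 1) \<le> diffusion_coeff a m x"
      using y(2)[of x] x by (simp add: diffusion_coeff_def mult_right_mono mult.assoc)
    \<comment> \<open>The exponents of \<open>x\<close> and \<open>1 - x\<close> in the drift are one less than those in the diffusion coefficient.\<close>
    have pw: "z ^ n = z * z ^ (n - 1)" if "n \<in> {1, 2}" for z :: real and n :: nat
      using that by (auto simp: power2_eq_square)
    have ratio: "x * (1 - x) * (p / x + q / (1 - x) + g x) = b x / a x"
    proof -
      have "x * (1 - x) * (p / x + q / (1 - x) + g x) = p * (1 - x) + q * x + N x"
        using x by (simp add: g_def distrib_left)
      then show ?thesis by (simp add: N_def)
    qed
    have "diffusion_coeff a m x * (p / x + q / (1 - x) + g x)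
      = a x * x ^ (m 0 - 1) * (1 - x) ^ (m 1 - 1) * (x * (1 - x) * (p / x + q / (1 - x) + g x))"
      unfolding diffusion_coeff_def pw[OF m(1)] pw[OF m(2)] by (simp only: mult_ac)
    also have "\<dots> = drift_coeff b m x"
      unfolding ratio drift_coeff_def using a_pos[of x] x by simp
    finally show "drift_coeff b m x = diffusion_coeff a m x * (b 0 / a 0 / x + b 1 / a 1 / (1 - x) + g x)"
      by (simp add: p_def q_def)
  qed
qed

lemma kimura_op_coeffs:
  "kimura_op a b m f x = diffusion_coeff a m x * unit_deriv (unit_deriv f) x + drift_coeff b m x * unit_deriv f x"
  by (simp add: kimura_op_def diffusion_coeff_def drift_coeff_def)

lemma unit_deriv_works:
  "f differentiable (at x within {0..1}) \<Longrightarrow> (f has_real_derivative unit_deriv f x) (at x within {0..1})"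
  by (simp add: unit_deriv_def has_real_derivative_iff_has_vector_derivative vector_derivative_works)

lemma unit_deriv_eq:
  "(f has_real_derivative d) (at x within {0..1}) \<Longrightarrow> x \<in> {0..1} \<Longrightarrow> unit_deriv f x = d"
  unfolding unit_deriv_def
  by (rule vector_derivative_within_closed_interval) (auto simp: has_real_derivative_iff_has_vector_derivative)

text \<open>At a quadratic endpoint the drift coefficient vanishes, so differentiability is only asked for
  where the regularity of the semigroup provides it.\<close>

lemma semigroup_classical_solution:
  assumes mixed: "mixed_type_kimura a b m" and Q: "kimura_semigroup a b m Q" and f: "f \<in> C_zero"
  shows "classical_solution (diffusion_coeff a m) (drift_coeff b m) (\<lambda>t. Q t f)"
  unfolding classical_solution_def
proof (intro conjI allI impI)
  show "continuous_on ({0..} \<times> {0..1}) (\<lambda>(t, x). Q t f x)"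
    using Q f by (simp add: kimura_semigroup_def)
  fix t :: real assume t: "t > 0"
  have reg: "kimura_regular m (Q t f)"
    and dt: "\<And>x. x \<in> {0..1} \<Longrightarrow> ((\<lambda>s. Q s f x) has_real_derivative kimura_op a b m (Q t f) x) (at t)"
    using Q f t unfolding kimura_semigroup_def by blast+
  have m: "m 0 \<in> {1, 2}" "m 1 \<in> {1, 2}" using mixed by (auto simp: mixed_type_kimura_def)
  have d1: "(Q t f has_real_derivative unit_deriv (Q t f) x) (at x within {0..1})"
    and d2: "(unit_deriv (Q t f) has_real_derivative unit_deriv (unit_deriv (Q t f)) x) (at x within {0..1})"
    if "x \<in> {0..1} - quadratic_endpoints m" for x
    using reg that by (auto simp: kimura_regular_def intro!: unit_deriv_works)
  show "\<exists>ux uxx.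
        (\<forall>x\<in>{0<..<1}. (Q t f has_real_derivative ux x) (at x) \<and>
           (ux has_real_derivative uxx x) (at x) \<and>
           ((\<lambda>s. Q s f x) has_real_derivative diffusion_coeff a m x * uxx x + drift_coeff b m x * ux x) (at t)) \<and>
        (\<forall>e\<in>{0, 1}. ((\<lambda>s. Q s f e) has_real_derivative drift_coeff b m e * ux e) (at t) \<and>
           (drift_coeff b m e \<noteq> 0 \<longrightarrow> (Q t f has_real_derivative ux e) (at e within {0..1})))"
  proof (intro exI conjI ballI impI)
    fix x :: real assume x: "x \<in> {0<..<1}"
    have x': "x \<in> {0..1} - quadratic_endpoints m" and eq: "at x within {0..1} = at x"
      using x at_within_Icc_at[of 0 x 1] by (auto simp: quadratic_endpoints_def)
    show "(Q t f has_real_derivative unit_deriv (Q t f) x) (at x)" using d1[OF x'] unfolding eq .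
    show "(unit_deriv (Q t f) has_real_derivative unit_deriv (unit_deriv (Q t f)) x) (at x)"
      using d2[OF x'] unfolding eq .
    show "((\<lambda>s. Q s f x) has_real_derivative diffusion_coeff a m x * unit_deriv (unit_deriv (Q t f)) x
        + drift_coeff b m x * unit_deriv (Q t f) x) (at t)"
      using dt[of x] x by (simp add: kimura_op_coeffs)
  next
    fix e :: real assume e: "e \<in> {0, 1}"
    have "diffusion_coeff a m e = 0" using e m by (auto simp: diffusion_coeff_def)
    then show "((\<lambda>s. Q s f e) has_real_derivative drift_coeff b m e * unit_deriv (Q t f) e) (at t)"
      using dt[of e] e by (auto simp: kimura_op_coeffs)
    assume "drift_coeff b m e \<noteq> 0"
    then have "e \<notin> quadratic_endpoints m"
      using e m by (auto simp: drift_coeff_def quadratic_endpoints_def)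
    then show "(Q t f has_real_derivative unit_deriv (Q t f) e) (at e within {0..1})"
      using d1[of e] e by auto
  qed
qed

section \<open>Wasserstein distance on the unit interval\<close>

lemma C_zero_measurable:
  assumes "f \<in> C_zero" "sets M = sets unit_borel"
  shows "f \<in> borel_measurable M"
proof -
  have "f \<in> borel_measurable unit_borel"
    using assms(1) by (simp add: C_zero_def borel_measurable_continuous_on_restrict)
  then show ?thesis unfolding measurable_cong_sets[OF assms(2) refl] .
qed

lemma unit_borel_space: "sets M = sets unit_borel \<Longrightarrow> space M = {0..1}"
  using sets_eq_imp_space_eq[of M unit_borel] by (simp add: space_restrict_space)

lemma C_zero_integrable:
  assumes f: "f \<in> C_zero" and "finite_measure M" "sets M = sets unit_borel"
  shows "integrable M f"
proof -
  interpret finite_measure M by fact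
  have "bounded (f ` {0..1})"
    using f by (auto simp: C_zero_def intro!: compact_imp_bounded compact_continuous_image)
  then obtain K where "\<forall>y\<in>f ` {0..1}. norm y \<le> K" unfolding bounded_iff by blast
  then have "AE x in M. norm (f x) \<le> K" using unit_borel_space[OF assms(3)] by (auto intro!: AE_I2)
  then show ?thesis using C_zero_measurable[OF f assms(3)] by (rule integrable_const_bound)
qed

lemma lipschitz_C_zero: "1-lipschitz_on {0..1} f \<Longrightarrow> f \<in> C_zero"
  by (simp add: C_zero_def lipschitz_on_continuous_on)

lemma zero_lipschitz: "1-lipschitz_on {0..1::real} (\<lambda>_. 0 :: real)"
  by (rule lipschitz_onI) auto

lemma wasserstein_le:
  assumes "\<And>f :: real \<Rightarrow> real. 1-lipschitz_on {0..1} f \<Longrightarrow> (\<integral>x. f x \<partial>\<mu>) - (\<integral>x. f x \<partial>\<nu>) \<le> c"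
  shows "wasserstein \<mu> \<nu> \<le> c"
  unfolding wasserstein_def using zero_lipschitz assms by (intro cSUP_least) auto

text \<open>The upper bound is there because the supremum of an unbounded set of reals has no meaning.\<close>

lemma wasserstein_nonneg:
  assumes "\<And>f :: real \<Rightarrow> real. 1-lipschitz_on {0..1} f \<Longrightarrow> (\<integral>x. f x \<partial>\<mu>) - (\<integral>x. f x \<partial>\<nu>) \<le> c"
  shows "0 \<le> wasserstein \<mu> \<nu>"
proof -
  have "(\<integral>x. 0 \<partial>\<mu>) - (\<integral>x. 0 \<partial>\<nu>) \<le> wasserstein \<mu> \<nu>"
    unfolding wasserstein_def
    using zero_lipschitz assms
    by (intro cSUP_upper[where f = "\<lambda>f. (\<integral>x. f x \<partial>\<mu>) - (\<integral>x. f x \<partial>\<nu>)" and x = "\<lambda>_. 0"] bdd_aboveI[of _ c]) auto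
  then show ?thesis by simp
qed

lemma integral_dirac:
  assumes "e \<in> {0..1}" "f \<in> C_zero"
  shows "(\<integral>x. f x \<partial>dirac e) = f e"
  using assms C_zero_measurable[of f unit_borel] by (intro integral_return) (auto simp: space_restrict_space)

lemma dist_C_zero: "(\<lambda>y. \<bar>y - e\<bar>) \<in> C_zero"
  by (auto simp: C_zero_def intro!: continuous_intros)

text \<open>The best test function for a Dirac measure is the distance to its support, since
  \<open>f y - f e \<le> \<bar>y - e\<bar>\<close> for every 1-Lipschitz \<open>f\<close>.\<close>

lemma wasserstein_dirac:
  assumes P: "transition_probability Q t x \<mu>" and e: "e \<in> {0..1}"
  shows "wasserstein \<mu> (dirac e) \<le> Q t (\<lambda>y. \<bar>y - e\<bar>) x" and "0 \<le> wasserstein \<mu> (dirac e)"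
    and "Q t (\<lambda>y. \<bar>y - e\<bar>) x \<le> 1"
proof -
  interpret prob_space \<mu> using P by (simp add: transition_probability_def)
  have sets: "sets \<mu> = sets unit_borel"
    and eq: "\<And>f. f \<in> C_zero \<Longrightarrow> Q t f x = (\<integral>y. f y \<partial>\<mu>)"
    using P by (auto simp: transition_probability_def)
  note int = C_zero_integrable[OF _ finite_measure_axioms sets]
  have le: "(\<integral>y. f y \<partial>\<mu>) - (\<integral>y. f y \<partial>dirac e) \<le> Q t (\<lambda>y. \<bar>y - e\<bar>) x"
    if f: "1-lipschitz_on {0..1} f" for f
  proof -
    have fC: "f \<in> C_zero" by (rule lipschitz_C_zero[OF f])
    have "(\<integral>y. f y \<partial>\<mu>) - f e = (\<integral>y. f y - f e \<partial>\<mu>)"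
      using int[OF fC] by (simp add: prob_space)
    also have "\<dots> \<le> (\<integral>y. \<bar>y - e\<bar> \<partial>\<mu>)"
    proof (rule integral_mono)
      fix y assume "y \<in> space \<mu>"
      then have "y \<in> {0..1}" using unit_borel_space[OF sets] by simp
      then show "f y - f e \<le> \<bar>y - e\<bar>"
        using lipschitz_onD[OF f, of y e] e by (auto simp: dist_real_def)
    qed (use int[OF fC] int[OF dist_C_zero] in auto)
    finally show ?thesis using integral_dirac[OF e fC] eq[OF dist_C_zero] by simp
  qed
  show "wasserstein \<mu> (dirac e) \<le> Q t (\<lambda>y. \<bar>y - e\<bar>) x" by (rule wasserstein_le[OF le])
  show "0 \<le> wasserstein \<mu> (dirac e)" by (rule wasserstein_nonneg[OF le])
  have "(\<integral>y. \<bar>y - e\<bar> \<partial>\<mu>) \<le> (\<integral>y. 1 \<partial>\<mu>)"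
    using unit_borel_space[OF sets] e
    by (intro integral_mono int[OF dist_C_zero]) (auto simp: abs_le_iff)
  then show "Q t (\<lambda>y. \<bar>y - e\<bar>) x \<le> 1" using eq[OF dist_C_zero] by (simp add: prob_space)
qed

text \<open>The mixture is identified with the image of a weighted counting measure on the two endpoints,
  whose integral is a finite sum.\<close>

lemma endpoint_mixture_integral:
  assumes c: "0 \<le> c0" "0 \<le> c1" and f: "f \<in> C_zero"
  shows "(\<integral>x. f x \<partial>endpoint_mixture c0 c1) = c0 * f 0 + c1 * f 1"
proof -
  define N where "N = point_measure {0, 1::real} (\<lambda>x. ennreal (if x = 0 then c0 else c1))"
  define M where "M = distr N unit_borel (\<lambda>x. x)"
  have id: "(\<lambda>x. x) \<in> measurable N unit_borel"
    by (auto simp: N_def measurable_def space_point_measure sets_point_measure space_restrict_space)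
  have "endpoint_mixture c0 c1 = measure_of {0..1} (sets unit_borel) (emeasure M)"
    unfolding endpoint_mixture_def
  proof (rule measure_of_eq)
    show "sets unit_borel \<subseteq> Pow {0..1}" using sets.sets_into_space[of _ unit_borel] by (auto simp: space_restrict_space)
    fix A assume "A \<in> sigma_sets {0..1} (sets unit_borel)"
    then have A: "A \<in> sets unit_borel"
      using sets.sigma_sets_eq[of unit_borel] by (simp add: space_restrict_space)
    have sp: "space N = {0, 1}" by (simp add: N_def space_point_measure)
    have "emeasure M A = emeasure N (A \<inter> {0, 1})"
      unfolding M_def by (simp add: emeasure_distr[OF id A] sp)
    also have "\<dots> = (\<Sum>x\<in>A \<inter> {0, 1}. ennreal (if x = 0 then c0 else c1))"
      unfolding N_def by (rule emeasure_point_measure_finite) auto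
    also have "A \<inter> {0, 1} = {x \<in> {0, 1}. x \<in> A}" by auto
    also have "(\<Sum>x\<in>{x \<in> {0, 1}. x \<in> A}. ennreal (if x = 0 then c0 else c1))
        = (\<Sum>x\<in>{0, 1}. if x \<in> A then ennreal (if x = 0 then c0 else c1) else 0)"
      by (rule sum.inter_filter) simp
    also have "\<dots> = ennreal c0 * emeasure (dirac 0) A + ennreal c1 * emeasure (dirac 1) A"
      using A by (simp add: emeasure_return)
    finally show "ennreal c0 * emeasure (dirac 0) A + ennreal c1 * emeasure (dirac 1) A = emeasure M A" by simp
  qed
  also have "\<dots> = M"
    using measure_of_of_measure[of M] by (simp add: M_def space_restrict_space)
  finally have "(\<integral>x. f x \<partial>endpoint_mixture c0 c1) = (\<integral>x. f x \<partial>M)" by simp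
  also have "\<dots> = (\<integral>x. f x \<partial>N)"
    unfolding M_def by (rule integral_distr[OF id C_zero_measurable[OF f refl]])
  also have "\<dots> = c0 * f 0 + c1 * f 1"
    unfolding N_def using c by (subst lebesgue_integral_point_measure_finite) auto
  finally show ?thesis .
qed

section \<open>Convergence of the semigroup\<close>

lemma tangent_0_coeffs:
  assumes "mixed_type_kimura a b m" "tangent a b m 0"
  shows "b 0 / a 0 < 1" "drift_coeff b m 0 = 0" "m 0 = 1 \<Longrightarrow> b 0 / a 0 = 0"
  using assms by (auto simp: mixed_type_kimura_def tangent_def drift_coeff_def split: if_splits)

lemma tangent_1_coeffs:
  assumes "mixed_type_kimura a b m" "tangent a b m 1"
  shows "b 1 / a 1 > - 1" "drift_coeff b m 1 = 0" "m 1 = 1 \<Longrightarrow> b 1 / a 1 = 0"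
  using assms by (auto simp: mixed_type_kimura_def tangent_def drift_coeff_def split: if_splits)

lemma nontangent_0_coeffs:
  assumes "mixed_type_kimura a b m" "\<not> tangent a b m 0"
  shows "m 0 = 1 \<and> b 0 / a 0 > 0 \<and> drift_coeff b m 0 > 0 \<or> m 0 = 2 \<and> b 0 / a 0 \<ge> 1"
    and "\<not> neutral a b m 0 \<Longrightarrow> m 0 = 1 \<and> b 0 / a 0 > 0 \<and> drift_coeff b m 0 > 0 \<or> m 0 = 2 \<and> b 0 / a 0 > 1"
proof -
  have "a 0 > 0" using assms by (auto simp: mixed_type_kimura_def)
  then show "m 0 = 1 \<and> b 0 / a 0 > 0 \<and> drift_coeff b m 0 > 0 \<or> m 0 = 2 \<and> b 0 / a 0 \<ge> 1"
    and "\<not> neutral a b m 0 \<Longrightarrow> m 0 = 1 \<and> b 0 / a 0 > 0 \<and> drift_coeff b m 0 > 0 \<or> m 0 = 2 \<and> b 0 / a 0 > 1"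
    using assms by (auto simp: mixed_type_kimura_def tangent_def neutral_def drift_coeff_def)
qed

lemma nontangent_1_coeffs:
  assumes "mixed_type_kimura a b m" "\<not> tangent a b m 1"
  shows "m 1 = 1 \<and> b 1 / a 1 < 0 \<and> drift_coeff b m 1 < 0 \<or> m 1 = 2 \<and> b 1 / a 1 \<le> - 1"
    and "\<not> neutral a b m 1 \<Longrightarrow> m 1 = 1 \<and> b 1 / a 1 < 0 \<and> drift_coeff b m 1 < 0 \<or> m 1 = 2 \<and> b 1 / a 1 < - 1"
proof -
  have "a 1 > 0" using assms by (auto simp: mixed_type_kimura_def)
  then show "m 1 = 1 \<and> b 1 / a 1 < 0 \<and> drift_coeff b m 1 < 0 \<or> m 1 = 2 \<and> b 1 / a 1 \<le> - 1"
    and "\<not> neutral a b m 1 \<Longrightarrow> m 1 = 1 \<and> b 1 / a 1 < 0 \<and> drift_coeff b m 1 < 0 \<or> m 1 = 2 \<and> b 1 / a 1 < - 1"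
    using assms by (auto simp: mixed_type_kimura_def tangent_def neutral_def drift_coeff_def divide_less_0_iff)
qed

text \<open>The distance to the tangent endpoint, evolved by the semigroup. For \<open>i = 1\<close> the reflected
  operator and the reflected solution take the place of the original ones.\<close>

lemma one_tangent_distance:
  fixes Q
  assumes mixed: "mixed_type_kimura a b m" and Q: "kimura_semigroup a b m Q"
    and P: "\<forall>t\<ge>0. \<forall>x\<in>{0..1}. transition_probability Q t x (p t x)"
    and i: "i \<in> {0, 1}" and tan: "tangent a b m i" "\<not> tangent a b m (1 - i)"
  defines "D \<equiv> \<lambda>t x. Q t (\<lambda>y. \<bar>y - real i\<bar>) x"
  shows "\<And>x e. x \<in> {0..1} - quadratic_endpoints m \<Longrightarrow> e > 0 \<Longrightarrow> \<forall>\<^sub>F t in at_top. D t x \<le> e"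
    and "\<not> neutral a b m (1 - i) \<Longrightarrow>
      \<exists>r>0. \<forall>x\<in>{0..1} - quadratic_endpoints m. \<exists>C. \<forall>t\<ge>0. D t x \<le> C * exp (- r * t)"
proof -
  obtain g \<kappa> where
    "boundary_operator (diffusion_coeff a m) (drift_coeff b m) g (b 0 / a 0) (b 1 / a 1) \<kappa> (m 0) (m 1)"
    using mixed_type_boundary_operator[OF mixed] .
  then interpret L: boundary_operator "diffusion_coeff a m" "drift_coeff b m" g "b 0 / a 0" "b 1 / a 1" \<kappa> "m 0" "m 1" .
  interpret R: boundary_operator "\<lambda>x. diffusion_coeff a m (1 - x)" "\<lambda>x. - drift_coeff b m (1 - x)"
    "\<lambda>x. - g (1 - x)" "- (b 1 / a 1)" "- (b 0 / a 0)" \<kappa> "m 1" "m 0"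
    by (rule L.reflected)
  have sol: "classical_solution (diffusion_coeff a m) (drift_coeff b m) D"
    unfolding D_def by (rule semigroup_classical_solution[OF mixed Q dist_C_zero])
  have D0: "D 0 x = \<bar>x - real i\<bar>" if "x \<in> {0..1}" for x
  proof -
    have "\<forall>f\<in>C_zero. \<forall>x\<in>{0..1}. Q 0 f x = f x" using Q by (simp add: kimura_semigroup_def)
    from bspec[OF bspec[OF this dist_C_zero] that] show ?thesis unfolding D_def .
  qed
  have D1: "D t x \<le> 1" if "t \<ge> 0" "x \<in> {0..1}" for t x
    unfolding D_def using P that i by (intro wasserstein_dirac(3)[where \<mu> = "p t x"]) auto
  have quad: "real j \<in> quadratic_endpoints m \<longleftrightarrow> m j = 2" if "j \<in> {0, 1}" for j
    using that by (auto simp: quadratic_endpoints_def)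
  consider "i = 0" | "i = 1" using i by auto
  then have "(\<forall>x\<in>{0..1} - quadratic_endpoints m. \<forall>e>0. \<forall>\<^sub>F t in at_top. D t x \<le> e) \<and>
    (\<not> neutral a b m (1 - i) \<longrightarrow>
      (\<exists>r>0. \<forall>x\<in>{0..1} - quadratic_endpoints m. \<exists>C. \<forall>t\<ge>0. D t x \<le> C * exp (- r * t)))"
  proof cases
    case 1
    have tan': "tangent a b m 0" "\<not> tangent a b m 1" using tan 1 by auto
    have u: "\<forall>x\<in>{0..1}. D 0 x = x" "\<forall>t\<ge>0. \<forall>x\<in>{0..1}. D t x \<le> 1"
      using D0 D1 1 by auto
    have x: "x < 1 \<or> m 1 = 1" if "x \<in> {0..1} - quadratic_endpoints m" for x
      using that quad[of 1] mixed by (cases "x = 1") (auto simp: mixed_type_kimura_def)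
    show ?thesis
    proof (intro conjI ballI allI impI)
      fix x e :: real assume "x \<in> {0..1} - quadratic_endpoints m" "e > 0"
      then show "\<forall>\<^sub>F t in at_top. D t x \<le> e"
        by (intro L.one_tangent_limit[OF tangent_0_coeffs(1,2)[OF mixed tan'(1)] nontangent_1_coeffs(1)[OF mixed tan'(2)] sol u]
            x) auto
    next
      assume "\<not> neutral a b m (1 - i)"
      then have "\<not> neutral a b m 1" using 1 by simp
      from L.one_tangent_decay[OF tangent_0_coeffs(1,2)[OF mixed tan'(1)] nontangent_1_coeffs(2)[OF mixed tan'(2) this]]
      obtain r where r: "r > 0" "\<forall>x\<in>{0..1}. x < 1 \<or> m 1 = 1 \<longrightarrow> (\<exists>C. \<forall>t\<ge>0. D t x \<le> C * exp (- r * t))"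
        using sol u by blast
      then show "\<exists>r>0. \<forall>x\<in>{0..1} - quadratic_endpoints m. \<exists>C. \<forall>t\<ge>0. D t x \<le> C * exp (- r * t)"
        using x by blast
    qed
  next
    case 2
    have tan': "tangent a b m 1" "\<not> tangent a b m 0" using tan 2 by auto
    define U where "U = (\<lambda>t x. D t (1 - x))"
    have solU: "classical_solution (\<lambda>x. diffusion_coeff a m (1 - x)) (\<lambda>x. - drift_coeff b m (1 - x)) U"
      unfolding U_def by (rule classical_solution_reflect[OF sol])
    have u: "\<forall>x\<in>{0..1}. U 0 x = x" "\<forall>t\<ge>0. \<forall>x\<in>{0..1}. U t x \<le> 1"
      using D0 D1 2 by (auto simp: U_def)
    have x: "1 - x < 1 \<or> m 0 = 1" "1 - x \<in> {0..1}" if "x \<in> {0..1} - quadratic_endpoints m" for x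
      using that quad[of 0] mixed by (cases "x = 0"; auto simp: mixed_type_kimura_def)+
    have UD: "D t x = U t (1 - x)" for t x by (simp add: U_def)
    have tan1: "- (b 1 / a 1) < 1" "- drift_coeff b m (1 - 0) = 0"
      using tangent_1_coeffs[OF mixed] tan' by auto
    show ?thesis
    proof (intro conjI ballI allI impI)
      fix x e :: real assume xe: "x \<in> {0..1} - quadratic_endpoints m" "e > 0"
      have "m 0 = 1 \<and> - (b 0 / a 0) < 0 \<and> - drift_coeff b m (1 - 1) < 0 \<or> m 0 = 2 \<and> - (b 0 / a 0) \<le> - 1"
        using nontangent_0_coeffs(1)[OF mixed] tan' by auto
      from R.one_tangent_limit[OF tan1 this solU u x(2,1) xe(2)] xe(1)
      show "\<forall>\<^sub>F t in at_top. D t x \<le> e" unfolding UD by blast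
    next
      assume "\<not> neutral a b m (1 - i)"
      then have "m 0 = 1 \<and> - (b 0 / a 0) < 0 \<and> - drift_coeff b m (1 - 1) < 0 \<or> m 0 = 2 \<and> - (b 0 / a 0) < - 1"
        using nontangent_0_coeffs(2)[OF mixed] tan' 2 by auto
      from R.one_tangent_decay[OF tan1 this]
      obtain r where r: "r > 0" "\<forall>x\<in>{0..1}. x < 1 \<or> m 0 = 1 \<longrightarrow> (\<exists>C. \<forall>t\<ge>0. U t x \<le> C * exp (- r * t))"
        using solU u by blast
      show "\<exists>r>0. \<forall>x\<in>{0..1} - quadratic_endpoints m. \<exists>C. \<forall>t\<ge>0. D t x \<le> C * exp (- r * t)"
        unfolding UD using r x by blast
    qed
  qed
  then show "\<And>x e. x \<in> {0..1} - quadratic_endpoints m \<Longrightarrow> e > 0 \<Longrightarrow> \<forall>\<^sub>F t in at_top. D t x \<le> e"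
    and "\<not> neutral a b m (1 - i) \<Longrightarrow>
      \<exists>r>0. \<forall>x\<in>{0..1} - quadratic_endpoints m. \<exists>C. \<forall>t\<ge>0. D t x \<le> C * exp (- r * t)"
    by blast+
qed

context boundary_operator
begin

text \<open>The second derivative along \<open>[0,1]\<close> is computed from the first one on a neighbourhood, and
  \<open>regular_points\<close> is relatively open in \<open>[0,1]\<close>.\<close>

lemma hitting_unit_derivs:
  assumes p: "p < 1" and q: "q > - 1" and x: "x \<in> regular_points p q"
  shows "(hitting has_real_derivative s q x / S q 1) (at x within {0..1})"
    and "unit_deriv hitting x = s q x / S q 1"
    and "(unit_deriv hitting has_real_derivative s' q x / S q 1) (at x within {0..1})"
    and "unit_deriv (unit_deriv hitting) x = s' q x / S q 1"
proof -
  have mem: "y \<in> {0..1}" if "y \<in> regular_points p q" for y using that by (simp add: regular_points_def)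
  show d1: "(hitting has_real_derivative s q x / S q 1) (at x within {0..1})"
    by (rule hitting_deriv_within(1)[OF p q x])
  have eq: "unit_deriv hitting y = s q y / S q 1" if "y \<in> regular_points p q" for y
    by (rule unit_deriv_eq[OF hitting_deriv_within(1)[OF p q that] mem[OF that]])
  show "unit_deriv hitting x = s q x / S q 1" by (rule eq[OF x])
  define d where "d = (if x = 0 \<or> x = 1 then 1 else min x (1 - x))"
  have d: "d > 0" using mem[OF x] by (auto simp: d_def)
  have near: "y \<in> regular_points p q" if "y \<in> {0..1}" "dist y x < d" for y
    using that x by (auto simp: d_def regular_points_def dist_real_def split: if_splits)
  show d2: "(unit_deriv hitting has_real_derivative s' q x / S q 1) (at x within {0..1})"
    by (rule has_field_derivative_transform_within[OF hitting_deriv_within(2)[OF p q x] d mem[OF x]])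
      (simp add: eq[OF near])
  show "unit_deriv (unit_deriv hitting) x = s' q x / S q 1"
    by (rule unit_deriv_eq[OF d2 mem[OF x]])
qed

text \<open>A tangent Kimura endpoint has exponent 0, as \<open>b\<close> vanishes there, and so it belongs to
  \<open>regular_points\<close>; hence the inclusion that is assumed.\<close>

lemma hitting_regular:
  assumes p: "p < 1" and q: "q > - 1" and quad: "{0..1} - quadratic_endpoints m \<subseteq> regular_points p q"
  shows "kimura_regular m hitting"
  unfolding kimura_regular_def
proof (intro conjI ballI)
  show "hitting \<in> C_zero" using hitting_continuous[OF p q] by (simp add: C_zero_def)
  fix x assume "x \<in> {0..1} - quadratic_endpoints m"
  then have x: "x \<in> regular_points p q" using quad by blast
  show "hitting differentiable (at x within {0..1})" "unit_deriv hitting differentiable (at x within {0..1})"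
    using hitting_unit_derivs(1,3)[OF p q x] by (auto simp: real_differentiable_def)
next
  have p_cont: "continuous_on (regular_points p q) (\<lambda>x. - p / x)"
    by (cases "p = 0") (auto simp: regular_points_def intro!: continuous_intros)
  have q_cont: "continuous_on (regular_points p q) (\<lambda>x. q / (1 - x))"
    by (cases "q = 0") (auto simp: regular_points_def intro!: continuous_intros)
  have "continuous_on (regular_points p q) (\<lambda>x. s' q x / S q 1)"
    using scale_at_1_pos[OF p q]
    by (intro continuous_on_divide continuous_on_mult continuous_on_diff p_cont q_cont
        scale_density_continuous[OF g] continuous_on_subset[OF g] continuous_on_const)
      (auto simp: regular_points_def)
  then have "continuous_on ({0..1} - quadratic_endpoints m) (\<lambda>x. s' q x / S q 1)"
    by (rule continuous_on_subset[OF _ quad])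
  moreover have "unit_deriv (unit_deriv hitting) x = s' q x / S q 1"
    if "x \<in> {0..1} - quadratic_endpoints m" for x
    using hitting_unit_derivs(4)[OF p q] that quad by blast
  ultimately show "continuous_on ({0..1} - quadratic_endpoints m) (unit_deriv (unit_deriv hitting))"
    by (simp cong: continuous_on_cong_simp)
qed

lemma hitting_harmonic:
  assumes p: "p < 1" and q: "q > - 1" and AB: "A 0 = 0" "A 1 = 0" "B 0 = 0" "B 1 = 0" and x: "x \<in> {0..1}"
  shows "A x * unit_deriv (unit_deriv hitting) x + B x * unit_deriv hitting x = 0"
proof (cases "x \<in> {0<..<1}")
  case True
  then have reg: "x \<in> regular_points p q" by simp
  show ?thesis
    unfolding hitting_unit_derivs(2,4)[OF p q reg]
    using operator_scale[OF True, of q] scale_at_1_pos[OF p q] by (simp add: field_simps)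
next
  case False
  then have "x = 0 \<or> x = 1" using x by auto
  then show ?thesis using AB by auto
qed

end

text \<open>The pointwise bound \<open>Q t f \<le> f 0 (1 - S0) + f 1 S0 + C exp (- r t)\<close> is integrated against \<open>v\<close>. It
  is one-sided, which suffices since the Wasserstein distance is a supremum.\<close>

lemma both_tangent_convergence:
  fixes Q
  assumes mixed: "mixed_type_kimura a b m" and Q: "kimura_semigroup a b m Q"
    and dual: "\<forall>t\<ge>0. \<forall>v. finite_measure v \<and> sets v = sets unit_borel \<longrightarrow> dual_image Q t v (Qdual t v)"
    and tan: "tangent a b m 0" "tangent a b m 1"
  shows "\<exists>S0. kimura_regular m S0 \<and> S0 0 = 0 \<and> S0 1 = 1 \<and>
           (\<forall>x\<in>{0..1}. kimura_op a b m S0 x = 0) \<and>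
           (\<exists>C>0. \<exists>r>0. \<forall>v. prob_space v \<and> sets v = sets unit_borel \<longrightarrow>
              exp_converges C r (\<lambda>t. Qdual t v)
                (endpoint_mixture (\<integral>x. 1 - S0 x \<partial>v) (\<integral>x. S0 x \<partial>v)))"
proof -
  obtain g \<kappa> where
    "boundary_operator (diffusion_coeff a m) (drift_coeff b m) g (b 0 / a 0) (b 1 / a 1) \<kappa> (m 0) (m 1)"
    using mixed_type_boundary_operator[OF mixed] .
  then interpret L: boundary_operator "diffusion_coeff a m" "drift_coeff b m" g "b 0 / a 0" "b 1 / a 1" \<kappa> "m 0" "m 1" .
  note p = tangent_0_coeffs[OF mixed tan(1)] and q = tangent_1_coeffs[OF mixed tan(2)]
  define S0 where "S0 = L.hitting"
  have m: "m 0 \<in> {1, 2}" "m 1 \<in> {1, 2}" using mixed by (auto simp: mixed_type_kimura_def)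
  have "{0..1} - quadratic_endpoints m \<subseteq> regular_points (b 0 / a 0) (b 1 / a 1)"
  proof
    fix x assume x: "x \<in> {0..1} - quadratic_endpoints m"
    have "x \<noteq> 0 \<or> m 0 = 1" "x \<noteq> 1 \<or> m 1 = 1"
      using x m by (auto simp: quadratic_endpoints_def)
    then show "x \<in> regular_points (b 0 / a 0) (b 1 / a 1)"
      using x p(3) q(3) by (auto simp: regular_points_def)
  qed
  then have reg: "kimura_regular m S0" unfolding S0_def by (rule L.hitting_regular[OF p(1) q(1)])
  have AB: "diffusion_coeff a m 0 = 0" "diffusion_coeff a m 1 = 0" using m by (auto simp: diffusion_coeff_def)
  have harm: "kimura_op a b m S0 x = 0" if "x \<in> {0..1}" for x
    unfolding kimura_op_coeffs S0_def by (rule L.hitting_harmonic[OF p(1) q(1) AB p(2) q(2) that])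
  have S0C: "S0 \<in> C_zero" using reg by (simp add: kimura_regular_def)
  have S0C': "(\<lambda>x. 1 - S0 x) \<in> C_zero" using S0C by (auto simp: C_zero_def intro!: continuous_intros)
  have S0_bounds: "0 \<le> S0 x" "S0 x \<le> 1" if "x \<in> {0..1}" for x
    using L.hitting_bounds(2)[OF p(1) q(1) that] by (auto simp: S0_def)
  obtain C r where C: "C > 0" and r: "r > 0" and decay:
    "\<forall>u. classical_solution (diffusion_coeff a m) (drift_coeff b m) u \<and> 1-lipschitz_on {0..1} (u 0) \<longrightarrow>
      (\<forall>t\<ge>0. \<forall>x\<in>{0..1}. u t x \<le> u 0 0 * (1 - S0 x) + u 0 1 * S0 x + C * exp (- r * t))"
    using L.both_tangent_decay[OF p(1) q(1) p(2) q(2)] unfolding S0_def by blast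
  have pointwise: "Q t f x \<le> f 0 * (1 - S0 x) + f 1 * S0 x + C * exp (- r * t)"
    if f: "1-lipschitz_on {0..1} f" and t: "t \<ge> 0" and x: "x \<in> {0..1}" for f t x
  proof -
    have fC: "f \<in> C_zero" by (rule lipschitz_C_zero[OF f])
    have "\<forall>f\<in>C_zero. \<forall>x\<in>{0..1}. Q 0 f x = f x" using Q by (simp add: kimura_semigroup_def)
    note Q0 = bspec[OF bspec[OF this fC]]
    have "1-lipschitz_on {0..1} (Q 0 f)"
      using f by (rule lipschitz_on_transform) (simp add: Q0)
    with decay semigroup_classical_solution[OF mixed Q fC]
    have "\<forall>t\<ge>0. \<forall>x\<in>{0..1}. Q t f x \<le> Q 0 f 0 * (1 - S0 x) + Q 0 f 1 * S0 x + C * exp (- r * t)"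
      by blast
    then show ?thesis using t x by (simp add: Q0)
  qed
  have "exp_converges C r (\<lambda>t. Qdual t v) (endpoint_mixture (\<integral>x. 1 - S0 x \<partial>v) (\<integral>x. S0 x \<partial>v))"
    if v: "prob_space v" "sets v = sets unit_borel" for v
    unfolding exp_converges_def
  proof (intro allI impI)
    fix t :: real assume t: "t > 0"
    interpret prob_space v by fact
    note int = C_zero_integrable[OF _ finite_measure_axioms v(2)] and sp = unit_borel_space[OF v(2)]
    have Qd: "(\<integral>y. f y \<partial>Qdual t v) = (\<integral>x. Q t f x \<partial>v)" if "f \<in> C_zero" for f
    proof -
      have "dual_image Q t v (Qdual t v)" using dual t v finite_measure_axioms by auto
      then show ?thesis using that by (simp add: dual_image_def)
    qed
    show "wasserstein (Qdual t v) (endpoint_mixture (\<integral>x. 1 - S0 x \<partial>v) (\<integral>x. S0 x \<partial>v)) \<le> C * exp (- r * t)"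
    proof (rule wasserstein_le)
      fix f :: "real \<Rightarrow> real" assume f: "1-lipschitz_on {0..1} f"
      have fC: "f \<in> C_zero" by (rule lipschitz_C_zero[OF f])
      have "\<forall>t\<ge>0. \<forall>f\<in>C_zero. Q t f \<in> C_zero" using Q by (simp add: kimura_semigroup_def)
      then have QC: "Q t f \<in> C_zero" using t fC by simp
      have "(\<integral>x. Q t f x \<partial>v) \<le> (\<integral>x. f 0 * (1 - S0 x) + f 1 * S0 x + C * exp (- r * t) \<partial>v)"
        using pointwise[OF f] t sp int[OF S0C] int[OF S0C'] by (intro integral_mono int[OF QC]) auto
      also have "\<dots> = f 0 * (\<integral>x. 1 - S0 x \<partial>v) + f 1 * (\<integral>x. S0 x \<partial>v) + C * exp (- r * t)"
        using int[OF S0C] int[OF S0C'] by (simp add: prob_space del: Bochner_Integration.integral_diff)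
      also have "f 0 * (\<integral>x. 1 - S0 x \<partial>v) + f 1 * (\<integral>x. S0 x \<partial>v)
          = (\<integral>x. f x \<partial>endpoint_mixture (\<integral>x. 1 - S0 x \<partial>v) (\<integral>x. S0 x \<partial>v))"
      proof -
        have "0 \<le> (\<integral>x. 1 - S0 x \<partial>v)" "0 \<le> (\<integral>x. S0 x \<partial>v)"
          using S0_bounds sp by (auto intro!: integral_nonneg_AE AE_I2)
        from endpoint_mixture_integral[OF this fC] show ?thesis by simp
      qed
      finally show "(\<integral>x. f x \<partial>Qdual t v) - (\<integral>x. f x \<partial>endpoint_mixture (\<integral>x. 1 - S0 x \<partial>v) (\<integral>x. S0 x \<partial>v)) \<le> C * exp (- r * t)"
        using Qd[OF fC] by simp
    qed
  qed
  moreover have "S0 0 = 0" "S0 1 = 1"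
    using L.hitting_endpoints[OF p(1) q(1)] by (auto simp: S0_def)
  ultimately show ?thesis using reg harm C r by blast
qed

lemma one_tangent_convergence:
  fixes Q
  assumes mixed: "mixed_type_kimura a b m" and Q: "kimura_semigroup a b m Q"
    and P: "\<forall>t\<ge>0. \<forall>x\<in>{0..1}. transition_probability Q t x (p t x)"
    and i: "i \<in> {0, 1}" and tan: "tangent a b m i" "\<not> tangent a b m (1 - i)"
  shows "\<forall>x\<in>{0..1} - quadratic_endpoints m. ((\<lambda>t. wasserstein (p t x) (dirac (real i))) \<longlongrightarrow> 0) at_top"
    and "\<not> neutral a b m (1 - i) \<Longrightarrow> \<exists>r>0. \<forall>x\<in>{0..1} - quadratic_endpoints m.
              \<exists>C>0. exp_converges C r (\<lambda>t. p t x) (dirac (real i))"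
proof -
  note dist = one_tangent_distance[OF mixed Q P i tan]
  have le: "wasserstein (p t x) (dirac (real i)) \<le> Q t (\<lambda>y. \<bar>y - real i\<bar>) x"
    and nonneg: "0 \<le> wasserstein (p t x) (dirac (real i))" if "t \<ge> 0" "x \<in> {0..1}" for t x
  proof -
    have tp: "transition_probability Q t x (p t x)" using P that by blast
    have e: "real i \<in> {0..1}" using i by auto
    show "wasserstein (p t x) (dirac (real i)) \<le> Q t (\<lambda>y. \<bar>y - real i\<bar>) x"
      by (rule wasserstein_dirac(1)[OF tp e])
    show "0 \<le> wasserstein (p t x) (dirac (real i))" by (rule wasserstein_dirac(2)[OF tp e])
  qed
  show "\<forall>x\<in>{0..1} - quadratic_endpoints m. ((\<lambda>t. wasserstein (p t x) (dirac (real i))) \<longlongrightarrow> 0) at_top"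
  proof (intro ballI order_tendstoI)
    fix x l :: real assume x: "x \<in> {0..1} - quadratic_endpoints m" and l: "l < 0"
    show "\<forall>\<^sub>F t in at_top. l < wasserstein (p t x) (dirac (real i))"
      using eventually_ge_at_top[of 0]
    proof eventually_elim
      case (elim t)
      then show ?case using nonneg[of t x] x l by simp
    qed
  next
    fix x e :: real assume x: "x \<in> {0..1} - quadratic_endpoints m" and e: "0 < e"
    have "e / 2 > 0" using e by simp
    from dist(1)[OF x this] eventually_ge_at_top[of 0]
    show "\<forall>\<^sub>F t in at_top. wasserstein (p t x) (dirac (real i)) < e"
    proof eventually_elim
      case (elim t)
      then show ?case using le[of t x] x e by simp
    qed
  qed
  assume "\<not> neutral a b m (1 - i)"
  then obtain r where r: "r > 0" and H: "\<And>x. x \<in> {0..1} - quadratic_endpoints m \<Longrightarrow>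
    \<exists>C. \<forall>t\<ge>0. Q t (\<lambda>y. \<bar>y - real i\<bar>) x \<le> C * exp (- r * t)"
    using dist(2) by blast
  have "\<exists>C>0. exp_converges C r (\<lambda>t. p t x) (dirac (real i))" if x: "x \<in> {0..1} - quadratic_endpoints m" for x
  proof -
    obtain C where C: "\<And>t. t \<ge> 0 \<Longrightarrow> Q t (\<lambda>y. \<bar>y - real i\<bar>) x \<le> C * exp (- r * t)"
      using H[OF x] by blast
    have "exp_converges (max C 1) r (\<lambda>t. p t x) (dirac (real i))"
      unfolding exp_converges_def
    proof (intro allI impI)
      fix t :: real assume t: "t > 0"
      have "wasserstein (p t x) (dirac (real i)) \<le> C * exp (- r * t)"
        using le[of t x] C[of t] x t by simp
      also have "\<dots> \<le> max C 1 * exp (- r * t)" by (intro mult_right_mono) auto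
      finally show "wasserstein (p t x) (dirac (real i)) \<le> max C 1 * exp (- r * t)" .
    qed
    moreover have "max C 1 > 0" by simp
    ultimately show ?thesis by blast
  qed
  then show "\<exists>r>0. \<forall>x\<in>{0..1} - quadratic_endpoints m.
      \<exists>C>0. exp_converges C r (\<lambda>t. p t x) (dirac (real i))" using r by blast
qed

theorem theorem4p1:
  fixes a b :: "real \<Rightarrow> real" and m :: "nat \<Rightarrow> nat"
    and Q :: "real \<Rightarrow> (real \<Rightarrow> real) \<Rightarrow> real \<Rightarrow> real"
    and p :: "real \<Rightarrow> real \<Rightarrow> real measure"
    and Qdual :: "real \<Rightarrow> real measure \<Rightarrow> real measure"
  assumes "mixed_type_kimura a b m"
    and "kimura_semigroup a b m Q"
    and "\<forall>t\<ge>0. \<forall>x\<in>{0..1}. transition_probability Q t x (p t x)"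
    and "\<forall>t\<ge>0. \<forall>v. finite_measure v \<and> sets v = sets unit_borel \<longrightarrow> dual_image Q t v (Qdual t v)"
  shows
    "(\<forall>i\<in>{0, 1}. tangent a b m i \<and> \<not> tangent a b m (1 - i) \<longrightarrow>
        (\<forall>x\<in>{0..1} - quadratic_endpoints m.
           ((\<lambda>t. wasserstein (p t x) (dirac (real i))) \<longlongrightarrow> 0) at_top) \<and>
        (\<not> neutral a b m (1 - i) \<longrightarrow>
           (\<exists>r>0. \<forall>x\<in>{0..1} - quadratic_endpoints m.
              \<exists>C>0. exp_converges C r (\<lambda>t. p t x) (dirac (real i))))) \<and>
     (tangent a b m 0 \<and> tangent a b m 1 \<longrightarrow>
        (\<exists>S0. kimura_regular m S0 \<and> S0 0 = 0 \<and> S0 1 = 1 \<and>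
           (\<forall>x\<in>{0..1}. kimura_op a b m S0 x = 0) \<and>
           (\<exists>C>0. \<exists>r>0. \<forall>v. prob_space v \<and> sets v = sets unit_borel \<longrightarrow>
              exp_converges C r (\<lambda>t. Qdual t v)
                (endpoint_mixture (\<integral>x. 1 - S0 x \<partial>v) (\<integral>x. S0 x \<partial>v)))))"
proof (rule conjI)
  show "\<forall>i\<in>{0, 1}. tangent a b m i \<and> \<not> tangent a b m (1 - i) \<longrightarrow>
        (\<forall>x\<in>{0..1} - quadratic_endpoints m.
           ((\<lambda>t. wasserstein (p t x) (dirac (real i))) \<longlongrightarrow> 0) at_top) \<and>
        (\<not> neutral a b m (1 - i) \<longrightarrow>
           (\<exists>r>0. \<forall>x\<in>{0..1} - quadratic_endpoints m.
              \<exists>C>0. exp_converges C r (\<lambda>t. p t x) (dirac (real i))))"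
  proof (rule ballI, rule impI, elim conjE)
    fix i :: nat assume i: "i \<in> {0, 1}" "tangent a b m i" "\<not> tangent a b m (1 - i)"
    note conv = one_tangent_convergence[OF assms(1-3) i]
    show "(\<forall>x\<in>{0..1} - quadratic_endpoints m.
           ((\<lambda>t. wasserstein (p t x) (dirac (real i))) \<longlongrightarrow> 0) at_top) \<and>
        (\<not> neutral a b m (1 - i) \<longrightarrow>
           (\<exists>r>0. \<forall>x\<in>{0..1} - quadratic_endpoints m.
              \<exists>C>0. exp_converges C r (\<lambda>t. p t x) (dirac (real i))))"
      by (rule conjI[OF conv(1)], rule impI, rule conv(2))
  qed
qed (rule impI, elim conjE, rule both_tangent_convergence[OF assms(1,2,4)])

end
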